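(* There exists an absolute constant $C>0$ such that for every $s>4$ and every divergence-free, axisymmetric, swirl-free vector field $u\in H^s(\mathbb{R}^4;\mathbb{R}^4)$ whose scalar vorticity $\omega$ satisfies $\frac{\omega}{r^2}\in L^{2,1}(r^2\,dr\,dz)$, we have $$\left\|\frac{u_r}{r}\right\|_{L^\infty}\leq C\left\|\frac{\omega}{r^2}\right\|_{L^{2,1}(r^2\,dr\,dz)}.$$
   Context: For $s\ge 0$, $H^s(\mathbb{R}^4)$ is the Hilbert space with norm $\|f\|_{H^s}^2=\int_{\mathbb{R}^4}(1+4\pi^2|\xi|^2)^s|\hat f(\xi)|^2\,d\xi$. Write $r=(x_1^2+x_2^2+x_3^2)^{1/2}$, $z=x_4$, $e_r=\frac1r(x_1,x_2,x_3,0)$, $e_z=(0,0,0,1)$. A vector field $u$ on $\mathbb{R}^4$ is axisymmetric, swirl-free if $u(x)=u_r(r,z)e_r+u_z(r,z)e_z$. Its scalar vorticity is $\omega(r,z)=\partial_r u_z-\partial_z u_r$. For a measure space $(X,\mu)$, $L^{2,1}(X,\mu)$ is the Lorentz space with quasinorm $\|f\|_{L^{2,1}}=2\int_0^\infty \mu(\{x:|f(x)|>\tau\})^{1/2}\,d\tau$. Here $L^{2,1}(r^2\,dr\,dz)$ refers to the half-plane $\{(r,z):r>0,\ z\in\mathbb{R}\}$ with measure $\mu(\Omega)=\int_\Omega r^2\,dr\,dz$. *)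

theory Defs
  imports "HOL-Analysis.Analysis" "HOL-Probability.Essential_Supremum"
begin

section \<open>Fourier transform and Sobolev spaces\<close>

definition L2 :: "('a::euclidean_space \<Rightarrow> complex) set" where
  "L2 = {f \<in> borel_measurable lborel. integrable lborel (\<lambda>x. (norm (f x))\<^sup>2)}"

text \<open>Meaningful for integrable \<open>f\<close>. The normalisation is the one for which \<open>\<partial>\<^sub>j\<close> becomes
  multiplication by \<open>2 \<pi> \<i> \<xi>\<^sub>j\<close>, matching the weight \<open>1 + 4 \<pi>\<^sup>2 |\<xi>|\<^sup>2\<close> below.\<close>

definition fourier_L1 :: "('a::euclidean_space \<Rightarrow> complex) \<Rightarrow> 'a \<Rightarrow> complex" where
  "fourier_L1 f \<xi> = (LINT x|lborel. cis (- 2 * pi * (x \<bullet> \<xi>)) * f x)"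

text \<open>The Fourier--Plancherel transform, as a relation because it is only determined almost
  everywhere: \<open>g\<close> is the \<open>L\<^sup>2\<close> limit of the transforms of the truncations of \<open>f\<close> to balls
  (which are integrable, balls having finite measure).\<close>

definition has_fourier_L2 ::
    "('a::euclidean_space \<Rightarrow> complex) \<Rightarrow> ('a \<Rightarrow> complex) \<Rightarrow> bool" where
  "has_fourier_L2 f g \<longleftrightarrow> f \<in> L2 \<and> g \<in> L2 \<and>
     ((\<lambda>R::real. \<integral>\<^sup>+ \<xi>. ennreal ((norm (g \<xi> -
          fourier_L1 (\<lambda>x. indicator (cball 0 R) x * f x) \<xi>))\<^sup>2) \<partial>lborel) \<longlongrightarrow> 0) at_top"

text \<open>\<open>Hs s\<close> is \<open>H\<^sup>s\<close> for \<open>s \<ge> 0\<close>: the functions of finite \<open>H\<^sup>s\<close> norm.\<close>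

definition Hs :: "real \<Rightarrow> ('a::euclidean_space \<Rightarrow> complex) set" where
  "Hs s = {f. \<exists>g. has_fourier_L2 f g \<and>
     (\<integral>\<^sup>+ \<xi>. ennreal ((1 + 4 * pi\<^sup>2 * (norm \<xi>)\<^sup>2) powr s * (norm (g \<xi>))\<^sup>2) \<partial>lborel) < \<infinity>}"

definition Hs_field :: "real \<Rightarrow> (real^4 \<Rightarrow> real^4) set" where
  "Hs_field s = {u. \<forall>i. (\<lambda>x. complex_of_real (u x $ i)) \<in> Hs s}"


section \<open>Axisymmetric vector fields without swirl\<close>

definition rad :: "real^4 \<Rightarrow> real" where
  "rad x = sqrt ((x$1)\<^sup>2 + (x$2)\<^sup>2 + (x$3)\<^sup>2)"

definition e_r :: "real^4 \<Rightarrow> real^4" where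
  "e_r x = (1 / rad x) *\<^sub>R vector [x$1, x$2, x$3, 0]"

definition e_z :: "real^4" where
  "e_z = vector [0, 0, 0, 1]"

text \<open>The components \<open>ur\<close>, \<open>uz\<close> are functions of \<open>(r, z)\<close> with \<open>r > 0\<close>, where \<open>u\<close> determines them.
  Nothing is required on the axis, where \<open>e_r\<close> is undefined.\<close>

definition axisymmetric_no_swirl ::
    "(real^4 \<Rightarrow> real^4) \<Rightarrow> (real \<Rightarrow> real \<Rightarrow> real) \<Rightarrow> (real \<Rightarrow> real \<Rightarrow> real) \<Rightarrow> bool" where
  "axisymmetric_no_swirl u ur uz \<longleftrightarrow>
     (\<forall>x. rad x > 0 \<longrightarrow> u x = ur (rad x) (x$4) *\<^sub>R e_r x + uz (rad x) (x$4) *\<^sub>R e_z)"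

definition scalar_vorticity ::
    "(real \<Rightarrow> real \<Rightarrow> real) \<Rightarrow> (real \<Rightarrow> real \<Rightarrow> real) \<Rightarrow> real \<Rightarrow> real \<Rightarrow> real" where
  "scalar_vorticity ur uz r z = deriv (\<lambda>\<rho>. uz \<rho> z) r - deriv (\<lambda>\<zeta>. ur r \<zeta>) z"

definition divergence :: "(real^4 \<Rightarrow> real^4) \<Rightarrow> real^4 \<Rightarrow> real" where
  "divergence u x = (\<Sum>i\<in>UNIV. deriv (\<lambda>t. u (x + t *\<^sub>R axis i 1) $ i) 0)"


section \<open>Lebesgue and Lorentz norms\<close>

definition ennreal_sqrt :: "ennreal \<Rightarrow> ennreal" where
  "ennreal_sqrt a = (if a = \<infinity> then \<infinity> else ennreal (sqrt (enn2real a)))"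

definition lorentz21_norm :: "'a measure \<Rightarrow> ('a \<Rightarrow> real) \<Rightarrow> ennreal" where
  "lorentz21_norm M f =
     2 * (\<integral>\<^sup>+ \<tau>\<in>{0<..}. ennreal_sqrt (emeasure M {x \<in> space M. \<bar>f x\<bar> > \<tau>}) \<partial>lborel)"

definition lorentz21 :: "'a measure \<Rightarrow> ('a \<Rightarrow> real) set" where
  "lorentz21 M = {f \<in> borel_measurable M. lorentz21_norm M f < \<infinity>}"

definition Linf_norm :: "'a measure \<Rightarrow> ('a \<Rightarrow> real) \<Rightarrow> ennreal" where
  "Linf_norm M f = esssup M (\<lambda>x. ennreal \<bar>f x\<bar>)"

text \<open>The half-plane \<open>{(r, z). r > 0}\<close> with the measure \<open>r\<^sup>2 dr dz\<close>.\<close>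

definition half_plane_measure :: "(real \<times> real) measure" where
  "half_plane_measure =
     density (restrict_space lborel ({0<..} \<times> UNIV)) (\<lambda>(r, z). ennreal (r\<^sup>2))"

text \<open>Elements of \<open>H\<^sup>s(\<real>\<^sup>4)\<close> are classes modulo null sets. For \<open>s > 4\<close> each class has exactly one
  continuous member, and that member is \<open>C\<^sup>2\<close> (Sobolev embedding). As usual, a Sobolev field is
  identified with this representative; quantifying over continuous \<open>u \<in> Hs_field s\<close> is thus
  quantifying over \<open>H\<^sup>s(\<real>\<^sup>4; \<real>\<^sup>4)\<close>. All derivatives in \<open>divergence\<close> and
  \<open>scalar_vorticity\<close> (for \<open>r > 0\<close>) then exist classically, so the default value
  of \<open>deriv\<close> at points of non-differentiability plays no role.\<close>

end

theory Submission
  imports Defs "HOL-Probability.Characteristic_Functions"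
begin

text \<open>Fix a point \<open>(p, q)\<close> of the half-plane and write \<open>w = z - q\<close>. Averaging the regularised Newtonian
  kernel \<open>1 / (|x - y|\<^sup>2 + e)\<close> of \<open>\<real>\<^sup>4\<close> over spheres, against a spherical harmonic of degree 1, and
  multiplying by \<open>r\<^sup>2\<close> gives an explicit function \<open>\<Psi>\<close> with
  \<open>\<partial>\<^sub>r\<^sub>r \<Psi> - (2 / r) \<partial>\<^sub>r \<Psi> + \<partial>\<^sub>z\<^sub>z \<Psi> = - \<beta>\<close>, where \<open>\<beta>\<close> concentrates at \<open>(p, q)\<close> as
  \<open>e\<close> tends to 0. Since \<open>\<partial>\<^sub>r u\<^sub>r + 2 u\<^sub>r / r + \<partial>\<^sub>z u\<^sub>z = 0\<close>,
  \<open>\<omega> \<partial>\<^sub>z \<Psi> + u\<^sub>r \<beta> = \<partial>\<^sub>r (u\<^sub>z \<partial>\<^sub>z \<Psi> - u\<^sub>r \<partial>\<^sub>r \<Psi>) - \<partial>\<^sub>z (u\<^sub>z \<partial>\<^sub>r \<Psi> + u\<^sub>r \<partial>\<^sub>z \<Psi>)\<close>. On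
  a box of size \<open>R\<close> the boundary terms are \<open>O(1/R)\<close>, because \<open>u\<close> is bounded and
  \<open>\<nabla>\<Psi> = O(R\<^bsup>-2\<^esup>)\<close>; so \<open>|u\<^sub>r(p, q)|\<close> is controlled by \<open>\<integral> |\<omega>| |\<partial>\<^sub>z \<Psi>| dr dz\<close>. Finally
  \<open>|\<partial>\<^sub>z \<Psi>| / p\<close> is bounded, uniformly in \<open>e\<close>, by a weight whose weak \<open>L\<^sup>2(r\<^sup>2 dr dz)\<close>
  quasinorm does not depend on \<open>p\<close> and \<open>q\<close>, and weak \<open>L\<^sup>2\<close> pairs with \<open>L\<^bsup>2,1\<^esup>\<close>.
  Sobolev regularity is used only to see that \<open>u\<close> is bounded and \<open>C\<^sup>1\<close>, which follows from
  Fourier inversion: the transforms of \<open>u\<close> and \<open>\<nabla>u\<close> are integrable.\<close>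

section \<open>The stream function of a regularised vortex ring\<close>

text \<open>\<open>sq_near\<close> and \<open>sq_far\<close> are the extreme values of the regularised squared distance along the
  sphere. With \<open>A\<close> their mean, \<open>\<Psi> = - r / p + A / (4 p\<^sup>2) (ln sq_far - ln sq_near)\<close>; the functions
  \<open>stream_r\<close>, \<open>stream_z\<close>, \<open>stream_rz\<close>, \<open>stream_rr\<close>, \<open>stream_zz\<close> are its partial derivatives, and
  \<open>bump\<close> is \<open>\<beta>\<close>. None of them is singular at \<open>r = 0\<close>.\<close>

definition sq_far :: "real \<Rightarrow> real \<Rightarrow> real \<Rightarrow> real \<Rightarrow> real" where
  "sq_far p e r w = (r + p)\<^sup>2 + w\<^sup>2 + e"
definition sq_near :: "real \<Rightarrow> real \<Rightarrow> real \<Rightarrow> real \<Rightarrow> real" where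
  "sq_near p e r w = (r - p)\<^sup>2 + w\<^sup>2 + e"
text \<open>The bracket shared by both first derivatives of \<open>\<Psi>\<close>, where it carries
  the factor \<open>r / (2 * p\<^sup>2)\<close> or \<open>w / (2 * p\<^sup>2)\<close>.
  Differentiating inside the logarithms contributes \<open>A / sq_far - A / sq_near\<close> to it,
  and because \<open>A = (sq_far + sq_near) / 2\<close> this is
  \<open>sq_near / (2 * sq_far) - sq_far / (2 * sq_near)\<close>.\<close>

definition stream_log :: "real \<Rightarrow> real \<Rightarrow> real \<Rightarrow> real \<Rightarrow> real" where
  "stream_log p e r w = ln (sq_far p e r w) - ln (sq_near p e r w)
     - sq_far p e r w / (2 * sq_near p e r w) + sq_near p e r w / (2 * sq_far p e r w)"
definition stream_r :: "real \<Rightarrow> real \<Rightarrow> real \<Rightarrow> real \<Rightarrow> real" where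
  "stream_r p e r w = r / (2 * p\<^sup>2) * stream_log p e r w + 4 * r\<^sup>2 * p / (sq_far p e r w * sq_near p e r w)"
definition stream_z :: "real \<Rightarrow> real \<Rightarrow> real \<Rightarrow> real \<Rightarrow> real" where
  "stream_z p e r w = w / (2 * p\<^sup>2) * stream_log p e r w"
definition stream_rz :: "real \<Rightarrow> real \<Rightarrow> real \<Rightarrow> real \<Rightarrow> real" where
  "stream_rz p e r w = 16 * w * r\<^sup>2 * p * (r\<^sup>2 - p\<^sup>2 - w\<^sup>2 - e) / (sq_far p e r w * sq_near p e r w)\<^sup>2"
definition stream_rr :: "real \<Rightarrow> real \<Rightarrow> real \<Rightarrow> real \<Rightarrow> real" where
  "stream_rr p e r w = stream_log p e r w / (2 * p\<^sup>2) + 8 * r * p / (sq_far p e r w * sq_near p e r w)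
     - 32 * r ^ 3 * p * (w\<^sup>2 + e) / (sq_far p e r w * sq_near p e r w)\<^sup>2"
definition stream_zz :: "real \<Rightarrow> real \<Rightarrow> real \<Rightarrow> real \<Rightarrow> real" where
  "stream_zz p e r w = stream_log p e r w / (2 * p\<^sup>2) + 32 * w\<^sup>2 * r ^ 3 * p / (sq_far p e r w * sq_near p e r w)\<^sup>2"
definition bump :: "real \<Rightarrow> real \<Rightarrow> real \<Rightarrow> real \<Rightarrow> real" where
  "bump p e r w = 32 * r ^ 3 * p * e / (sq_far p e r w * sq_near p e r w)\<^sup>2"

section \<open>Derivatives of the stream function and its differential equation\<close>

lemma sq_far_pos: "e > 0 \<Longrightarrow> sq_far p e r w > 0" and sq_near_pos: "e > 0 \<Longrightarrow> sq_near p e r w > 0"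
  unfolding sq_far_def sq_near_def by (simp_all add: add_nonneg_pos)

text \<open>The expression depends on \<open>t = u / v\<close> only: it is
  \<open>ln t - t / 2 + 1 / (2 * t)\<close>, whose derivative
  \<open>- (t - 1)\<^sup>2 / (2 * t\<^sup>2)\<close> has a double zero at \<open>t = 1\<close>. For
  the two squared distances the resulting factor \<open>(u x - v x)\<^sup>2\<close> is
  \<open>16 * r\<^sup>2 * p\<^sup>2\<close>, which makes the derivatives of
  \<open>stream_log\<close> small near the axis.\<close>

lemma has_derivative_log_ratio:
  fixes u v :: "real \<Rightarrow> real"
  assumes u: "(u has_real_derivative u') (at x)" and v: "(v has_real_derivative v') (at x)"
    and pos: "u x > 0" "v x > 0"
  shows "((\<lambda>x. ln (u x) - ln (v x) - u x / (2 * v x) + v x / (2 * u x)) has_real_derivative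
     (u x - v x)\<^sup>2 * (u x * v' - v x * u') / (2 * (u x * v x)\<^sup>2)) (at x)"
proof -
  have "((\<lambda>x. ln (u x) - ln (v x) - u x / (2 * v x) + v x / (2 * u x)) has_real_derivative
     u' / u x - v' / v x - (u' * (2 * v x) - u x * (2 * v')) / (2 * v x * (2 * v x))
      + (v' * (2 * u x) - v x * (2 * u')) / (2 * u x * (2 * u x))) (at x)"
  proof -
    have l: "((\<lambda>x. ln (f x)) has_real_derivative f' / f x) (at x)"
      if "(f has_real_derivative f') (at x)" "f x > 0" for f f'
      using that by (auto intro!: derivative_eq_intros)
    show ?thesis
      by (intro DERIV_add DERIV_diff l DERIV_divide DERIV_cmult u v) (use pos in auto)
  qed
  moreover have "u' / u x - v' / v x - (u' * (2 * v x) - u x * (2 * v')) / (2 * v x * (2 * v x))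
      + (v' * (2 * u x) - v x * (2 * u')) / (2 * u x * (2 * u x)) =
      (u x - v x)\<^sup>2 * (u x * v' - v x * u') / (2 * (u x * v x)\<^sup>2)"
    using pos by (simp add: field_simps power2_eq_square)
  ultimately show ?thesis by simp
qed

lemma sq_far_deriv_r: "((\<lambda>r. sq_far p e r w) has_real_derivative 2 * (r + p)) (at r)"
  and sq_near_deriv_r: "((\<lambda>r. sq_near p e r w) has_real_derivative 2 * (r - p)) (at r)"
  and sq_far_deriv_w: "((\<lambda>w. sq_far p e r w) has_real_derivative 2 * w) (at w)"
  and sq_near_deriv_w: "((\<lambda>w. sq_near p e r w) has_real_derivative 2 * w) (at w)"
  unfolding sq_far_def sq_near_def by (auto intro!: derivative_eq_intros)

lemma sq_far_minus_sq_near: "sq_far p e r w - sq_near p e r w = 4 * r * p"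
  unfolding sq_far_def sq_near_def by (simp add: power2_eq_square algebra_simps)

lemma stream_log_deriv_r:
  assumes "e > 0"
  shows "((\<lambda>r. stream_log p e r w) has_real_derivative
    32 * r\<^sup>2 * p ^ 3 * (r\<^sup>2 - p\<^sup>2 - w\<^sup>2 - e) / (sq_far p e r w * sq_near p e r w)\<^sup>2) (at r)"
proof -
  have *: "(sq_far p e r w - sq_near p e r w)\<^sup>2 * (sq_far p e r w * (2 * (r - p)) - sq_near p e r w * (2 * (r + p)))
     = 2 * (32 * r\<^sup>2 * p ^ 3 * (r\<^sup>2 - p\<^sup>2 - w\<^sup>2 - e))"
    unfolding sq_far_minus_sq_near by (simp add: sq_far_def sq_near_def power2_eq_square power3_eq_cube algebra_simps)
  have "((\<lambda>r. stream_log p e r w) has_real_derivative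
      (sq_far p e r w - sq_near p e r w)\<^sup>2 * (sq_far p e r w * (2 * (r - p)) - sq_near p e r w * (2 * (r + p)))
        / (2 * (sq_far p e r w * sq_near p e r w)\<^sup>2)) (at r)"
    unfolding stream_log_def
    by (rule has_derivative_log_ratio[OF sq_far_deriv_r sq_near_deriv_r sq_far_pos[OF assms] sq_near_pos[OF assms]])
  thus ?thesis unfolding * by (simp add: mult_ac)
qed

lemma stream_log_deriv_w:
  assumes "e > 0"
  shows "((\<lambda>w. stream_log p e r w) has_real_derivative
    64 * w * r ^ 3 * p ^ 3 / (sq_far p e r w * sq_near p e r w)\<^sup>2) (at w)"
proof -
  have "sq_far p e r w * (2 * w) - sq_near p e r w * (2 * w) = 2 * w * (sq_far p e r w - sq_near p e r w)"
    by (simp add: algebra_simps)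
  hence *: "(sq_far p e r w - sq_near p e r w)\<^sup>2 * (sq_far p e r w * (2 * w) - sq_near p e r w * (2 * w))
     = 2 * (64 * w * r ^ 3 * p ^ 3)"
    unfolding sq_far_minus_sq_near by (simp add: power2_eq_square power3_eq_cube algebra_simps)
  have "((\<lambda>w. stream_log p e r w) has_real_derivative
      (sq_far p e r w - sq_near p e r w)\<^sup>2 * (sq_far p e r w * (2 * w) - sq_near p e r w * (2 * w))
        / (2 * (sq_far p e r w * sq_near p e r w)\<^sup>2)) (at w)"
    unfolding stream_log_def
    by (rule has_derivative_log_ratio[OF sq_far_deriv_w sq_near_deriv_w sq_far_pos[OF assms] sq_near_pos[OF assms]])
  thus ?thesis unfolding * by (simp add: mult_ac)
qed

lemma sq_prod_deriv_r: "((\<lambda>r. sq_far p e r w * sq_near p e r w) has_real_derivative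
    4 * r * (r\<^sup>2 - p\<^sup>2 + w\<^sup>2 + e)) (at r)"
  by (rule derivative_eq_intros sq_far_deriv_r sq_near_deriv_r refl)+
    (simp add: sq_far_def sq_near_def power2_eq_square algebra_simps)

lemma sq_prod_deriv_w: "((\<lambda>w. sq_far p e r w * sq_near p e r w) has_real_derivative
    4 * w * (r\<^sup>2 + p\<^sup>2 + w\<^sup>2 + e)) (at w)"
  by (rule derivative_eq_intros sq_far_deriv_w sq_near_deriv_w refl)+
    (simp add: sq_far_def sq_near_def power2_eq_square algebra_simps)

lemma stream_z_deriv_r:
  assumes "e > 0" "p > 0"
  shows "((\<lambda>r. stream_z p e r w) has_real_derivative stream_rz p e r w) (at r)"
proof -
  have "w / (2 * p\<^sup>2) * (32 * r\<^sup>2 * p ^ 3 * (r\<^sup>2 - p\<^sup>2 - w\<^sup>2 - e) / (sq_far p e r w * sq_near p e r w)\<^sup>2) = stream_rz p e r w"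
  proof -
    define Q where "Q = r\<^sup>2 - p\<^sup>2 - w\<^sup>2 - e"
    define D where "D = (sq_far p e r w * sq_near p e r w)\<^sup>2"
    have "D > 0" using sq_far_pos[OF assms(1), of p r w] sq_near_pos[OF assms(1), of p r w] by (simp add: D_def)
    thus ?thesis using assms unfolding stream_rz_def Q_def[symmetric] D_def[symmetric]
      by (simp add: divide_simps power2_eq_square power3_eq_cube)
  qed
  thus ?thesis
    unfolding stream_z_def using DERIV_cmult[OF stream_log_deriv_r[OF assms(1)], of "w / (2 * p\<^sup>2)"] by metis
qed

lemma stream_z_deriv_w:
  assumes "e > 0" "p > 0"
  shows "((\<lambda>w. stream_z p e r w) has_real_derivative stream_zz p e r w) (at w)"
proof -
  have "((\<lambda>w. w / (2 * p\<^sup>2)) has_real_derivative 1 / (2 * p\<^sup>2)) (at w)"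
    by (intro DERIV_cdivide DERIV_ident)
  from DERIV_mult[OF this stream_log_deriv_w[OF assms(1)]]
  have "((\<lambda>w. stream_z p e r w) has_real_derivative
     1 / (2 * p\<^sup>2) * stream_log p e r w + 64 * w * r ^ 3 * p ^ 3 / (sq_far p e r w * sq_near p e r w)\<^sup>2 * (w / (2 * p\<^sup>2))) (at w)"
    unfolding stream_z_def .
  moreover have "1 / (2 * p\<^sup>2) * stream_log p e r w + 64 * w * r ^ 3 * p ^ 3 / (sq_far p e r w * sq_near p e r w)\<^sup>2 * (w / (2 * p\<^sup>2)) = stream_zz p e r w"
  proof -
    define D where "D = (sq_far p e r w * sq_near p e r w)\<^sup>2"
    have "D > 0" using sq_far_pos[OF assms(1), of p r w] sq_near_pos[OF assms(1), of p r w] by (simp add: D_def)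
    thus ?thesis using assms unfolding stream_zz_def D_def[symmetric]
      by (simp add: divide_simps power2_eq_square power3_eq_cube)
  qed
  ultimately show ?thesis by simp
qed

lemma stream_r_deriv_w:
  assumes "e > 0" "p > 0"
  shows "((\<lambda>w. stream_r p e r w) has_real_derivative stream_rz p e r w) (at w)"
proof -
  define D where "D = sq_far p e r w * sq_near p e r w"
  have D: "D > 0" using sq_far_pos sq_near_pos assms by (simp add: D_def)
  have "((\<lambda>w. stream_r p e r w) has_real_derivative
     r / (2 * p\<^sup>2) * (64 * w * r ^ 3 * p ^ 3 / D\<^sup>2)
     + (0 * D - (4 * r\<^sup>2 * p) * (4 * w * (r\<^sup>2 + p\<^sup>2 + w\<^sup>2 + e))) / (D * D)) (at w)"
    unfolding stream_r_def D_def
    by (intro DERIV_add DERIV_cmult DERIV_divide DERIV_const stream_log_deriv_w sq_prod_deriv_w)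
       (use D assms in \<open>auto simp: D_def\<close>)
  moreover have "r / (2 * p\<^sup>2) * (64 * w * r ^ 3 * p ^ 3 / D\<^sup>2)
     + (0 * D - (4 * r\<^sup>2 * p) * (4 * w * (r\<^sup>2 + p\<^sup>2 + w\<^sup>2 + e))) / (D * D) = stream_rz p e r w"
    unfolding stream_rz_def D_def[symmetric] using D assms
    by (simp add: divide_simps power2_eq_square power3_eq_cube) (simp add: algebra_simps)
  ultimately show ?thesis by simp
qed

lemma stream_r_deriv_r:
  assumes "e > 0" "p > 0"
  shows "((\<lambda>r. stream_r p e r w) has_real_derivative stream_rr p e r w) (at r)"
proof -
  define D where "D = sq_far p e r w * sq_near p e r w"
  have D: "D > 0" using sq_far_pos sq_near_pos assms by (simp add: D_def)
  have "((\<lambda>r. stream_r p e r w) has_real_derivative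
     (1 / (2 * p\<^sup>2) * stream_log p e r w +  32 * r\<^sup>2 * p ^ 3 * (r\<^sup>2 - p\<^sup>2 - w\<^sup>2 - e) / D\<^sup>2 * (r / (2 * p\<^sup>2)))
     + ((8 * r * p) * D - (4 * r\<^sup>2 * p) * (4 * r * (r\<^sup>2 - p\<^sup>2 + w\<^sup>2 + e))) / (D * D)) (at r)"
    unfolding stream_r_def D_def
    by (intro DERIV_add DERIV_mult DERIV_divide DERIV_cdivide DERIV_ident stream_log_deriv_r sq_prod_deriv_r)
       (use D assms in \<open>auto intro!: derivative_eq_intros simp: D_def\<close>)
  moreover have "(1 / (2 * p\<^sup>2) * stream_log p e r w +  32 * r\<^sup>2 * p ^ 3 * (r\<^sup>2 - p\<^sup>2 - w\<^sup>2 - e) / D\<^sup>2 * (r / (2 * p\<^sup>2)))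
     + ((8 * r * p) * D - (4 * r\<^sup>2 * p) * (4 * r * (r\<^sup>2 - p\<^sup>2 + w\<^sup>2 + e))) / (D * D) = stream_rr p e r w"
  proof -
    have "32 * r\<^sup>2 * p ^ 3 * (r\<^sup>2 - p\<^sup>2 - w\<^sup>2 - e) / D\<^sup>2 * (r / (2 * p\<^sup>2))
       = 16 * r ^ 3 * p * (r\<^sup>2 - p\<^sup>2 - w\<^sup>2 - e) / (D * D)"
    proof -
      define Q where "Q = r\<^sup>2 - p\<^sup>2 - w\<^sup>2 - e"
      show ?thesis unfolding Q_def[symmetric]
        using D assms by (simp add: divide_simps power2_eq_square power3_eq_cube)
    qed
    moreover have "((8 * r * p) * D - (4 * r\<^sup>2 * p) * (4 * r * (r\<^sup>2 - p\<^sup>2 + w\<^sup>2 + e))) / (D * D)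
       = 8 * r * p / D - 16 * r ^ 3 * p * (r\<^sup>2 - p\<^sup>2 + w\<^sup>2 + e) / (D * D)"
      using D by (simp add: diff_divide_distrib power2_eq_square power3_eq_cube mult_ac)
    moreover have "16 * r ^ 3 * p * (r\<^sup>2 - p\<^sup>2 - w\<^sup>2 - e) / (D * D) - 16 * r ^ 3 * p * (r\<^sup>2 - p\<^sup>2 + w\<^sup>2 + e) / (D * D)
       = - (32 * r ^ 3 * p * (w\<^sup>2 + e) / (D * D))"
      using D by (simp add: divide_simps) (simp add: algebra_simps)
    ultimately show ?thesis
      unfolding stream_rr_def D_def[symmetric] power2_eq_square[of D] by simp
  qed
  ultimately show ?thesis by simp
qed

lemma stream_axis: "stream_log p e 0 w = 0" "stream_r p e 0 w = 0" "stream_z p e 0 w = 0" "stream_rz p e 0 w = 0"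
  "stream_rr p e 0 w = 0" "stream_zz p e 0 w = 0" "bump p e 0 w = 0"
  unfolding stream_log_def stream_r_def stream_z_def stream_rz_def stream_rr_def stream_zz_def bump_def sq_far_def sq_near_def by auto

text \<open>The differential equation for \<open>\<Psi>\<close>, multiplied by \<open>r\<close> so
  that it makes sense on the axis. The terms of fourth order in the distances in
  \<open>stream_rr\<close> and \<open>stream_zz\<close> carry \<open>w\<^sup>2 + e\<close> and
  \<open>w\<^sup>2\<close> with opposite signs; what survives is the part with \<open>e\<close>,
  which is \<open>bump\<close>.\<close>

lemma stream_equation:
  assumes "p > 0" "e > 0"
  shows "r * (stream_rr p e r w + stream_zz p e r w) = 2 * stream_r p e r w - r * bump p e r w"
proof -
  define D where "D = sq_far p e r w * sq_near p e r w"
  have "32 * w\<^sup>2 * r ^ 3 * p / D\<^sup>2 - 32 * r ^ 3 * p * (w\<^sup>2 + e) / D\<^sup>2 = - (32 * r ^ 3 * p * e / D\<^sup>2)"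
    by (simp add: diff_divide_distrib[symmetric] algebra_simps flip: minus_divide_left)
  hence "stream_rr p e r w + stream_zz p e r w = 2 * (stream_log p e r w / (2 * p\<^sup>2)) + 8 * r * p / D - bump p e r w"
    unfolding stream_rr_def stream_zz_def bump_def D_def[symmetric] by simp
  hence "r * (stream_rr p e r w + stream_zz p e r w) = r * (2 * (stream_log p e r w / (2 * p\<^sup>2)) + 8 * r * p / D - bump p e r w)"
    by simp
  also have "\<dots> = 2 * stream_r p e r w - r * bump p e r w"
    unfolding stream_r_def D_def[symmetric] by (simp add: algebra_simps power2_eq_square)
  finally show ?thesis .
qed

text \<open>The identity of the overview at one point: \<open>a\<close>, \<open>b\<close> are the
  values of the radial and the axial velocity, \<open>ar\<close>, \<open>az\<close>,
  \<open>br\<close>, \<open>bz\<close> those of their derivatives, and the right-hand side is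
  grouped as the product rule delivers it. The mixed terms \<open>stream_rz * b\<close> cancel; the
  remainder vanishes by combining \<open>stream_equation\<close> with incompressibility.\<close>

lemma stream_divergence_identity:
  assumes "p > 0" "e > 0" "r > 0" "r * ar + 2 * a + r * bz = 0"
  shows "(br - az) * stream_z p e r w + a * bump p e r w =
    (br * stream_z p e r w + stream_rz p e r w * b - (ar * stream_r p e r w + stream_rr p e r w * a))
    + (- (bz * stream_r p e r w + stream_rz p e r w * b) - (az * stream_z p e r w + stream_zz p e r w * a))"
proof -
  have "r * (stream_rr p e r w + stream_zz p e r w + bump p e r w) = 2 * stream_r p e r w"
    using stream_equation[OF assms(1,2), of r w] by (simp add: algebra_simps)
  hence "r * (a * (stream_rr p e r w + stream_zz p e r w + bump p e r w) + (ar + bz) * stream_r p e r w)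
     = (2 * a + r * (ar + bz)) * stream_r p e r w"
  proof -
    have "r * (a * V + q * s) = (2 * a + r * q) * s" if "r * V = 2 * s" for V q s
      using arg_cong[OF that, of "(*) a"] by (simp add: algebra_simps)
    thus ?thesis using \<open>r * _ = _\<close> .
  qed
  also have "2 * a + r * (ar + bz) = 0" using assms(4) by (simp add: algebra_simps)
  finally have "a * (stream_rr p e r w + stream_zz p e r w + bump p e r w) + (ar + bz) * stream_r p e r w = 0"
    using assms by simp
  thus ?thesis by (simp add: algebra_simps)
qed

section \<open>Bounds on the stream function and the bump\<close>

text \<open>In both cases the difference of the two sides vanishes at 0 and is nondecreasing: its
  derivative is \<open>2 * t\<^sup>2 / (1 - t\<^sup>2)\<close> for the lower bound and
  \<open>4 * t\<^sup>2 / (1 - t\<^sup>2)\<^sup>2\<close> for the upper one.\<close>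

lemma ln_ratio_bounds:
  fixes x :: real assumes "0 \<le> x" "x < 1"
  shows "2 * x \<le> ln (1 + x) - ln (1 - x)" "ln (1 + x) - ln (1 - x) \<le> 2 * x / (1 - x\<^sup>2)"
proof -
  have pos: "1 - t\<^sup>2 > 0" if "0 \<le> t" "t \<le> x" for t
    using that assms by (simp add: abs_square_less_1)
  have "ln (1 + 0) - ln (1 - 0) - 2 * 0 \<le> ln (1 + x) - ln (1 - x) - 2 * x"
  proof (rule DERIV_nonneg_imp_nondecreasing[OF assms(1)])
    fix t assume t: "0 \<le> t" "t \<le> x"
    have "((\<lambda>x. ln (1 + x) - ln (1 - x) - 2 * x) has_real_derivative 2 * t\<^sup>2 / (1 - t\<^sup>2)) (at t)"
    proof -
      have "((\<lambda>x. ln (1 + x) - ln (1 - x) - 2 * x) has_real_derivative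
         1 / (1 + t) - (-1) / (1 - t) - 2) (at t)"
        using t assms by (auto intro!: derivative_eq_intros)
      moreover have "1 / (1 + t) - (-1) / (1 - t) - 2 = 2 * t\<^sup>2 / ((1 + t) * (1 - t))"
        using t assms by (simp add: divide_simps) (simp add: power2_eq_square algebra_simps)
      moreover have "(1 + t) * (1 - t) = 1 - t\<^sup>2" by (simp add: power2_eq_square algebra_simps)
      ultimately show ?thesis by simp
    qed
    thus "\<exists>y. ((\<lambda>x. ln (1 + x) - ln (1 - x) - 2 * x) has_real_derivative y) (at t) \<and> 0 \<le> y"
      using pos[OF t] by (intro exI[of _ "2 * t\<^sup>2 / (1 - t\<^sup>2)"]) auto
  qed
  thus "2 * x \<le> ln (1 + x) - ln (1 - x)" by simp
  have "2 * 0 / (1 - 0\<^sup>2) - (ln (1 + 0) - ln (1 - 0)) \<le> 2 * x / (1 - x\<^sup>2) - (ln (1 + x) - ln (1 - x))"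
  proof (rule DERIV_nonneg_imp_nondecreasing[OF assms(1)])
    fix t assume t: "0 \<le> t" "t \<le> x"
    have "((\<lambda>x. 2 * x / (1 - x\<^sup>2) - (ln (1 + x) - ln (1 - x))) has_real_derivative
       (2 * (1 - t\<^sup>2) - 2 * t * (- 2 * t)) / ((1 - t\<^sup>2) * (1 - t\<^sup>2)) - (1 / (1 + t) - (-1) / (1 - t))) (at t)"
    proof (intro DERIV_diff DERIV_divide)
      show "((\<lambda>x. 1 - x\<^sup>2) has_real_derivative (- 2 * t)) (at t)"
        by (auto intro!: derivative_eq_intros)
      show "((\<lambda>x. ln (1 + x)) has_real_derivative 1 / (1 + t)) (at t)"
        "((\<lambda>x. ln (1 - x)) has_real_derivative (-1) / (1 - t)) (at t)"
        using t assms by (auto intro!: derivative_eq_intros)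
    qed (use pos[OF t] in \<open>auto intro!: derivative_eq_intros\<close>)
    moreover have "1 / (1 + t) - (-1) / (1 - t) = 2 * (1 - t\<^sup>2) / ((1 - t\<^sup>2) * (1 - t\<^sup>2))"
    proof -
      have "1 - t\<^sup>2 = (1 + t) * (1 - t)" by (simp add: power2_eq_square algebra_simps)
      thus ?thesis using t assms by (simp add: divide_simps)
    qed
    ultimately have "((\<lambda>x. 2 * x / (1 - x\<^sup>2) - (ln (1 + x) - ln (1 - x))) has_real_derivative
       4 * t\<^sup>2 / ((1 - t\<^sup>2) * (1 - t\<^sup>2))) (at t)"
      by (simp add: diff_divide_distrib[symmetric] power2_eq_square)
    thus "\<exists>y. ((\<lambda>x. 2 * x / (1 - x\<^sup>2) - (ln (1 + x) - ln (1 - x))) has_real_derivative y) (at t) \<and> 0 \<le> y"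
      by (intro exI[of _ "4 * t\<^sup>2 / ((1 - t\<^sup>2) * (1 - t\<^sup>2))"]) auto
  qed
  thus "ln (1 + x) - ln (1 - x) \<le> 2 * x / (1 - x\<^sup>2)" by simp
qed

text \<open>If \<open>A\<close> is the mean of the two squared distances and
  \<open>x = 2 * r * p / A\<close>, they are \<open>A * (1 + x)\<close> and
  \<open>A * (1 - x)\<close>, so \<open>stream_log\<close> becomes
  \<open>ln (1 + x) - ln (1 - x) - 2 * x / (1 - x\<^sup>2)\<close>. Both parts agree with
  \<open>2 * x\<close> to first order; only the cubic quantity
  \<open>2 * x ^ 3 / (1 - x\<^sup>2)\<close> is left, and it supplies the decay at the axis and at
  infinity.\<close>

lemma stream_log_bounds:
  assumes "e > 0" "p > 0" "r \<ge> 0"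
  shows "stream_log p e r w \<le> 0"
    "- stream_log p e r w \<le> 16 * r ^ 3 * p ^ 3 / ((r\<^sup>2 + p\<^sup>2 + w\<^sup>2 + e) * (sq_far p e r w * sq_near p e r w))"
proof -
  define A where "A = r\<^sup>2 + p\<^sup>2 + w\<^sup>2 + e"
  define x where "x = 2 * r * p / A"
  have A: "A > 0" using assms unfolding A_def by (simp add: add_nonneg_pos)
  have uA: "sq_far p e r w = A * (1 + x)" and vA: "sq_near p e r w = A * (1 - x)"
    using A unfolding x_def sq_far_def sq_near_def by (simp_all add: field_simps) (simp_all add: A_def power2_eq_square algebra_simps)
  have x: "0 \<le> x" "x < 1"
    using assms A sq_near_pos[OF assms(1), of p r w] vA by (auto simp: x_def zero_less_mult_iff)
  have x2: "1 - x\<^sup>2 > 0" using x by (simp add: abs_square_less_1)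
  have eq: "1 - x\<^sup>2 = (1 - x) * (1 + x)" by (simp add: power2_eq_square algebra_simps)
  have Y: "stream_log p e r w = ln (1 + x) - ln (1 - x) - 2 * x / (1 - x\<^sup>2)"
  proof -
    have "sq_far p e r w / (2 * sq_near p e r w) - sq_near p e r w / (2 * sq_far p e r w) =
       (1 + x) / (2 * (1 - x)) - (1 - x) / (2 * (1 + x))"
      unfolding uA vA using A x by simp
    also have "\<dots> = 2 * x / (1 - x\<^sup>2)" unfolding eq using x
      by (simp add: divide_simps) (simp add: algebra_simps)
    finally have "sq_far p e r w / (2 * sq_near p e r w) - sq_near p e r w / (2 * sq_far p e r w) = 2 * x / (1 - x\<^sup>2)" .
    moreover have "ln (sq_far p e r w) - ln (sq_near p e r w) = ln (1 + x) - ln (1 - x)"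
      unfolding uA vA using A x by (simp add: ln_mult)
    ultimately show ?thesis unfolding stream_log_def by simp
  qed
  show "stream_log p e r w \<le> 0" using ln_ratio_bounds[OF x] Y by simp
  have "- stream_log p e r w \<le> 2 * x / (1 - x\<^sup>2) - 2 * x" using ln_ratio_bounds[OF x] Y by simp
  also have "\<dots> = 2 * x ^ 3 / (1 - x\<^sup>2)"
    using x2 by (simp add: divide_simps) (simp add: power2_eq_square power3_eq_cube algebra_simps)
  also have "\<dots> = 2 * (A * x) ^ 3 / (A * (A * (1 + x) * (A * (1 - x))))"
    unfolding eq using A x by (simp add: divide_simps power2_eq_square power3_eq_cube)
  also have "\<dots> = 16 * r ^ 3 * p ^ 3 / (A * (sq_far p e r w * sq_near p e r w))"
    unfolding uA[symmetric] vA[symmetric] using A by (simp add: x_def power_mult_distrib)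
  finally show "- stream_log p e r w \<le> 16 * r ^ 3 * p ^ 3 / ((r\<^sup>2 + p\<^sup>2 + w\<^sup>2 + e) * (sq_far p e r w * sq_near p e r w))"
    by (simp add: A_def)
qed

lemma sq_prod_ge:
  assumes "e > 0" "p > 0" "r \<ge> 0"
  shows "(r\<^sup>2 + p\<^sup>2 + w\<^sup>2) * ((r - p)\<^sup>2 + w\<^sup>2) \<le> sq_far p e r w * sq_near p e r w"
proof (rule mult_mono)
  show "r\<^sup>2 + p\<^sup>2 + w\<^sup>2 \<le> sq_far p e r w" using assms by (simp add: sq_far_def power2_sum)
qed (use assms sq_far_pos[of e p r w] in \<open>auto simp: sq_near_def less_imp_le\<close>)

lemma stream_z_bound:
  assumes "e > 0" "p > 0" "r \<ge> 0"
  shows "\<bar>stream_z p e r w\<bar> \<le> 8 * \<bar>w\<bar> * r ^ 3 * p / ((r\<^sup>2 + p\<^sup>2 + w\<^sup>2)\<^sup>2 * ((r - p)\<^sup>2 + w\<^sup>2))"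
proof (cases "w = 0")
  case False
  hence pos: "(r - p)\<^sup>2 + w\<^sup>2 > 0" by (simp add: add_nonneg_pos)
  have "r\<^sup>2 + p\<^sup>2 + w\<^sup>2 > 0" using assms by (simp add: add_nonneg_pos add_pos_nonneg)
  note pos = pos this
  have D: "sq_far p e r w * sq_near p e r w > 0" using sq_far_pos sq_near_pos assms by simp
  have "\<bar>stream_z p e r w\<bar> = \<bar>w\<bar> / (2 * p\<^sup>2) * (- stream_log p e r w)"
    using stream_log_bounds(1)[OF assms, of w] by (simp add: stream_z_def abs_mult)
  also have "\<dots> \<le> \<bar>w\<bar> / (2 * p\<^sup>2) * (16 * r ^ 3 * p ^ 3 / ((r\<^sup>2 + p\<^sup>2 + w\<^sup>2 + e) * (sq_far p e r w * sq_near p e r w)))"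
    by (intro mult_left_mono stream_log_bounds assms) simp
  also have "\<dots> = 8 * \<bar>w\<bar> * r ^ 3 * p / ((r\<^sup>2 + p\<^sup>2 + w\<^sup>2 + e) * (sq_far p e r w * sq_near p e r w))"
    using assms by (simp add: power2_eq_square power3_eq_cube)
  also have "\<dots> \<le> 8 * \<bar>w\<bar> * r ^ 3 * p / ((r\<^sup>2 + p\<^sup>2 + w\<^sup>2) * ((r\<^sup>2 + p\<^sup>2 + w\<^sup>2) * ((r - p)\<^sup>2 + w\<^sup>2)))"
    by (intro divide_left_mono mult_mono sq_prod_ge mult_pos_pos) (use assms pos D sq_far_pos[OF assms(1), of p r w] sq_near_pos[OF assms(1), of p r w] in \<open>auto simp: sq_near_def sq_far_def power2_sum\<close>)
  finally show ?thesis by (simp add: power2_eq_square mult.assoc)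
qed (simp add: stream_z_def)

text \<open>The right-hand side is \<open>p\<close> times \<open>ring_weight p 0 (r, w)\<close>.
  With \<open>a\<close> and \<open>d\<close> the two square roots, it follows from
  \<open>stream_z_bound\<close> by \<open>r \<le> a\<close> and
  \<open>\<bar>w\<bar> \<le> d\<close>.\<close>

lemma stream_z_le_weight:
  assumes "e > 0" "p > 0" "r \<ge> 0"
  shows "\<bar>stream_z p e r w\<bar> \<le> p * (8 / (sqrt (r\<^sup>2 + p\<^sup>2 + w\<^sup>2) * sqrt ((r - p)\<^sup>2 + w\<^sup>2)))"
proof -
  define a where "a = sqrt (r\<^sup>2 + p\<^sup>2 + w\<^sup>2)"
  define d where "d = sqrt ((r - p)\<^sup>2 + w\<^sup>2)"
  have sq: "a\<^sup>2 = r\<^sup>2 + p\<^sup>2 + w\<^sup>2" "d\<^sup>2 = (r - p)\<^sup>2 + w\<^sup>2" unfolding a_def d_def by auto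
  have a: "a > 0" unfolding a_def using assms by (simp add: add_nonneg_pos add_pos_nonneg)
  have ra: "r \<le> a" unfolding a_def by (rule real_le_rsqrt) simp
  have wd: "\<bar>w\<bar> \<le> d" unfolding d_def by (rule real_le_rsqrt) simp
  show ?thesis
  proof (cases "d = 0")
    case True
    hence "w = 0" using wd by simp
    thus ?thesis using assms by (simp add: stream_z_def)
  next
    case False
    hence d: "d > 0" using wd by simp
    have "\<bar>stream_z p e r w\<bar> \<le> 8 * \<bar>w\<bar> * r ^ 3 * p / ((a\<^sup>2)\<^sup>2 * d\<^sup>2)"
      using stream_z_bound[OF assms, of w] by (simp add: sq)
    also have "\<dots> \<le> 8 * d * a ^ 3 * p / ((a\<^sup>2)\<^sup>2 * d\<^sup>2)"
      using assms a d ra wd by (intro divide_right_mono mult_right_mono mult_mono power_mono) auto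
    also have "\<dots> = p * (8 / (a * d))"
      using a d by (simp add: divide_simps power2_eq_square power3_eq_cube)
    finally show ?thesis by (simp add: a_def d_def)
  qed
qed

text \<open>Together with \<open>stream_r_far\<close>, this is the inverse square decay that
  controls the boundary terms on a large box; \<open>q\<close> is any positive lower bound for the
  squared distance to \<open>(p, 0)\<close>.\<close>

lemma stream_z_far:
  assumes "e > 0" "p > 0" "r \<ge> 0" "0 < q" "q \<le> (r - p)\<^sup>2 + w\<^sup>2"
  shows "\<bar>stream_z p e r w\<bar> \<le> 8 * p / q"
proof -
  define a where "a = sqrt (r\<^sup>2 + p\<^sup>2 + w\<^sup>2)"
  have sq: "a\<^sup>2 = r\<^sup>2 + p\<^sup>2 + w\<^sup>2" unfolding a_def by auto
  have a: "a > 0" unfolding a_def using assms by (simp add: add_nonneg_pos add_pos_nonneg)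
  have ra: "r \<le> a" unfolding a_def by (rule real_le_rsqrt) simp
  have wa: "\<bar>w\<bar> \<le> a" unfolding a_def by (rule real_le_rsqrt) simp
  have "\<bar>stream_z p e r w\<bar> \<le> 8 * \<bar>w\<bar> * r ^ 3 * p / ((a\<^sup>2)\<^sup>2 * ((r - p)\<^sup>2 + w\<^sup>2))"
    using stream_z_bound[OF assms(1-3), of w] by (simp add: sq)
  also have "\<dots> \<le> 8 * a * a ^ 3 * p / ((a\<^sup>2)\<^sup>2 * q)"
    using assms a ra wa by (intro frac_le mult_right_mono mult_mono power_mono) auto
  also have "\<dots> = 8 * p / q"
    using a assms by (simp add: divide_simps power2_eq_square power3_eq_cube)
  finally show ?thesis .
qed

text \<open>The two summands of \<open>stream_r\<close> have opposite signs. The logarithmic one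
  lies between \<open>- 8 * r\<^sup>2 * p / D\<close> and 0, the other one is
  \<open>4 * r\<^sup>2 * p / D\<close>, so the sum is at most \<open>8 * r\<^sup>2 * p / D\<close>
  in absolute value.\<close>

lemma stream_r_far:
  assumes "e > 0" "p > 0" "r \<ge> 0" "0 < q" "q \<le> (r - p)\<^sup>2 + w\<^sup>2"
  shows "\<bar>stream_r p e r w\<bar> \<le> 8 * p / q"
proof -
  define A where "A = r\<^sup>2 + p\<^sup>2 + w\<^sup>2 + e"
  define D where "D = sq_far p e r w * sq_near p e r w"
  have D: "D > 0" using sq_far_pos sq_near_pos assms by (simp add: D_def)
  have A: "A > 0" "r\<^sup>2 \<le> A" using assms unfolding A_def by (auto simp: add_nonneg_pos)
  have B: "r\<^sup>2 + p\<^sup>2 + w\<^sup>2 > 0" using assms by (simp add: add_nonneg_pos add_pos_nonneg)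
  have "r / (2 * p\<^sup>2) * (- stream_log p e r w) \<le> r / (2 * p\<^sup>2) * (16 * r ^ 3 * p ^ 3 / (A * D))"
    unfolding A_def D_def using assms by (intro mult_left_mono stream_log_bounds assms) simp
  also have "\<dots> = (8 * r\<^sup>2 * p / D) * (r\<^sup>2 / A)"
    using assms by (simp add: power2_eq_square power3_eq_cube mult_ac)
  also have "\<dots> \<le> (8 * r\<^sup>2 * p / D) * 1"
    using A D assms by (intro mult_left_mono) auto
  finally have 1: "r / (2 * p\<^sup>2) * (- stream_log p e r w) \<le> 8 * r\<^sup>2 * p / D" by simp
  have 2: "r / (2 * p\<^sup>2) * (- stream_log p e r w) \<ge> 0" 
    using stream_log_bounds(1)[OF assms(1-3), of w] assms by (intro mult_nonneg_nonneg) auto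
  have "0 \<le> 4 * r\<^sup>2 * p / D" "4 * r\<^sup>2 * p / D \<le> 8 * r\<^sup>2 * p / D"
    using D assms by (auto intro!: divide_right_mono)
  hence "\<bar>stream_r p e r w\<bar> \<le> 8 * r\<^sup>2 * p / D"
    using 1 2 unfolding stream_r_def D_def by simp
  also have "\<dots> \<le> 8 * (r\<^sup>2 + p\<^sup>2 + w\<^sup>2) * p / ((r\<^sup>2 + p\<^sup>2 + w\<^sup>2) * q)"
  proof (rule frac_le)
    have "(r\<^sup>2 + p\<^sup>2 + w\<^sup>2) * q \<le> (r\<^sup>2 + p\<^sup>2 + w\<^sup>2) * ((r - p)\<^sup>2 + w\<^sup>2)"
      using assms by (intro mult_left_mono) auto
    also have "\<dots> \<le> D" unfolding D_def by (rule sq_prod_ge) (use assms in auto)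
    finally show "(r\<^sup>2 + p\<^sup>2 + w\<^sup>2) * q \<le> D" .
  qed (use assms B in auto)
  also have "\<dots> = 8 * p / q"
  proof -
    have "8 * X * p / (X * q) = 8 * p / q" if "X > 0" for X using that by simp
    from this[OF B] show ?thesis .
  qed
  finally show ?thesis .
qed

lemma bump_nonneg: "e > 0 \<Longrightarrow> p > 0 \<Longrightarrow> r \<ge> 0 \<Longrightarrow> bump p e r w \<ge> 0"
  by (simp add: bump_def)

text \<open>Away from \<open>(p, 0)\<close> the bump tends to 0 with \<open>e\<close>, uniformly:
  \<open>sq_far\<close> is at least \<open>(r + p)\<^sup>2\<close>, and this absorbs the growth of
  \<open>r ^ 3 * p\<close>.\<close>

lemma bump_far:
  assumes "e > 0" "p > 0" "r \<ge> 0" "0 < q" "q \<le> (r - p)\<^sup>2 + w\<^sup>2"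
  shows "bump p e r w \<le> 32 * e / q\<^sup>2"
proof -
  have B: "(r + p)\<^sup>2 > 0" using assms by simp
  have r: "r ^ 3 * p \<le> (r + p) ^ 3 * (r + p)" using assms by (intro mult_mono power_mono) auto
  have "(r + p)\<^sup>2 * q \<le> sq_far p e r w * sq_near p e r w"
    unfolding sq_far_def sq_near_def using assms by (intro mult_mono) auto
  hence "((r + p)\<^sup>2 * q)\<^sup>2 \<le> (sq_far p e r w * sq_near p e r w)\<^sup>2"
    using assms by (intro power_mono) auto
  hence "bump p e r w \<le> 32 * ((r + p) ^ 3 * (r + p)) * e / ((r + p)\<^sup>2 * q)\<^sup>2"
    unfolding bump_def using assms B r
    by (intro frac_le) (auto intro!: mult_right_mono)
  also have "\<dots> = 32 * e / q\<^sup>2"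
    using B assms by (simp add: divide_simps power2_eq_square power3_eq_cube)
  finally show ?thesis .
qed

text \<open>With \<open>e = h\<^sup>2\<close> the bump has height of order
  \<open>1 / h\<^sup>2\<close> on a square of area \<open>4 * h\<^sup>2\<close>, so its mass there
  stays bounded below as \<open>h\<close> tends to 0. The number 441 is
  \<open>(7 * 3)\<^sup>2\<close>, from the bounds on \<open>sq_far\<close> and
  \<open>sq_near\<close>.\<close>

lemma bump_near:
  assumes "h > 0" "p \<ge> 2 * h" "\<bar>r - p\<bar> \<le> h" "\<bar>w\<bar> \<le> h"
  shows "bump p (h\<^sup>2) r w \<ge> 4 / (441 * h\<^sup>2)"
proof -
  have p: "p > 0" and r: "r \<ge> p / 2" using assms by auto
  have w2: "w\<^sup>2 \<le> h\<^sup>2" and d2: "(r - p)\<^sup>2 \<le> h\<^sup>2"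
    using assms by (metis abs_ge_zero power2_abs power_mono)+
  have h2: "h\<^sup>2 \<le> (p / 2)\<^sup>2" using assms by (intro power_mono) auto
  have "(r + p)\<^sup>2 \<le> (5 / 2 * p)\<^sup>2" using assms p by (intro power_mono) auto
  \<comment> \<open>\<open>r + p \<le> 5 / 2 * p\<close> contributes \<open>25 / 4\<close>, while
    \<open>w\<^sup>2\<close> and \<open>e\<close> contribute at most \<open>1 / 4\<close> each, in
    units of \<open>p\<^sup>2\<close>; 7 is the sum rounded up.\<close>
  hence u: "sq_far p (h\<^sup>2) r w \<le> 7 * p\<^sup>2"
  proof -
    have "(5 / 2 * p)\<^sup>2 = 25 / 4 * p\<^sup>2" "(p / 2)\<^sup>2 = p\<^sup>2 / 4"
      by (simp_all add: power2_eq_square)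
    with \<open>(r + p)\<^sup>2 \<le> (5 / 2 * p)\<^sup>2\<close> show ?thesis
      unfolding sq_far_def using w2 h2 zero_le_power2[of p] by linarith
  qed
  have v: "sq_near p (h\<^sup>2) r w \<le> 3 * h\<^sup>2" unfolding sq_near_def using w2 d2 by simp
  have uv: "sq_far p (h\<^sup>2) r w * sq_near p (h\<^sup>2) r w \<le> 7 * p\<^sup>2 * (3 * h\<^sup>2)"
    using u v sq_far_pos[of "h\<^sup>2" p r w] sq_near_pos[of "h\<^sup>2" p r w] assms by (intro mult_mono) auto
  have uvp: "sq_far p (h\<^sup>2) r w * sq_near p (h\<^sup>2) r w > 0"
    using sq_far_pos[of "h\<^sup>2" p r w] sq_near_pos[of "h\<^sup>2" p r w] assms by simp
  have "4 / (441 * h\<^sup>2) = 32 * (p / 2) ^ 3 * p * h\<^sup>2 / (7 * p\<^sup>2 * (3 * h\<^sup>2))\<^sup>2"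
    using p assms by (simp add: divide_simps power2_eq_square power3_eq_cube)
  also have "\<dots> \<le> bump p (h\<^sup>2) r w"
    unfolding bump_def using p r uv uvp
    by (intro frac_le mult_right_mono mult_left_mono power_mono) auto
  finally show ?thesis .
qed

section \<open>Integration by parts on a box\<close>

lemma continuous_sq_far: "continuous_on A (\<lambda>x. sq_far p e (fst x) (snd x))"
  and continuous_sq_near: "continuous_on A (\<lambda>x. sq_near p e (fst x) (snd x))"
  unfolding sq_far_def sq_near_def by (intro continuous_intros)+

lemma continuous_stream:
  assumes "e > 0" "p > 0"
  shows "continuous_on A (\<lambda>x. stream_r p e (fst x) (snd x))"
    "continuous_on A (\<lambda>x. stream_z p e (fst x) (snd x))"
    "continuous_on A (\<lambda>x. stream_rz p e (fst x) (snd x))"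
    "continuous_on A (\<lambda>x. stream_rr p e (fst x) (snd x))"
    "continuous_on A (\<lambda>x. stream_zz p e (fst x) (snd x))"
    "continuous_on A (\<lambda>x. bump p e (fst x) (snd x))"
proof -
  have ne: "sq_far p e r w \<noteq> 0" "sq_near p e r w \<noteq> 0" for r w
    using sq_far_pos[OF assms(1), of p r w] sq_near_pos[OF assms(1), of p r w] by auto
  have Y: "continuous_on A (\<lambda>x. stream_log p e (fst x) (snd x))"
    unfolding stream_log_def by (intro continuous_intros continuous_sq_far continuous_sq_near) (use ne in auto)
  show "continuous_on A (\<lambda>x. stream_r p e (fst x) (snd x))"
    "continuous_on A (\<lambda>x. stream_z p e (fst x) (snd x))"
    "continuous_on A (\<lambda>x. stream_rz p e (fst x) (snd x))"
    "continuous_on A (\<lambda>x. stream_rr p e (fst x) (snd x))"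
    "continuous_on A (\<lambda>x. stream_zz p e (fst x) (snd x))"
    "continuous_on A (\<lambda>x. bump p e (fst x) (snd x))"
    unfolding stream_r_def stream_z_def stream_rz_def stream_rr_def stream_zz_def bump_def
    by (intro continuous_intros continuous_sq_far continuous_sq_near Y; use ne assms in simp)+
qed

text \<open>The divergence theorem for a field with one component: after exchanging the
  integrations, the fundamental theorem leaves only the values of \<open>P\<close> on two opposite
  edges.\<close>

lemma integral_box_deriv_fst:
  fixes P f :: "real \<Rightarrow> real \<Rightarrow> real"
  assumes c: "continuous_on UNIV (\<lambda>x. f (fst x) (snd x))" and "a \<le> b" "c \<le> d"
    and P: "\<And>r w. ((\<lambda>r. P r w) has_real_derivative f r w) (at r)"
    and B: "\<And>w. c \<le> w \<Longrightarrow> w \<le> d \<Longrightarrow> \<bar>P b w - P a w\<bar> \<le> B"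
  shows "\<bar>integral (cbox (a, c) (b, d)) (\<lambda>x. f (fst x) (snd x))\<bar> \<le> B * (d - c)"
proof -
  have c': "continuous_on (cbox (c, a) (d, b)) (\<lambda>x. f (snd x) (fst x))"
    using continuous_on_compose2[OF c, of "cbox (c, a) (d, b)" "\<lambda>x. (snd x, fst x)"]
    by (simp add: continuous_on_Pair continuous_on_snd continuous_on_fst continuous_on_id)
  have "integral (cbox (a, c) (b, d)) (\<lambda>x. f (fst x) (snd x)) =
     integral (cbox a b) (\<lambda>r. integral (cbox c d) (\<lambda>w. f r w))"
    using integral_prod_continuous[OF continuous_on_subset[OF c subset_UNIV], of a c b d] by simp
  also have "\<dots> = integral (cbox c d) (\<lambda>w. integral (cbox a b) (\<lambda>r. f r w))"
    by (rule integral_swap_continuous)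
       (use continuous_on_subset[OF c subset_UNIV] in \<open>simp add: case_prod_unfold\<close>)
  also have "\<bar>\<dots>\<bar> \<le> B * (d - c)"
  proof -
    have "integral (cbox a b) (\<lambda>r. f r w) = P b w - P a w" for w
    proof -
      have "((\<lambda>r. P r w) has_vector_derivative f r w) (at r within {a..b})" for r
        using P[of w r] has_field_derivative_at_within has_real_derivative_iff_has_vector_derivative by blast
      from fundamental_theorem_of_calculus[OF assms(2) this] show ?thesis
        by (simp add: integral_unique)
    qed
    moreover have "continuous_on (cbox c d) (\<lambda>w. integral (cbox a b) (\<lambda>r. f r w))"
      by (rule integral_continuous_on_param)
         (use c' in \<open>simp add: case_prod_unfold cbox_Pair_eq\<close>)
    ultimately show ?thesis
      using integral_bound[OF assms(3), of "\<lambda>w. integral (cbox a b) (\<lambda>r. f r w)" B] B by simp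
  qed
  finally show ?thesis .
qed

lemma integral_box_deriv_snd:
  fixes P f :: "real \<Rightarrow> real \<Rightarrow> real"
  assumes c: "continuous_on UNIV (\<lambda>x. f (fst x) (snd x))" and "a \<le> b" "c \<le> d"
    and P: "\<And>r w. ((\<lambda>w. P r w) has_real_derivative f r w) (at w)"
    and B: "\<And>r. a \<le> r \<Longrightarrow> r \<le> b \<Longrightarrow> \<bar>P r d - P r c\<bar> \<le> B"
  shows "\<bar>integral (cbox (a, c) (b, d)) (\<lambda>x. f (fst x) (snd x))\<bar> \<le> B * (b - a)"
proof -
  have "continuous_on UNIV (\<lambda>x. f (snd x) (fst x))"
    using continuous_on_compose2[OF c, of UNIV "\<lambda>x. (snd x, fst x)"]
    by (simp add: continuous_on_Pair continuous_on_snd continuous_on_fst continuous_on_id)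
  hence "\<bar>integral (cbox (c, a) (d, b)) (\<lambda>x. f (snd x) (fst x))\<bar> \<le> B * (b - a)"
    by (rule integral_box_deriv_fst[of "\<lambda>w r. f r w" c d a b "\<lambda>w r. P r w", OF _ assms(3,2) P B])
  moreover have "integral (cbox (a, c) (b, d)) (\<lambda>x. f (fst x) (snd x)) =
      integral (cbox (c, a) (d, b)) (\<lambda>x. f (snd x) (fst x))"
    using integral_swap_2dim[of a c b d f] continuous_on_subset[OF c subset_UNIV]
    by (simp add: case_prod_unfold)
  ultimately show ?thesis by simp
qed

text \<open>Here \<open>a\<close> and \<open>b\<close> stand for the radial and the axial velocity.
  By \<open>stream_divergence_identity\<close> the integrand is the divergence of
  \<open>(P, Q)\<close>, the two fluxes defined in the proof, so only the boundary of the box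
  counts.\<close>

lemma box_integral_bound:
  fixes a b ar az br bz :: "real \<Rightarrow> real \<Rightarrow> real"
  assumes p: "p > 0" and e: "e > 0" and R: "R \<ge> 2 * p"
    and a_r: "\<And>r w. ((\<lambda>r. a r w) has_real_derivative ar r w) (at r)"
    and a_z: "\<And>r w. ((\<lambda>w. a r w) has_real_derivative az r w) (at w)"
    and b_r: "\<And>r w. ((\<lambda>r. b r w) has_real_derivative br r w) (at r)"
    and b_z: "\<And>r w. ((\<lambda>w. b r w) has_real_derivative bz r w) (at w)"
    and cont: "continuous_on UNIV (\<lambda>x. a (fst x) (snd x))" "continuous_on UNIV (\<lambda>x. b (fst x) (snd x))"
      "continuous_on UNIV (\<lambda>x. ar (fst x) (snd x))" "continuous_on UNIV (\<lambda>x. az (fst x) (snd x))"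
      "continuous_on UNIV (\<lambda>x. br (fst x) (snd x))" "continuous_on UNIV (\<lambda>x. bz (fst x) (snd x))"
    and div: "\<And>r w. r > 0 \<Longrightarrow> r * ar r w + 2 * a r w + r * bz r w = 0"
    and aM: "\<And>r w. \<bar>a r w\<bar> \<le> M" and bM: "\<And>r w. \<bar>b r w\<bar> \<le> M"
  shows "\<bar>integral (cbox (0, -R) (R, R)) (\<lambda>x. (br (fst x) (snd x) - az (fst x) (snd x)) * stream_z p e (fst x) (snd x)
      + a (fst x) (snd x) * bump p e (fst x) (snd x))\<bar> \<le> 256 * M * p / R"
proof -
  define f where "f r w = br r w * stream_z p e r w + stream_rz p e r w * b r w - (ar r w * stream_r p e r w + stream_rr p e r w * a r w)" for r w
  define g where "g r w = - (bz r w * stream_r p e r w + stream_rz p e r w * b r w) - (az r w * stream_z p e r w + stream_zz p e r w * a r w)" for r w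
  define P where "P r w = b r w * stream_z p e r w - a r w * stream_r p e r w" for r w
  define Q where "Q r w = - (b r w * stream_r p e r w) - a r w * stream_z p e r w" for r w
  note k = continuous_stream[OF e p]
  have R0: "R > 0" using p R by simp
  have M: "M \<ge> 0" using aM[of 0 0] by simp
  have P: "((\<lambda>r. P r w) has_real_derivative f r w) (at r)" for r w
    unfolding P_def f_def
    by (intro DERIV_diff DERIV_mult a_r b_r stream_z_deriv_r[OF e p] stream_r_deriv_r[OF e p])
  have Q: "((\<lambda>w. Q r w) has_real_derivative g r w) (at w)" for r w
    unfolding Q_def g_def
    by (intro DERIV_diff DERIV_minus DERIV_mult a_z b_z stream_z_deriv_w[OF e p] stream_r_deriv_w[OF e p])
  have cf: "continuous_on UNIV (\<lambda>x. f (fst x) (snd x))"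
    unfolding f_def by (intro continuous_intros cont k)
  have cg: "continuous_on UNIV (\<lambda>x. g (fst x) (snd x))"
    unfolding g_def by (intro continuous_intros cont k)
  \<comment> \<open>\<open>R \<ge> 2 * p\<close> keeps the three edges off the axis at distance at
    least \<open>R / 2\<close> from \<open>(p, 0)\<close>; the far bounds with
    \<open>q = (R / 2)\<^sup>2\<close> then read \<open>32 * p / R\<^sup>2\<close>.\<close>
  define C where "C = 32 * p / R\<^sup>2"
  have ST: "\<bar>stream_r p e r w\<bar> \<le> C" "\<bar>stream_z p e r w\<bar> \<le> C" if "r \<ge> 0" "r = R \<or> \<bar>w\<bar> = R" for r w
  proof -
    have "(R / 2)\<^sup>2 \<le> (r - p)\<^sup>2 + w\<^sup>2"
    proof (cases "r = R")
      case True
      hence "(R / 2)\<^sup>2 \<le> (r - p)\<^sup>2" using R p by (intro power_mono) auto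
      thus ?thesis by (simp add: add_increasing2)
    next
      case False
      hence "(R / 2)\<^sup>2 \<le> \<bar>w\<bar>\<^sup>2" using that R0 by (intro power_mono) auto
      thus ?thesis by (simp add: add_increasing)
    qed
    from stream_r_far[OF e p that(1) _ this] stream_z_far[OF e p that(1) _ this] R0
    show "\<bar>stream_r p e r w\<bar> \<le> C" "\<bar>stream_z p e r w\<bar> \<le> C" by (simp_all add: C_def power_divide)
  qed
  have MC: "\<bar>a r w * t\<bar> \<le> M * C" "\<bar>b r w * t\<bar> \<le> M * C" if "\<bar>t\<bar> \<le> C" for r w t
    unfolding abs_mult using aM bM M that by (auto intro!: mult_mono)
  have Pb: "\<bar>P R w\<bar> \<le> 2 * (M * C)" for w
    using MC[OF ST(1), of R w R w] MC[OF ST(2), of R w R w] R0 unfolding P_def by simp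
  have Qb: "\<bar>Q r w\<bar> \<le> 2 * (M * C)" if "r \<ge> 0" "\<bar>w\<bar> = R" for r w
    using MC[OF ST(1), of r w r w] MC[OF ST(2), of r w r w] that unfolding Q_def by simp
  \<comment> \<open>The edge \<open>r = 0\<close> contributes nothing, because
    \<open>stream_r\<close> and \<open>stream_z\<close> vanish on the axis.\<close>
  have 1: "\<bar>integral (cbox (0, -R) (R, R)) (\<lambda>x. f (fst x) (snd x))\<bar> \<le> 2 * (M * C) * (R - - R)"
    by (rule integral_box_deriv_fst[OF cf _ _ P]) (use R0 Pb in \<open>auto simp: P_def[of 0] stream_axis\<close>)
  have 2: "\<bar>integral (cbox (0, -R) (R, R)) (\<lambda>x. g (fst x) (snd x))\<bar> \<le> 4 * (M * C) * (R - 0)"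
  proof (rule integral_box_deriv_snd[OF cg _ _ Q])
    fix r :: real assume "0 \<le> r"
    hence "\<bar>Q r R\<bar> \<le> 2 * (M * C)" "\<bar>Q r (- R)\<bar> \<le> 2 * (M * C)" using R0 by (intro Qb; simp)+
    thus "\<bar>Q r R - Q r (- R)\<bar> \<le> 4 * (M * C)" by linarith
  qed (use R0 in auto)
  \<comment> \<open>Incompressibility is given for \<open>r > 0\<close> only; at
    \<open>r = 0\<close> every kernel factor, and hence each side, is 0.\<close>
  have eq: "(br r w - az r w) * stream_z p e r w + a r w * bump p e r w = f r w + g r w" if "r \<ge> 0" for r w
  proof (cases "r = 0")
    case True thus ?thesis by (simp add: f_def g_def stream_axis)
  next
    case False
    with that show ?thesis unfolding f_def g_def by (intro stream_divergence_identity p e div) auto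
  qed
  have "integral (cbox (0, -R) (R, R)) (\<lambda>x. (br (fst x) (snd x) - az (fst x) (snd x)) * stream_z p e (fst x) (snd x)
      + a (fst x) (snd x) * bump p e (fst x) (snd x)) =
      integral (cbox (0, -R) (R, R)) (\<lambda>x. f (fst x) (snd x) + g (fst x) (snd x))"
    by (rule integral_cong) (auto simp: cbox_Pair_eq eq)
  also have "\<dots> = integral (cbox (0, -R) (R, R)) (\<lambda>x. f (fst x) (snd x))
      + integral (cbox (0, -R) (R, R)) (\<lambda>x. g (fst x) (snd x))"
    by (intro integral_add integrable_continuous continuous_on_subset[OF cf] continuous_on_subset[OF cg]) auto
  also have "\<bar>\<dots>\<bar> \<le> 2 * (M * C) * (R - - R) + 4 * (M * C) * (R - 0)"
    using 1 2 by linarith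
  also have "\<dots> = 256 * M * p / R" using R0 by (simp add: C_def power2_eq_square)
  finally show ?thesis .
qed

section \<open>Pairing of weak \<open>L\<^sup>2\<close> with \<open>L\<^bsup>2,1\<^esup>\<close>\<close>

text \<open>Write \<open>g x\<close> as the length of \<open>{0<..<g x}\<close> and apply Tonelli.
  The weight \<open>h\<close> allows two uses: with an indicator as \<open>h\<close> for the weak
  function alone, and with the weak function as \<open>h\<close> for the pairing.\<close>

lemma layer_cake:
  assumes "sigma_finite_measure M" and g[measurable]: "g \<in> borel_measurable M"
    and h[measurable]: "h \<in> borel_measurable M" and nn: "\<And>x. 0 \<le> (g x :: real)"
  shows "(\<integral>\<^sup>+x. ennreal (g x) * h x \<partial>M) =
    (\<integral>\<^sup>+s\<in>{0<..}. (\<integral>\<^sup>+x\<in>{x \<in> space M. g x > s}. h x \<partial>M) \<partial>lborel)"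
proof -
  interpret pair_sigma_finite M lborel
    using assms(1) sigma_finite_lborel by (simp add: pair_sigma_finite_def)
  have eq: "h x * ennreal (g x) = (\<integral>\<^sup>+s. h x * indicator {0<..<g x} s \<partial>lborel)" for x
    by (subst nn_integral_cmult_indicator) (use nn[of x] in auto)
  have "(\<integral>\<^sup>+x. ennreal (g x) * h x \<partial>M) = (\<integral>\<^sup>+x. (\<integral>\<^sup>+s. h x * indicator {0<..<g x} s \<partial>lborel) \<partial>M)"
    by (simp add: eq mult.commute)
  also have "\<dots> = (\<integral>\<^sup>+s. (\<integral>\<^sup>+x. h x * indicator {0<..<g x} s \<partial>M) \<partial>lborel)"
  proof -
    have "h x * indicator {0<..<g x} s = (if 0 < s \<and> s < g x then h x else 0)" for x s
      by (auto simp: indicator_def)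
    moreover have "(\<lambda>(x, s). if 0 < s \<and> s < g x then h x else 0) \<in> borel_measurable (M \<Otimes>\<^sub>M lborel)"
      by measurable
    ultimately show ?thesis using Fubini[of "\<lambda>(x, s). h x * indicator {0<..<g x} s"] by simp
  qed
  also have "\<dots> = (\<integral>\<^sup>+s\<in>{0<..}. (\<integral>\<^sup>+x\<in>{x \<in> space M. g x > s}. h x \<partial>M) \<partial>lborel)"
  proof (intro nn_integral_cong)
    fix s :: real
    have "(\<integral>\<^sup>+x. h x * indicator {0<..<g x} s \<partial>M) =
        (\<integral>\<^sup>+x. h x * indicator {x \<in> space M. g x > s} x * indicator {0<..} s \<partial>M)"
      by (intro nn_integral_cong) (auto simp: indicator_def)
    also have "\<dots> = (\<integral>\<^sup>+x\<in>{x \<in> space M. g x > s}. h x \<partial>M) * indicator {0<..} s"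
      by (rule nn_integral_multc) measurable
    finally show "(\<integral>\<^sup>+x. h x * indicator {0<..<g x} s \<partial>M) =
        (\<integral>\<^sup>+x\<in>{x \<in> space M. g x > s}. h x \<partial>M) * indicator {0<..} s" .
  qed
  finally show ?thesis .
qed

text \<open>The pairing estimate for the indicator of \<open>E\<close>. The part of the level set of
  height \<open>s\<close> inside \<open>E\<close> has measure at most the smaller of
  \<open>m\<close> and \<open>c / s\<^sup>2\<close>; integrating the first up to \<open>l\<close>
  and the second beyond gives twice \<open>sqrt (c * m)\<close>.\<close>

lemma nn_integral_weak_L2_le:
  fixes k :: "'a \<Rightarrow> real"
  assumes "sigma_finite_measure M" and k[measurable]: "k \<in> borel_measurable M"
    and nn: "\<And>x. 0 \<le> k x" and E[measurable]: "E \<in> sets M" and c: "c > 0"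
    and weak: "\<And>s. s > 0 \<Longrightarrow> emeasure M {x \<in> space M. k x > s} \<le> ennreal (c / s\<^sup>2)"
  shows "(\<integral>\<^sup>+x\<in>E. ennreal (k x) \<partial>M) \<le> ennreal (2 * sqrt c) * ennreal_sqrt (emeasure M E)"
proof (cases "emeasure M E = \<infinity>")
  case True
  thus ?thesis using c by (simp add: ennreal_sqrt_def ennreal_mult_top)
next
  case False
  then obtain m where m: "m \<ge> 0" "emeasure M E = ennreal m"
    by (metis ennreal_cases infinity_ennreal_def)
  show ?thesis
  proof (cases "m = 0")
    case True
    hence "E \<in> null_sets M" using m by (auto simp: null_sets_def)
    hence "(\<integral>\<^sup>+x\<in>E. ennreal (k x) \<partial>M) = 0"
      by (rule nn_integral_null_set)
    thus ?thesis by simp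
  next
    case False
    hence m0: "m > 0" using m by simp
    define l where "l = sqrt (c / m)" \<comment> \<open>where the bounds \<open>m\<close> and \<open>c / s\<^sup>2\<close> on the level sets agree\<close>
    have l: "l > 0" using m0 c by (simp add: l_def)
    have "(\<integral>\<^sup>+x\<in>E. ennreal (k x) \<partial>M) = 
       (\<integral>\<^sup>+s\<in>{0<..}. (\<integral>\<^sup>+x\<in>{x \<in> space M. k x > s}. indicator E x \<partial>M) \<partial>lborel)"
      by (rule layer_cake[OF assms(1)]) (use nn in auto)
    also have "\<dots> \<le> (\<integral>\<^sup>+s. ennreal m * indicator {0..l} s + ennreal (c / s\<^sup>2) * indicator {l..} s \<partial>lborel)"
    proof (intro nn_integral_mono)
      fix s :: real
      have i: "(\<integral>\<^sup>+x\<in>{x \<in> space M. k x > s}. indicator E x \<partial>M) = emeasure M (E \<inter> {x \<in> space M. k x > s})"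
      proof -
        have "(\<integral>\<^sup>+x\<in>{x \<in> space M. k x > s}. indicator E x \<partial>M) =
            (\<integral>\<^sup>+x. indicator (E \<inter> {x \<in> space M. k x > s}) x \<partial>M)"
          by (intro nn_integral_cong) (auto simp: indicator_def)
        thus ?thesis by simp
      qed
      have 1: "emeasure M (E \<inter> {x \<in> space M. k x > s}) \<le> ennreal m"
        unfolding m(2)[symmetric] by (intro emeasure_mono) auto
      have 2: "emeasure M (E \<inter> {x \<in> space M. k x > s}) \<le> ennreal (c / s\<^sup>2)" if "s > 0"
        by (rule order_trans[OF _ weak[OF that]]) (intro emeasure_mono, auto)
      show "(\<integral>\<^sup>+x\<in>{x \<in> space M. k x > s}. indicator E x \<partial>M) * indicator {0<..} s
         \<le> ennreal m * indicator {0..l} s + ennreal (c / s\<^sup>2) * indicator {l..} s"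
        unfolding i using 1 2 l by (cases "s \<le> 0"; cases "s \<le> l") (auto simp: indicator_def add_increasing2)
    qed
    also have "\<dots> = ennreal m * ennreal l + ennreal (c / l)"
    proof -
      have "(\<integral>\<^sup>+s. ennreal (c / s\<^sup>2) * indicator {l..} s \<partial>lborel) = ennreal (0 - (- c / l))"
      proof (rule nn_integral_FTC_atLeast)
        fix x assume "l \<le> x"
        thus "((\<lambda>x. - c / x) has_real_derivative c / x\<^sup>2) (at x)"
          using l by (auto intro!: derivative_eq_intros simp: power2_eq_square)
        show "0 \<le> c / x\<^sup>2" using c by simp
      next
        show "((\<lambda>x. - c / x) \<longlongrightarrow> 0) at_top"
          by (intro tendsto_divide_0[OF tendsto_const] filterlim_at_top_imp_at_infinity filterlim_ident)
      qed simp
      thus ?thesis using l by (subst nn_integral_add) (auto simp: nn_integral_cmult_indicator)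
    qed
    also have "\<dots> = ennreal (m * l + c / l)" using m l c by (simp add: ennreal_mult'' ennreal_plus)
    also have "m * l + c / l = 2 * sqrt c * sqrt m"
    proof -
      have "m * l = sqrt c * sqrt m" "c / l = sqrt c * sqrt m"
        using m0 c by (simp_all add: l_def real_sqrt_divide field_simps)
      thus ?thesis by simp
    qed
    also have "ennreal (2 * sqrt c * sqrt m) = ennreal (2 * sqrt c) * ennreal_sqrt (emeasure M E)"
      using m m0 c by (simp add: ennreal_sqrt_def ennreal_mult')
    finally show ?thesis .
  qed
qed

text \<open>Slice \<open>\<bar>f\<bar>\<close> into its level sets and apply
  \<open>nn_integral_weak_L2_le\<close> to each. The factor 2 obtained there is the one in the
  definition of \<open>lorentz21_norm\<close>.\<close>

lemma lorentz21_duality: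
  fixes f k :: "'a \<Rightarrow> real"
  assumes "sigma_finite_measure M" and f[measurable]: "f \<in> borel_measurable M"
    and k[measurable]: "k \<in> borel_measurable M"
    and nn: "\<And>x. 0 \<le> k x" and c: "c > 0"
    and weak: "\<And>s. s > 0 \<Longrightarrow> emeasure M {x \<in> space M. k x > s} \<le> ennreal (c / s\<^sup>2)"
  shows "(\<integral>\<^sup>+x. ennreal (\<bar>f x\<bar> * k x) \<partial>M) \<le> ennreal (sqrt c) * lorentz21_norm M f"
proof -
  interpret sigma_finite_measure M by fact
  have [measurable]: "(\<lambda>s. emeasure M {x \<in> space M. \<bar>f x\<bar> > s}) \<in> borel_measurable borel"
    by (intro measurable_emeasure) (auto simp: space_pair_measure)
  have [measurable]: "(\<lambda>s. ennreal_sqrt (emeasure M {x \<in> space M. \<bar>f x\<bar> > s})) \<in> borel_measurable borel"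
    unfolding ennreal_sqrt_def by measurable
  have "(\<integral>\<^sup>+x. ennreal (\<bar>f x\<bar> * k x) \<partial>M) = (\<integral>\<^sup>+x. ennreal \<bar>f x\<bar> * ennreal (k x) \<partial>M)"
    using nn by (simp add: ennreal_mult'')
  also have "\<dots> = (\<integral>\<^sup>+s\<in>{0<..}. (\<integral>\<^sup>+x\<in>{x \<in> space M. \<bar>f x\<bar> > s}. ennreal (k x) \<partial>M) \<partial>lborel)"
    by (rule layer_cake[OF assms(1)]) auto
  also have "\<dots> \<le> (\<integral>\<^sup>+s. ennreal (2 * sqrt c) * (ennreal_sqrt (emeasure M {x \<in> space M. \<bar>f x\<bar> > s}) * indicator {0<..} s) \<partial>lborel)"
    by (intro nn_integral_mono, unfold mult.assoc[symmetric])
       (intro mult_right_mono nn_integral_weak_L2_le[OF assms(1) k nn _ c weak], auto)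
  also have "\<dots> = ennreal (2 * sqrt c) * (\<integral>\<^sup>+s\<in>{0<..}. ennreal_sqrt (emeasure M {x \<in> space M. \<bar>f x\<bar> > s}) \<partial>lborel)"
    by (intro nn_integral_cmult) measurable
  also have "\<dots> = ennreal (sqrt c) * lorentz21_norm M f"
    using c by (simp add: lorentz21_norm_def ennreal_mult' mult_ac)
  finally show ?thesis .
qed

section \<open>The half-plane measure and the weight of a ring\<close>

lemma borel_half_plane_density: "(\<lambda>(r, z). ennreal (r\<^sup>2)) \<in> borel_measurable (borel :: (real \<times> real) measure)"
  unfolding case_prod_unfold
  by (intro measurable_compose[OF _ measurable_ennreal] borel_measurable_continuous_onI continuous_intros)

lemma sigma_finite_half_plane: "sigma_finite_measure half_plane_measure"
proof -
  have "sigma_finite_measure (restrict_space lborel ({0<..} \<times> UNIV) :: (real \<times> real) measure)"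
    by (intro sigma_finite_measure_restrict_space sigma_finite_lborel) (auto intro!: borel_open open_Times)
  moreover have "(\<lambda>(r, z). ennreal (r\<^sup>2)) \<in> borel_measurable (restrict_space lborel ({0<..} \<times> UNIV) :: (real \<times> real) measure)"
    by (auto intro!: measurable_restrict_space1 borel_half_plane_density)
  ultimately show ?thesis unfolding half_plane_measure_def
    by (subst sigma_finite_measure.sigma_finite_iff_density_finite) auto
qed

lemma nn_integral_half_plane:
  assumes "f \<in> borel_measurable half_plane_measure"
  shows "(\<integral>\<^sup>+x. f x \<partial>half_plane_measure) =
     (\<integral>\<^sup>+x\<in>{0<..} \<times> UNIV. ennreal ((fst x)\<^sup>2) * f x \<partial>lborel)"
proof -
  have [measurable]: "f \<in> borel_measurable (restrict_space lborel ({0<..} \<times> UNIV))"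
    using assms by (simp add: half_plane_measure_def)
  have [measurable]: "(\<lambda>(r, z). ennreal (r\<^sup>2)) \<in> borel_measurable (restrict_space lborel ({0<..} \<times> UNIV) :: (real \<times> real) measure)"
    by (auto intro!: measurable_restrict_space1 borel_half_plane_density)
  show ?thesis unfolding half_plane_measure_def
    by (subst nn_integral_density, measurable, subst nn_integral_restrict_space)
       (auto simp: case_prod_unfold intro!: borel_open open_Times)
qed

text \<open>At the point \<open>(p, q)\<close> itself the division by 0 makes \<open>ring_weight\<close> vanish; this is harmless,
  as \<open>stream_z\<close> is 0 on the line \<open>w = 0\<close>.\<close>

definition ring_weight :: "real \<Rightarrow> real \<Rightarrow> real \<times> real \<Rightarrow> real" where
  "ring_weight p q x = 8 / (sqrt ((fst x)\<^sup>2 + p\<^sup>2 + (snd x - q)\<^sup>2) * sqrt ((fst x - p)\<^sup>2 + (snd x - q)\<^sup>2))"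

lemma ring_weight_nonneg: "ring_weight p q x \<ge> 0"
  by (simp add: ring_weight_def)

lemma borel_measurable_ring_weight [measurable]: "ring_weight p q \<in> borel_measurable borel"
  unfolding ring_weight_def
  by (intro borel_measurable_divide borel_measurable_const borel_measurable_continuous_onI continuous_intros)

lemma ring_weight_weak_L2:
  assumes p: "p > 0" and s: "s > 0"
  shows "emeasure half_plane_measure {x \<in> space half_plane_measure. ring_weight p q x > s} \<le> ennreal (2048 / s\<^sup>2)"
proof -
  \<comment> \<open>The superlevel set is contained in \<open>a * d < l\<close>, with
    \<open>a\<close> and \<open>d\<close> the two square roots of the weight. From
    \<open>p \<le> a\<close> and \<open>d \<le> a\<close> follow \<open>d < l / p\<close> and
    \<open>d \<le> sqrt l\<close>, which explains the sizes of \<open>B1\<close> and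
    \<open>B2\<close>.\<close>
  define l where "l = 8 / s"
  have l: "l > 0" using s by (simp add: l_def)
  define B1 where "B1 = cbox (p - l / p, q - l / p) (p + l / p, q + l / p)"
  define B2 where "B2 = cbox (p - sqrt l, q - sqrt l) (p + sqrt l, q + sqrt l)"
  define S where "S = {x \<in> space half_plane_measure. ring_weight p q x > s}"
  have [measurable]: "ring_weight p q \<in> borel_measurable half_plane_measure"
    unfolding half_plane_measure_def by (simp add: measurable_restrict_space1)
  have [measurable]: "S \<in> sets half_plane_measure" unfolding S_def by measurable
  \<comment> \<open>Close to the ring, \<open>r\<close> is at most \<open>2 p\<close> and the weight behaves like \<open>1 / (p d)\<close>; far from
    it, \<open>r\<close> is at most \<open>2 d\<close> and the weight behaves like \<open>1 / d\<^sup>2\<close>.\<close>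
  have key: "r\<^sup>2 * indicator S (r, z) \<le> 4 * p\<^sup>2 * indicator B1 (r, z) + 4 * l * indicator B2 (r, z)"
    if "r > 0" for r z
  proof (cases "(r, z) \<in> S")
    case True
    define a where "a = sqrt (r\<^sup>2 + p\<^sup>2 + (z - q)\<^sup>2)"
    define d where "d = sqrt ((r - p)\<^sup>2 + (z - q)\<^sup>2)"
    have a: "a > 0" unfolding a_def using p by (simp add: add_nonneg_pos add_pos_nonneg)
    have pa: "p \<le> a" unfolding a_def by (rule real_le_rsqrt) simp
    have da: "d \<le> a" unfolding a_def d_def
      using that p by (simp add: power2_diff)
    have rd: "\<bar>r - p\<bar> \<le> d" "\<bar>z - q\<bar> \<le> d" unfolding d_def by (rule real_le_rsqrt, simp)+
    have sl: "s < 8 / (a * d)" using True by (simp add: S_def ring_weight_def a_def d_def)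
    have d: "d > 0"
    proof (rule ccontr)
      assume "\<not> d > 0"
      hence "d = 0" using rd by linarith
      thus False using sl s by simp
    qed
    have ad: "a * d < l" using sl s a d by (simp add: l_def field_simps)
    show ?thesis
    proof (cases "d \<le> p")
      case True
      have "p * d < l" using mult_right_mono[OF pa, of d] ad d by linarith
      hence "d < l / p" using p by (simp add: field_simps)
      hence "(r, z) \<in> B1" using rd unfolding B1_def by (auto simp: cbox_Pair_eq abs_le_iff)
      moreover have "r\<^sup>2 \<le> (2 * p)\<^sup>2" using True rd that by (intro power_mono) auto
      moreover have "0 \<le> 4 * l * indicator B2 (r, z)" using l by simp
      ultimately show ?thesis using \<open>(r, z) \<in> S\<close> by (simp add: power_mult_distrib)
    next
      case False
      have "d * d < l" using mult_right_mono[OF da, of d] ad d by linarith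
      hence d2: "d\<^sup>2 \<le> l" by (simp add: power2_eq_square)
      hence "d \<le> sqrt l" by (rule real_le_rsqrt)
      hence "(r, z) \<in> B2" using rd unfolding B2_def by (auto simp: cbox_Pair_eq abs_le_iff)
      moreover have "r\<^sup>2 \<le> (2 * d)\<^sup>2" using False rd that by (intro power_mono) auto
      moreover have "0 \<le> 4 * p\<^sup>2 * indicator B1 (r, z)" by simp
      ultimately show ?thesis using \<open>(r, z) \<in> S\<close> d2 by (simp add: power_mult_distrib add_increasing)
    qed
  qed (use l in auto)
  have "emeasure half_plane_measure S = (\<integral>\<^sup>+x. indicator S x \<partial>half_plane_measure)" by simp
  also have "\<dots> = (\<integral>\<^sup>+x\<in>{0<..} \<times> UNIV. ennreal ((fst x)\<^sup>2) * indicator S x \<partial>lborel)"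
    by (rule nn_integral_half_plane) measurable
  also have "\<dots> \<le> (\<integral>\<^sup>+x. ennreal (4 * p\<^sup>2) * indicator B1 x + ennreal (4 * l) * indicator B2 x \<partial>lborel)"
  proof (intro nn_integral_mono)
    fix x :: "real \<times> real"
    obtain r z where x: "x = (r, z)" by (cases x)
    have "ennreal ((fst x)\<^sup>2) * indicator S x = ennreal (r\<^sup>2 * indicator S (r, z))"
      by (auto simp: x indicator_def)
    moreover have "ennreal (4 * p\<^sup>2) * indicator B1 x + ennreal (4 * l) * indicator B2 x
       = ennreal (4 * p\<^sup>2 * indicator B1 (r, z) + 4 * l * indicator B2 (r, z))"
      using l by (auto simp: x indicator_def)
    ultimately show "ennreal ((fst x)\<^sup>2) * indicator S x * indicator ({0<..} \<times> UNIV) x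
      \<le> ennreal (4 * p\<^sup>2) * indicator B1 x + ennreal (4 * l) * indicator B2 x"
      using key[of r z] by (cases "r > 0") (auto simp: x intro!: ennreal_leI)
  qed
  also have "\<dots> = ennreal (4 * p\<^sup>2) * emeasure lborel B1 + ennreal (4 * l) * emeasure lborel B2"
    unfolding B1_def B2_def by (subst nn_integral_add) (auto simp: nn_integral_cmult_indicator)
  also have "emeasure lborel B1 = ennreal (4 * (l / p)\<^sup>2)"
    unfolding B1_def using l p
    by (subst emeasure_lborel_cbox) (auto simp: Basis_prod_def prod.union_disjoint power2_eq_square)
  also have "emeasure lborel B2 = ennreal (4 * l)"
    unfolding B2_def using l p
    by (subst emeasure_lborel_cbox) (auto simp: Basis_prod_def prod.union_disjoint)
  \<comment> \<open>Each square contributes \<open>16 * l\<^sup>2\<close>. In the first one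
    \<open>p\<close> cancels between the density and the area; this gives a bound uniform in
    \<open>p\<close>.\<close>
  also have "ennreal (4 * p\<^sup>2) * ennreal (4 * (l / p)\<^sup>2) + ennreal (4 * l) * ennreal (4 * l) = ennreal (32 * l\<^sup>2)"
    using l p by (simp flip: ennreal_mult'' ennreal_plus) (simp add: power2_eq_square)
  also have "32 * l\<^sup>2 = 2048 / s\<^sup>2" by (simp add: l_def power_divide)
  finally show ?thesis by (simp add: S_def)
qed

section \<open>The pointwise estimate in the half-plane\<close>

lemma nn_integral_cbox_eq_integral:
  fixes f :: "'a::euclidean_space \<Rightarrow> real"
  assumes f: "continuous_on (cbox a b) f" and nn: "\<And>x. x \<in> cbox a b \<Longrightarrow> 0 \<le> f x"
  shows "(\<integral>\<^sup>+x\<in>cbox a b. ennreal (f x) \<partial>lborel) = ennreal (integral (cbox a b) f)"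
proof -
  have i: "integrable lborel (\<lambda>x. indicator (cbox a b) x *\<^sub>R f x)"
    by (rule borel_integrable_compact) (use f in auto)
  have "(\<integral>\<^sup>+x\<in>cbox a b. ennreal (f x) \<partial>lborel) = (\<integral>\<^sup>+x. ennreal (indicator (cbox a b) x *\<^sub>R f x) \<partial>lborel)"
    by (intro nn_integral_cong) (auto simp: indicator_def)
  also have "\<dots> = ennreal (LINT x:cbox a b|lborel. f x)"
    unfolding set_lebesgue_integral_def
    by (rule nn_integral_eq_integral[OF i]) (use nn in \<open>auto simp: indicator_def\<close>)
  also have "(LINT x:cbox a b|lborel. f x) = integral (cbox a b) f"
    using i by (intro set_borel_integral_eq_integral) (simp add: set_integrable_def)
  finally show ?thesis .
qed

text \<open>The estimate at \<open>(p, q)\<close>, translated to \<open>q = 0\<close>. The bump is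
  tested against \<open>a\<close> with \<open>e = h\<^sup>2\<close>: its mass near
  \<open>(p, 0)\<close> bounds the integral below in terms of \<open>\<bar>a p 0\<bar>\<close>, and
  \<open>box_integral_bound\<close> bounds it above by the vorticity integral and an error of order
  \<open>1 / R\<close>.\<close>

lemma axis_estimate:
  fixes a b ar az br bz :: "real \<Rightarrow> real \<Rightarrow> real"
  assumes p: "p > 0"
    and a_r: "\<And>r w. ((\<lambda>r. a r w) has_real_derivative ar r w) (at r)"
    and a_z: "\<And>r w. ((\<lambda>w. a r w) has_real_derivative az r w) (at w)"
    and b_r: "\<And>r w. ((\<lambda>r. b r w) has_real_derivative br r w) (at r)"
    and b_z: "\<And>r w. ((\<lambda>w. b r w) has_real_derivative bz r w) (at w)"
    and cont: "continuous_on UNIV (\<lambda>x. a (fst x) (snd x))" "continuous_on UNIV (\<lambda>x. b (fst x) (snd x))"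
      "continuous_on UNIV (\<lambda>x. ar (fst x) (snd x))" "continuous_on UNIV (\<lambda>x. az (fst x) (snd x))"
      "continuous_on UNIV (\<lambda>x. br (fst x) (snd x))" "continuous_on UNIV (\<lambda>x. bz (fst x) (snd x))"
    and div: "\<And>r w. r > 0 \<Longrightarrow> r * ar r w + 2 * a r w + r * bz r w = 0"
    and aM: "\<And>r w. \<bar>a r w\<bar> \<le> M" and bM: "\<And>r w. \<bar>b r w\<bar> \<le> M"
    and I: "(\<integral>\<^sup>+x\<in>{0<..} \<times> UNIV. ennreal (\<bar>br (fst x) (snd x) - az (fst x) (snd x)\<bar> * ring_weight p 0 x) \<partial>lborel)
       \<le> ennreal I" "I \<ge> 0"
  shows "8 / 441 * \<bar>a p 0\<bar> \<le> p * I"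
proof (cases "a p 0 = 0")
  case True thus ?thesis using p I by simp
next
  case False
  define om where "om r w = br r w - az r w" for r w
  define \<sigma> where "\<sigma> = sgn (a p 0)"
  have \<sigma>: "\<sigma> * a p 0 = \<bar>a p 0\<bar>" "\<bar>\<sigma>\<bar> = 1" using False by (auto simp: \<sigma>_def sgn_if)
  have M: "M \<ge> 0" using aM[of 0 0] by simp
  have "isCont (\<lambda>x. a (fst x) (snd x)) (p, 0)"
    using cont(1) by (simp add: continuous_on_eq_continuous_at)
  then obtain d0 where d0: "d0 > 0"
    "\<And>x. dist x (p, 0) < d0 \<Longrightarrow> dist (a (fst x) (snd x)) (a p 0) < \<bar>a p 0\<bar> / 2"
    using False unfolding continuous_at_eps_delta
    by (metis fst_conv half_gt_zero snd_conv zero_less_abs_iff)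
  \<comment> \<open>\<open>d0 / 3\<close> ensures that
    \<open>\<bar>r - p\<bar> + \<bar>w\<bar> \<le> 2 * \<delta> < d0\<close>, so that
    \<open>a\<close> keeps its sign and half its size; \<open>p / 2\<close> ensures
    \<open>2 * h \<le> p\<close>, as \<open>bump_near\<close> requires.\<close>
  define \<delta> where "\<delta> = min (p / 2) (d0 / 3)"
  have \<delta>: "\<delta> > 0" "\<delta> \<le> p / 2" using d0 p by (auto simp: \<delta>_def)
  have near: "\<sigma> * a r w \<ge> \<bar>a p 0\<bar> / 2" if "\<bar>r - p\<bar> \<le> \<delta>" "\<bar>w\<bar> \<le> \<delta>" for r w
  proof -
    have "dist (r, w) (p, 0) \<le> \<bar>r - p\<bar> + \<bar>w\<bar>"
      using sqrt_sum_squares_le_sum_abs[of "r - p" w] by (simp add: dist_Pair_Pair dist_real_def)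
    also have "\<dots> < d0" using that \<delta> d0(1) by (simp add: \<delta>_def min_def split: if_splits)
    finally have "\<bar>a r w - a p 0\<bar> < \<bar>a p 0\<bar> / 2" using d0(2)[of "(r, w)"] by (simp add: dist_real_def)
    thus ?thesis using False by (auto simp: \<sigma>_def sgn_if abs_if split: if_splits)
  qed
  have main: "8 / 441 * \<bar>a p 0\<bar> - 64 * M * R\<^sup>2 * h\<^sup>2 / \<delta> ^ 4 \<le> p * I + 256 * M * p / R"
    if R: "R \<ge> 2 * p" and h: "h > 0" "h \<le> \<delta>" for R h
  proof -
    define K where "K = cbox (0, - R) (R, R)"
    define S where "S = cbox (p - h, - h) (p + h, h)"
    define e where "e = h\<^sup>2"
    have e: "e > 0" using h by (simp add: e_def)
    have hp: "2 * h \<le> p" using h \<delta> by linarith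
    have SK: "S \<subseteq> K" unfolding S_def K_def using hp R h by (auto simp: cbox_Pair_eq)
    have K: "r \<ge> 0 \<and> r \<le> R \<and> \<bar>w\<bar> \<le> R" if "(r, w) \<in> K" for r w
      using that by (auto simp: K_def cbox_Pair_eq)
    note k = continuous_stream[OF e p]
    have cT: "continuous_on A (\<lambda>x. om (fst x) (snd x) * stream_z p e (fst x) (snd x))" for A
      unfolding om_def by (intro continuous_intros k cont[THEN continuous_on_subset]) auto
    have cK: "continuous_on A (\<lambda>x. a (fst x) (snd x) * bump p e (fst x) (snd x))" for A
      by (intro continuous_intros k cont[THEN continuous_on_subset]) auto
    \<comment> \<open>\<open>c1\<close> is half of \<open>\<bar>a p 0\<bar>\<close> times the height
      from \<open>bump_near\<close>; \<open>c2\<close> bounds the integrand where no sign is known,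
      by \<open>bump_far\<close> at distance \<open>\<delta>\<close>.\<close>
    define c1 where "c1 = 2 * \<bar>a p 0\<bar> / (441 * h\<^sup>2)"
    define c2 where "c2 = 32 * M * h\<^sup>2 / \<delta> ^ 4"
    have c: "c1 \<ge> 0" "c2 \<ge> 0" using M by (auto simp: c1_def c2_def)
    have low: "(if x \<in> S then c1 else 0) - c2 \<le> \<sigma> * (a (fst x) (snd x) * bump p e (fst x) (snd x))"
      if "x \<in> K" for x
    proof -
      obtain r w where x: "x = (r, w)" by (cases x)
      have r: "r \<ge> 0" using K that x by auto
      have kn: "bump p e r w \<ge> 0" by (rule bump_nonneg[OF e p r])
      \<comment> \<open>Three zones: on the small square the integrand is at least
        \<open>c1\<close>; between it and the square of half side \<open>\<delta>\<close> it is
        nonnegative; elsewhere it exceeds \<open>- c2\<close>, up to equality.\<close>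
      consider "\<bar>r - p\<bar> \<le> h \<and> \<bar>w\<bar> \<le> h" | "\<not> (\<bar>r - p\<bar> \<le> h \<and> \<bar>w\<bar> \<le> h)" "\<bar>r - p\<bar> \<le> \<delta> \<and> \<bar>w\<bar> \<le> \<delta>"
        | "\<not> (\<bar>r - p\<bar> \<le> \<delta> \<and> \<bar>w\<bar> \<le> \<delta>)" by blast
      thus ?thesis
      proof cases
        case 1
        have "\<bar>a p 0\<bar> / 2 * (4 / (441 * h\<^sup>2)) \<le> \<sigma> * a r w * bump p e r w"
          using 1 h hp near[of r w] bump_near[of h p r w] unfolding e_def
          by (intro mult_mono) auto
        moreover have "\<bar>a p 0\<bar> / 2 * (4 / (441 * h\<^sup>2)) = c1" by (simp add: c1_def)
        ultimately show ?thesis using c by (auto simp: x mult.assoc)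
      next
        case 2
        hence "x \<notin> S" by (auto simp: x S_def cbox_Pair_eq)
        moreover have "0 \<le> \<sigma> * a r w * bump p e r w"
          using near[of r w] 2 by (intro mult_nonneg_nonneg[OF _ kn]) auto
        ultimately show ?thesis using c by (auto simp: x mult.assoc)
      next
        case 3
        hence "x \<notin> S" using h by (auto simp: x S_def cbox_Pair_eq)
        moreover have "bump p e r w \<le> 32 * e / (\<delta>\<^sup>2)\<^sup>2"
        proof (rule bump_far[OF e p r])
          from 3 have "\<delta>\<^sup>2 \<le> \<bar>r - p\<bar>\<^sup>2 \<or> \<delta>\<^sup>2 \<le> \<bar>w\<bar>\<^sup>2"
            using \<delta> power_mono[of \<delta> "\<bar>r - p\<bar>" 2] power_mono[of \<delta> "\<bar>w\<bar>" 2] by linarith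
          thus "\<delta>\<^sup>2 \<le> (r - p)\<^sup>2 + w\<^sup>2" by (auto simp: add_increasing add_increasing2)
        qed (use \<delta> in auto)
        hence "\<bar>\<sigma> * (a r w * bump p e r w)\<bar> \<le> M * (32 * e / (\<delta>\<^sup>2)\<^sup>2)"
          unfolding abs_mult \<sigma> mult_1 using aM[of r w] kn M by (intro mult_mono) auto
        moreover have "M * (32 * e / (\<delta>\<^sup>2)\<^sup>2) = c2" by (simp add: c2_def e_def flip: power_mult)
        ultimately show ?thesis by (simp add: x)
      qed
    qed
    have iS: "((\<lambda>x. if x \<in> S then c1 else 0) has_integral (4 * h\<^sup>2 * c1)) K"
    proof -
      have "((\<lambda>x. c1) has_integral (measure lborel S *\<^sub>R c1)) S"
        unfolding S_def by (rule has_integral_const)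
      moreover have "measure lborel S = 4 * h\<^sup>2"
        using h by (simp add: S_def content_Pair power2_eq_square)
      ultimately show ?thesis using SK by (simp add: has_integral_restrict)
    qed
    have iK: "((\<lambda>x. c2) has_integral (2 * R\<^sup>2 * c2)) K"
    proof -
      have "measure lborel K = 2 * R\<^sup>2"
        using R p by (simp add: K_def content_Pair power2_eq_square)
      thus ?thesis using has_integral_const[of c2 "(0, - R)" "(R, R)"] by (simp add: K_def)
    qed
    have ii: "(\<lambda>x. a (fst x) (snd x) * bump p e (fst x) (snd x)) integrable_on K"
      "(\<lambda>x. om (fst x) (snd x) * stream_z p e (fst x) (snd x)) integrable_on K"
      unfolding K_def by (intro integrable_continuous cK cT)+
    \<comment> \<open>The small square has area \<open>4 * h\<^sup>2\<close> and the box
      \<open>K\<close> has area \<open>2 * R\<^sup>2\<close>. The leading term equals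
      \<open>8 / 441 * \<bar>a p 0\<bar>\<close>, independently of \<open>h\<close>.\<close>
    have "4 * h\<^sup>2 * c1 - 2 * R\<^sup>2 * c2 \<le> \<sigma> * integral K (\<lambda>x. a (fst x) (snd x) * bump p e (fst x) (snd x))"
      by (rule has_integral_le[OF has_integral_diff[OF iS iK] has_integral_mult_right low])
         (use ii in auto)
    also have "\<dots> \<le> \<bar>integral K (\<lambda>x. a (fst x) (snd x) * bump p e (fst x) (snd x))\<bar>"
      by (rule order_trans[OF abs_ge_self]) (simp add: abs_mult[of \<sigma>] \<sigma>(2))
    also have "\<dots> \<le> \<bar>integral K (\<lambda>x. om (fst x) (snd x) * stream_z p e (fst x) (snd x))\<bar> + 256 * M * p / R"
      using box_integral_bound[OF p e R a_r a_z b_r b_z cont div aM bM, folded om_def K_def]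
        integral_add[OF ii(2,1)] by linarith
    also have "\<bar>integral K (\<lambda>x. om (fst x) (snd x) * stream_z p e (fst x) (snd x))\<bar>
       \<le> integral K (\<lambda>x. \<bar>om (fst x) (snd x) * stream_z p e (fst x) (snd x)\<bar>)"
      using integral_norm_bound_integral[OF ii(2), of "\<lambda>x. \<bar>om (fst x) (snd x) * stream_z p e (fst x) (snd x)\<bar>"]
      by (simp add: K_def integrable_continuous cT continuous_on_rabs)
    also have "\<dots> \<le> p * I"
    proof -
      have "ennreal (integral K (\<lambda>x. \<bar>om (fst x) (snd x) * stream_z p e (fst x) (snd x)\<bar>)) =
        (\<integral>\<^sup>+x\<in>K. ennreal \<bar>om (fst x) (snd x) * stream_z p e (fst x) (snd x)\<bar> \<partial>lborel)"
        unfolding K_def by (rule nn_integral_cbox_eq_integral[symmetric]) (auto intro!: continuous_on_rabs cT)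
      also have "\<dots> \<le> (\<integral>\<^sup>+x. ennreal p * (ennreal (\<bar>om (fst x) (snd x)\<bar> * ring_weight p 0 x) * indicator ({0<..} \<times> UNIV) x) \<partial>lborel)"
      proof (intro nn_integral_mono)
        fix x :: "real \<times> real"
        obtain r w where x: "x = (r, w)" by (cases x)
        \<comment> \<open>The closed box meets the axis, which is outside the open half-plane;
          \<open>stream_z\<close> is 0 there.\<close>
        consider "x \<notin> K" | "x \<in> K" "r = 0" | "r > 0" using K[of r w] x by force
        thus "ennreal \<bar>om (fst x) (snd x) * stream_z p e (fst x) (snd x)\<bar> * indicator K x
           \<le> ennreal p * (ennreal (\<bar>om (fst x) (snd x)\<bar> * ring_weight p 0 x) * indicator ({0<..} \<times> UNIV) x)"
        proof cases
          case 3
          have "\<bar>om r w * stream_z p e r w\<bar> \<le> \<bar>om r w\<bar> * (p * ring_weight p 0 x)"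
            unfolding abs_mult using stream_z_le_weight[OF e p, of r w] 3
            by (intro mult_left_mono) (auto simp: ring_weight_def x)
          hence "ennreal \<bar>om r w * stream_z p e r w\<bar> \<le> ennreal p * ennreal (\<bar>om r w\<bar> * ring_weight p 0 x)"
            using p ring_weight_nonneg[of p 0 x] by (subst ennreal_mult[symmetric]) (auto intro!: ennreal_leI simp: mult_ac)
          thus ?thesis using 3 by (auto simp: x indicator_def)
        qed (auto simp: x stream_axis)
      qed
      also have "\<dots> = ennreal p * (\<integral>\<^sup>+x\<in>{0<..} \<times> UNIV. ennreal (\<bar>om (fst x) (snd x)\<bar> * ring_weight p 0 x) \<partial>lborel)"
      proof (rule nn_integral_cmult)
        have [measurable]: "(\<lambda>x. om (fst x) (snd x)) \<in> borel_measurable borel"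
          unfolding om_def by (intro borel_measurable_continuous_onI continuous_intros cont)
        have [measurable]: "{0<..} \<times> UNIV \<in> sets (borel :: (real \<times> real) measure)"
          by (intro borel_open open_Times) auto
        show "(\<lambda>x. ennreal (\<bar>om (fst x) (snd x)\<bar> * ring_weight p 0 x) * indicator ({0<..} \<times> UNIV) x) \<in> borel_measurable lborel"
          by measurable
      qed
      also have "\<dots> \<le> ennreal p * ennreal I"
        using I unfolding om_def by (intro mult_left_mono) auto
      finally show ?thesis using p I by (simp flip: ennreal_mult)
    qed
    finally have "4 * h\<^sup>2 * c1 - 2 * R\<^sup>2 * c2 \<le> p * I + 256 * M * p / R" by simp
    moreover have "4 * h\<^sup>2 * c1 = 8 / 441 * \<bar>a p 0\<bar>" using h by (simp add: c1_def)
    moreover have "2 * R\<^sup>2 * c2 = 64 * M * R\<^sup>2 * h\<^sup>2 / \<delta> ^ 4" by (simp add: c2_def)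
    ultimately show ?thesis by simp
  qed
  \<comment> \<open>The order of the limits matters: the error from \<open>c2\<close> is of order
    \<open>R\<^sup>2 * h\<^sup>2\<close>, so \<open>h\<close> tends to 0 for fixed \<open>R\<close>,
    and \<open>R\<close> to infinity afterwards.\<close>
  have main2: "8 / 441 * \<bar>a p 0\<bar> \<le> p * I + 256 * M * p / R" if R: "R \<ge> 2 * p" for R
  proof (rule tendsto_upperbound)
    show "((\<lambda>h. 8 / 441 * \<bar>a p 0\<bar> - 64 * M * R\<^sup>2 * h\<^sup>2 / \<delta> ^ 4) \<longlongrightarrow> 8 / 441 * \<bar>a p 0\<bar>) (at_right 0)"
      by (rule tendsto_eq_intros refl | use \<delta> in simp)+
    show "\<forall>\<^sub>F h in at_right 0. 8 / 441 * \<bar>a p 0\<bar> - 64 * M * R\<^sup>2 * h\<^sup>2 / \<delta> ^ 4 \<le> p * I + 256 * M * p / R"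
      unfolding eventually_at_right_field using \<delta> main[OF R] by (intro exI[of _ \<delta>]) auto
  qed simp
  show ?thesis
  proof (rule tendsto_lowerbound)
    show "((\<lambda>R. p * I + 256 * M * p / R) \<longlongrightarrow> p * I) at_top"
      by (rule tendsto_eq_rhs[OF tendsto_add[OF tendsto_const tendsto_divide_0[OF tendsto_const]]])
         (auto intro: filterlim_at_top_imp_at_infinity filterlim_ident)
    show "\<forall>\<^sub>F R in at_top. 8 / 441 * \<bar>a p 0\<bar> \<le> p * I + 256 * M * p / R"
      using eventually_ge_at_top[of "2 * p"] by eventually_elim (rule main2)
  qed simp
qed

section \<open>Fourier inversion\<close>

lemma lborel_prod_integral:
  fixes f :: "'a::euclidean_space \<Rightarrow> real \<Rightarrow> complex"
  assumes "\<And>b. b \<in> Basis \<Longrightarrow> integrable lborel (f b)"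
  shows "integrable lborel (\<lambda>x. \<Prod>b\<in>Basis. f b (x \<bullet> b))"
    "(LINT x|lborel. (\<Prod>b\<in>Basis. f b (x \<bullet> b))) = (\<Prod>b\<in>Basis. (LINT x|lborel. f b x))"
proof -
  interpret product_sigma_finite "\<lambda>b::'a. lborel :: real measure"
    by standard
  have [measurable]: "f b \<in> borel_measurable borel" if "b \<in> Basis" for b
    using borel_measurable_integrable[OF assms[OF that]] by simp
  have m: "(\<lambda>x. \<Prod>b\<in>Basis. f b (x \<bullet> b)) \<in> borel_measurable borel" by measurable
  have eq: "(\<Prod>b\<in>Basis. f b ((\<Sum>b'\<in>Basis. y b' *\<^sub>R b') \<bullet> b)) = (\<Prod>b\<in>Basis. f b (y b))" for y
    by (intro prod.cong) auto
  show "integrable lborel (\<lambda>x. \<Prod>b\<in>Basis. f b (x \<bullet> b))"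
    unfolding lborel_eq[where 'a = 'a]
    by (subst integrable_distr_eq[OF _ m])
       (auto simp: eq intro!: product_integrable_prod assms)
  show "(LINT x|lborel. (\<Prod>b\<in>Basis. f b (x \<bullet> b))) = (\<Prod>b\<in>Basis. (LINT x|lborel. f b x))"
    unfolding lborel_eq[where 'a = 'a]
    by (subst integral_distr[OF _ m])
       (auto simp: eq intro!: product_integral_prod assms)
qed

text \<open>A rescaling of the characteristic function of the standard normal distribution:
  substituting \<open>y = c * \<xi>\<close> turns its density into the Gaussian here, and the
  argument \<open>t\<close> is fixed by \<open>t * c = 2 * pi * x\<close>.\<close>

lemma gaussian_fourier_real:
  fixes s x :: real
  assumes s: "s > 0"
  shows "integrable lborel (\<lambda>\<xi>. cis (2 * pi * x * \<xi>) * complex_of_real (exp (- pi * \<xi>\<^sup>2 / s\<^sup>2)))"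
    "(LINT \<xi>|lborel. cis (2 * pi * x * \<xi>) * complex_of_real (exp (- pi * \<xi>\<^sup>2 / s\<^sup>2)))
      = complex_of_real (s * exp (- pi * s\<^sup>2 * x\<^sup>2))"
proof -
  define t where "t = sqrt (2 * pi) * s * x"
  define c where "c = sqrt (2 * pi) / s"
  define F where "F y = std_normal_density y *\<^sub>R iexp (t * y)" for y
  have c: "c > 0" using s by (simp add: c_def)
  have i: "integrable lborel (\<lambda>y. std_normal_density y)"
    by (rule integrable_normal_density) simp
  have F: "integrable lborel F"
    unfolding F_def by (rule Bochner_Integration.integrable_bound[OF i]) auto
  have "char std_normal_distribution t = (LINT y|lborel. F y)"
    unfolding char_def F_def by (subst integral_density) auto
  hence IF: "(LINT y|lborel. F y) = complex_of_real (exp (- (t\<^sup>2) / 2))"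
    by (simp add: char_std_normal_distribution)
  have eq: "F (0 + c * \<xi>) = complex_of_real (1 / sqrt (2 * pi)) * (cis (2 * pi * x * \<xi>) * complex_of_real (exp (- pi * \<xi>\<^sup>2 / s\<^sup>2)))" for \<xi>
  proof -
    have "t * (c * \<xi>) = (sqrt (2 * pi) * sqrt (2 * pi)) * x * \<xi>" using s by (simp add: t_def c_def)
    also have "sqrt (2 * pi) * sqrt (2 * pi) = 2 * pi" by simp
    finally have 1: "t * (c * \<xi>) = 2 * pi * x * \<xi>" .
    have 2: "- (c * \<xi>)\<^sup>2 / 2 = - pi * \<xi>\<^sup>2 / s\<^sup>2"
      by (simp add: c_def power_mult_distrib power_divide)
    show ?thesis unfolding F_def std_normal_density_def add_0 1 2 cis_conv_exp scaleR_conv_of_real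
      by (simp add: mult_ac)
  qed
  have "integrable lborel (\<lambda>\<xi>. F (0 + c * \<xi>))"
    by (rule lborel_integrable_real_affine[OF F]) (use c in auto)
  hence "integrable lborel (\<lambda>\<xi>. complex_of_real (sqrt (2 * pi)) * F (0 + c * \<xi>))"
    by (rule integrable_mult_right)
  moreover have "complex_of_real (sqrt (2 * pi)) * (complex_of_real (1 / sqrt (2 * pi)) * X) = X" for X
    by (simp add: mult.assoc[symmetric] of_real_mult[symmetric] del: of_real_mult)
  ultimately show "integrable lborel (\<lambda>\<xi>. cis (2 * pi * x * \<xi>) * complex_of_real (exp (- pi * \<xi>\<^sup>2 / s\<^sup>2)))"
    unfolding eq by simp
  have "(LINT y|lborel. F y) = \<bar>c\<bar> *\<^sub>R (LINT \<xi>|lborel. F (0 + c * \<xi>))"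
    by (rule lborel_integral_real_affine) (use c in auto)
  also have "\<dots> = complex_of_real (c / sqrt (2 * pi)) * (LINT \<xi>|lborel. cis (2 * pi * x * \<xi>) * complex_of_real (exp (- pi * \<xi>\<^sup>2 / s\<^sup>2)))"
    unfolding eq using c by (simp add: scaleR_conv_of_real)
  also have "c / sqrt (2 * pi) = 1 / s" by (simp add: c_def)
  finally have "(LINT y|lborel. F y) = complex_of_real (1 / s) *
     (LINT \<xi>|lborel. cis (2 * pi * x * \<xi>) * complex_of_real (exp (- pi * \<xi>\<^sup>2 / s\<^sup>2)))" .
  moreover have "- (t\<^sup>2) / 2 = - pi * s\<^sup>2 * x\<^sup>2" by (simp add: t_def power_mult_distrib)
  ultimately show "(LINT \<xi>|lborel. cis (2 * pi * x * \<xi>) * complex_of_real (exp (- pi * \<xi>\<^sup>2 / s\<^sup>2)))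
      = complex_of_real (s * exp (- pi * s\<^sup>2 * x\<^sup>2))"
    unfolding IF using s by (simp add: field_simps)
qed

text \<open>The heat kernel at time \<open>1 / (4 * pi * s\<^sup>2)\<close>; it concentrates at 0 as
  \<open>s\<close> tends to infinity.\<close>

definition gauss_kernel :: "real \<Rightarrow> 'a::euclidean_space \<Rightarrow> real" where
  "gauss_kernel s x = s ^ DIM('a) * exp (- pi * s\<^sup>2 * (norm x)\<^sup>2)"

lemma norm_sq_euclidean: "(norm (x::'a::euclidean_space))\<^sup>2 = (\<Sum>b\<in>Basis. (x \<bullet> b)\<^sup>2)"
  by (simp add: norm_eq_sqrt_inner euclidean_inner[of x x] power2_eq_square sum_nonneg)

lemma gaussian_fourier:
  fixes x :: "'a::euclidean_space"
  assumes s: "s > 0"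
  shows "integrable lborel (\<lambda>\<xi>. cis (2 * pi * (x \<bullet> \<xi>)) * complex_of_real (exp (- pi * (norm \<xi>)\<^sup>2 / s\<^sup>2)))"
    "(LINT \<xi>|lborel. cis (2 * pi * (x \<bullet> \<xi>)) * complex_of_real (exp (- pi * (norm \<xi>)\<^sup>2 / s\<^sup>2)))
      = complex_of_real (gauss_kernel s x)"
proof -
  have eq: "cis (2 * pi * (x \<bullet> \<xi>)) * complex_of_real (exp (- pi * (norm \<xi>)\<^sup>2 / s\<^sup>2)) =
     (\<Prod>b\<in>Basis. cis (2 * pi * (x \<bullet> b) * (\<xi> \<bullet> b)) * complex_of_real (exp (- pi * (\<xi> \<bullet> b)\<^sup>2 / s\<^sup>2)))" for \<xi>
  proof -
    have "cis (2 * pi * (x \<bullet> \<xi>)) = (\<Prod>b\<in>Basis. cis (2 * pi * (x \<bullet> b) * (\<xi> \<bullet> b)))"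
      by (subst euclidean_inner)
         (simp add: cis_conv_exp sum_distrib_left mult.assoc flip: exp_sum)
    moreover have "exp (- pi * (norm \<xi>)\<^sup>2 / s\<^sup>2) = (\<Prod>b\<in>Basis. exp (- pi * (\<xi> \<bullet> b)\<^sup>2 / s\<^sup>2))"
      unfolding norm_sq_euclidean
      by (simp add: sum_distrib_left sum_divide_distrib sum_negf flip: exp_sum)
    ultimately show ?thesis by (simp add: prod.distrib)
  qed
  show "integrable lborel (\<lambda>\<xi>. cis (2 * pi * (x \<bullet> \<xi>)) * complex_of_real (exp (- pi * (norm \<xi>)\<^sup>2 / s\<^sup>2)))"
    unfolding eq by (rule lborel_prod_integral) (rule gaussian_fourier_real[OF s])
  have "(LINT \<xi>|lborel. cis (2 * pi * (x \<bullet> \<xi>)) * complex_of_real (exp (- pi * (norm \<xi>)\<^sup>2 / s\<^sup>2))) =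
     (\<Prod>b\<in>Basis. complex_of_real (s * exp (- pi * s\<^sup>2 * (x \<bullet> b)\<^sup>2)))"
    unfolding eq gaussian_fourier_real(2)[OF s, symmetric]
    by (rule lborel_prod_integral) (rule gaussian_fourier_real[OF s])
  also have "\<dots> = complex_of_real (gauss_kernel s x)"
    unfolding gauss_kernel_def norm_sq_euclidean
    by (simp add: prod.distrib sum_distrib_left sum_negf prod_constant flip: exp_sum of_real_prod)
  finally show "(LINT \<xi>|lborel. cis (2 * pi * (x \<bullet> \<xi>)) * complex_of_real (exp (- pi * (norm \<xi>)\<^sup>2 / s\<^sup>2)))
      = complex_of_real (gauss_kernel s x)" .
qed

lemma gauss_kernel_nonneg: "s > 0 \<Longrightarrow> gauss_kernel s x \<ge> 0"
  by (simp add: gauss_kernel_def)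

text \<open>The kernel is itself a multiple of the Gaussian with parameter \<open>1 / s\<close>, so
  its mass is read off from \<open>gaussian_fourier\<close> at frequency 0.\<close>

lemma gauss_kernel_integral:
  assumes s: "s > 0"
  shows "integrable lborel (gauss_kernel s :: 'a::euclidean_space \<Rightarrow> real)"
    "(LINT x|lborel. gauss_kernel s (x::'a)) = 1"
proof -
  have s': "1 / s > 0" using s by simp
  have eq: "exp (- pi * (norm \<xi>)\<^sup>2 / (1 / s)\<^sup>2) = (1 / s) ^ DIM('a) * gauss_kernel s \<xi>" for \<xi> :: 'a
    using s by (simp add: gauss_kernel_def power_divide mult_ac)
  have "integrable lborel (\<lambda>\<xi>::'a. complex_of_real ((1 / s) ^ DIM('a) * gauss_kernel s \<xi>))"
    using gaussian_fourier(1)[OF s', of "0::'a"] by (simp only: eq inner_zero_left mult_zero_right cis_zero mult_1)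
  hence "integrable lborel (\<lambda>\<xi>::'a. (1 / s) ^ DIM('a) * gauss_kernel s \<xi>)"
    by (simp only: complex_of_real_integrable_eq)
  thus 1: "integrable lborel (gauss_kernel s :: 'a \<Rightarrow> real)"
    using integrable_mult_right[of "s ^ DIM('a)" lborel "\<lambda>\<xi>::'a. (1 / s) ^ DIM('a) * gauss_kernel s \<xi>"] s
    by (simp add: power_divide)
  have "complex_of_real ((1 / s) ^ DIM('a) * (LINT \<xi>|lborel. gauss_kernel s (\<xi>::'a))) = complex_of_real (gauss_kernel (1 / s) (0::'a))"
    using gaussian_fourier(2)[OF s', of "0::'a"] s
    by (simp only: eq inner_zero_left mult_zero_right cis_zero mult_1 integral_complex_of_real integral_mult_right_zero)
  hence "(1 / s) ^ DIM('a) * (LINT \<xi>|lborel. gauss_kernel s (\<xi>::'a)) = (1 / s) ^ DIM('a)"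
    by (simp only: of_real_eq_iff) (simp add: gauss_kernel_def)
  thus "(LINT x|lborel. gauss_kernel s (x::'a)) = 1" using s by simp
qed

section \<open>Gaussian regularisation and the inversion formula\<close>

lemma integrable_L2_mult:
  fixes f :: "'a \<Rightarrow> complex" and h :: "'a \<Rightarrow> complex"
  assumes [measurable]: "f \<in> borel_measurable M" "h \<in> borel_measurable M"
    and "integrable M (\<lambda>x. (norm (f x))\<^sup>2)" "integrable M (\<lambda>x. (norm (h x))\<^sup>2)"
  shows "integrable M (\<lambda>x. f x * h x)"
proof (rule Bochner_Integration.integrable_bound)
  show "integrable M (\<lambda>x. (norm (f x))\<^sup>2 + (norm (h x))\<^sup>2)" using assms by auto
  show "AE x in M. norm (f x * h x) \<le> norm ((norm (f x))\<^sup>2 + (norm (h x))\<^sup>2)"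
  proof (intro AE_I2)
    fix x
    have "norm (f x * h x) \<le> (norm (f x))\<^sup>2 + (norm (h x))\<^sup>2"
      using sum_squares_bound[of "norm (f x)" "norm (h x)"]
        mult_nonneg_nonneg[OF norm_ge_zero norm_ge_zero, of "f x" "h x"]
      unfolding norm_mult by linarith
    thus "norm (f x * h x) \<le> norm ((norm (f x))\<^sup>2 + (norm (h x))\<^sup>2)" by simp
  qed
qed measurable

lemma borel_measurable_fourier_L1:
  fixes f :: "'a::euclidean_space \<Rightarrow> complex"
  assumes [measurable]: "f \<in> borel_measurable lborel"
  shows "fourier_L1 f \<in> borel_measurable lborel"
  unfolding fourier_L1_def
proof (intro lborel.borel_measurable_lebesgue_integral)
  have "(\<lambda>p::'a \<times> 'a. cis (- 2 * pi * (snd p \<bullet> fst p))) \<in> borel_measurable borel"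
    unfolding cis_conv_exp by (intro borel_measurable_continuous_onI continuous_intros)
  hence [measurable]: "(\<lambda>p::'a \<times> 'a. cis (- 2 * pi * (snd p \<bullet> fst p))) \<in> borel_measurable (lborel \<Otimes>\<^sub>M lborel)"
    by (simp add: lborel_prod)
  show "(\<lambda>(\<xi>, x). cis (- 2 * pi * (x \<bullet> \<xi>)) * f x) \<in> borel_measurable (lborel \<Otimes>\<^sub>M lborel)"
    unfolding case_prod_unfold by measurable
qed

lemma norm_fourier_L1_le:
  assumes "integrable lborel f"
  shows "norm (fourier_L1 f \<xi>) \<le> (LINT x|lborel. norm (f x))"
  unfolding fourier_L1_def
  by (rule order_trans[OF integral_norm_bound]) (simp add: norm_mult)

text \<open>Fubini for \<open>cis (- 2 * pi * (x \<bullet> y)) * f x * \<psi> y\<close>, whose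
  modulus is the product of two integrable functions. It moves the transform from the unknown
  function onto a Gaussian.\<close>

lemma fourier_L1_multiplication:
  fixes f \<psi> :: "'a::euclidean_space \<Rightarrow> complex"
  assumes f: "integrable lborel f" and p: "integrable lborel \<psi>"
  shows "(LINT \<xi>|lborel. fourier_L1 f \<xi> * \<psi> \<xi>) = (LINT x|lborel. f x * fourier_L1 \<psi> x)"
proof -
  have [measurable]: "f \<in> borel_measurable lborel" "\<psi> \<in> borel_measurable lborel"
    using f p by auto
  have "(\<lambda>p::'a \<times> 'a. cis (- 2 * pi * (fst p \<bullet> snd p))) \<in> borel_measurable borel"
    unfolding cis_conv_exp by (intro borel_measurable_continuous_onI continuous_intros)
  hence [measurable]: "(\<lambda>p::'a \<times> 'a. cis (- 2 * pi * (fst p \<bullet> snd p))) \<in> borel_measurable (lborel \<Otimes>\<^sub>M lborel)"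
    by (simp add: lborel_prod)
  define F where "F = (\<lambda>p::'a \<times> 'a. cis (- 2 * pi * (fst p \<bullet> snd p)) * f (fst p) * \<psi> (snd p))"
  have F: "integrable (lborel \<Otimes>\<^sub>M lborel) F"
  proof (rule lborel_pair.Fubini_integrable)
    show "F \<in> borel_measurable (lborel \<Otimes>\<^sub>M lborel)" unfolding F_def by measurable
    show "integrable lborel (\<lambda>x. LINT y|lborel. norm (F (x, y)))"
      using f by (simp add: F_def norm_mult)
    have "integrable lborel (\<lambda>y. F (x, y))" for x
    proof (rule Bochner_Integration.integrable_bound)
      show "integrable lborel (\<lambda>y. f x * \<psi> y)" using p by simp
      have "(\<lambda>y. cis (- 2 * pi * (x \<bullet> y))) \<in> borel_measurable borel"
        unfolding cis_conv_exp by (intro borel_measurable_continuous_onI continuous_intros)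
      thus "(\<lambda>y. F (x, y)) \<in> borel_measurable lborel" unfolding F_def by simp
    qed (auto simp: F_def norm_mult)
    thus "AE x in lborel. integrable lborel (\<lambda>y. F (x, y))" by simp
  qed
  have "(LINT y|lborel. (LINT x|lborel. F (x, y))) = (LINT x|lborel. (LINT y|lborel. F (x, y)))"
    using lborel_pair.Fubini_integral[of "\<lambda>x y. F (x, y)"] F by simp
  moreover have "(LINT x|lborel. F (x, y)) = fourier_L1 f y * \<psi> y" for y
    unfolding F_def fourier_L1_def by simp
  moreover have "(LINT y|lborel. F (x, y)) = f x * fourier_L1 \<psi> x" for x
  proof -
    have "F (x, y) = f x * (cis (- 2 * pi * (y \<bullet> x)) * \<psi> y)" for y
      by (simp add: F_def inner_commute mult_ac)
    thus ?thesis unfolding fourier_L1_def by simp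
  qed
  ultimately show ?thesis by simp
qed

lemma integrable_gauss_sq:
  assumes s: "s > 0"
  shows "integrable lborel (\<lambda>x::'a::euclidean_space. (exp (- pi * (norm x)\<^sup>2 / s\<^sup>2))\<^sup>2)"
proof -
  have eq: "(exp (- pi * (norm x)\<^sup>2 / s\<^sup>2))\<^sup>2 = (1 / (sqrt 2 / s)) ^ DIM('a) * gauss_kernel (sqrt 2 / s) x" for x :: 'a
  proof -
    have "(exp (- pi * (norm x)\<^sup>2 / s\<^sup>2))\<^sup>2 = exp (2 * (- pi * (norm x)\<^sup>2 / s\<^sup>2))"
      by (rule exp_double[symmetric])
    also have "2 * (- pi * (norm x)\<^sup>2 / s\<^sup>2) = - pi * (sqrt 2 / s)\<^sup>2 * (norm x)\<^sup>2"
      by (simp add: power_divide)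
    finally show ?thesis using s by (simp add: gauss_kernel_def power_divide)
  qed
  show ?thesis unfolding eq
    by (intro integrable_mult_right gauss_kernel_integral) (use s in simp)
qed

lemma gauss_kernel_eq_exp:
  "s > 0 \<Longrightarrow> gauss_kernel s x = s ^ DIM('a) * exp (- pi * (norm (x::'a::euclidean_space))\<^sup>2 / (1 / s)\<^sup>2)"
  by (simp add: gauss_kernel_def power_divide mult_ac)

lemma integrable_lborel_translate:
  fixes h :: "'a::euclidean_space \<Rightarrow> 'b::{banach, second_countable_topology}"
  assumes "integrable lborel h"
  shows "integrable lborel (\<lambda>y. h (c - y))" "(LINT y|lborel. h (c - y)) = (LINT y|lborel. h y)"
proof -
  have d: "lborel = distr lborel borel (\<lambda>y::'a. c - y)"
    using lborel_affine[of "-1" c] by (simp add: density_1)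
  have m: "(\<lambda>y::'a. c - y) \<in> measurable lborel borel" "h \<in> borel_measurable borel"
    using assms by auto
  show "integrable lborel (\<lambda>y. h (c - y))"
    using assms by (subst (asm) d) (simp add: integrable_distr_eq[OF m])
  show "(LINT y|lborel. h (c - y)) = (LINT y|lborel. h y)"
    by (subst (2) d) (simp add: integral_distr[OF m])
qed

lemma integrable_L2_gauss:
  fixes f :: "'a::euclidean_space \<Rightarrow> complex"
  assumes f: "f \<in> L2" and s: "s > 0"
  shows "integrable lborel (\<lambda>y. f y * complex_of_real (gauss_kernel s (x - y)))"
proof -
  have g: "integrable lborel (\<lambda>y. (norm (complex_of_real (gauss_kernel s (x - y))))\<^sup>2)"
  proof -
    have "integrable lborel (\<lambda>y::'a. (s ^ DIM('a))\<^sup>2 * (exp (- pi * (norm y)\<^sup>2 / (1 / s)\<^sup>2))\<^sup>2)"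
      by (intro integrable_mult_right integrable_gauss_sq) (use s in simp)
    from integrable_lborel_translate(1)[OF this, of x] show ?thesis
      by (simp only: gauss_kernel_eq_exp[OF s] norm_of_real power2_abs power_mult_distrib)
  qed
  have [measurable]: "f \<in> borel_measurable borel" using f by (simp add: L2_def)
  have "(\<lambda>y. complex_of_real (gauss_kernel s (x - y))) \<in> borel_measurable borel"
    unfolding gauss_kernel_def by (intro borel_measurable_continuous_onI continuous_intros)
  thus ?thesis using f g by (intro integrable_L2_mult) (auto simp: L2_def)
qed

text \<open>Half of the exponent is spent on decay in \<open>s\<close>, uniform outside the ball of
  radius \<open>d\<close>, by \<open>s * d\<^sup>2 \<le> s\<^sup>2 * (norm x)\<^sup>2\<close>. The
  other half leaves a fixed Gaussian, against which an \<open>L2\<close> function is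
  integrable.\<close>

lemma gauss_kernel_tail:
  fixes x :: "'a::euclidean_space"
  assumes s: "s \<ge> 1" and d: "d > 0" "d \<le> norm x"
  shows "gauss_kernel s x \<le> s ^ DIM('a) * exp (- (pi * d\<^sup>2 / 2) * s) * gauss_kernel (1 / sqrt 2) x * sqrt 2 ^ DIM('a)"
proof -
  have ss: "s \<le> s\<^sup>2" using s by (simp add: power2_eq_square)
  have dd: "d\<^sup>2 \<le> (norm x)\<^sup>2" using d by (intro power_mono) auto
  have "s\<^sup>2 * (norm x)\<^sup>2 \<ge> s * d\<^sup>2" using ss dd s by (intro mult_mono) auto
  moreover have "s\<^sup>2 * (norm x)\<^sup>2 \<ge> 1 * (norm x)\<^sup>2" using s by (intro mult_right_mono) auto
  ultimately have "s * d\<^sup>2 + (norm x)\<^sup>2 \<le> 2 * (s\<^sup>2 * (norm x)\<^sup>2)" by linarith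
  hence "pi * (s * d\<^sup>2 + (norm x)\<^sup>2) \<le> pi * (2 * (s\<^sup>2 * (norm x)\<^sup>2))"
    by (intro mult_left_mono) auto
  hence "- pi * s\<^sup>2 * (norm x)\<^sup>2 \<le> - (pi * d\<^sup>2 / 2) * s + (- pi * (norm x)\<^sup>2 / 2)"
    by (simp add: algebra_simps)
  hence "exp (- pi * s\<^sup>2 * (norm x)\<^sup>2) \<le> exp (- (pi * d\<^sup>2 / 2) * s) * exp (- pi * (norm x)\<^sup>2 / 2)"
    by (simp only: exp_le_cancel_iff flip: exp_add)
  hence "gauss_kernel s x \<le> s ^ DIM('a) * (exp (- (pi * d\<^sup>2 / 2) * s) * exp (- pi * (norm x)\<^sup>2 / 2))"
    unfolding gauss_kernel_def using s by (intro mult_left_mono) auto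
  moreover have "gauss_kernel (1 / sqrt 2) x * sqrt 2 ^ DIM('a) = exp (- pi * (norm x)\<^sup>2 / 2)"
    by (simp add: gauss_kernel_def power_divide flip: power_mult_distrib)
  ultimately show ?thesis by (simp add: mult.assoc)
qed

lemma power_times_exp_decay:
  assumes "c > (0::real)" shows "((\<lambda>s. s ^ n * exp (- c * s)) \<longlongrightarrow> 0) at_top"
proof -
  have "filterlim (\<lambda>s. c * s) at_top at_top"
    using assms filterlim_tendsto_pos_mult_at_top[OF tendsto_const _ filterlim_ident] by blast
  hence "((\<lambda>s. (c * s) ^ n / exp (c * s)) \<longlongrightarrow> 0) at_top"
    by (rule filterlim_compose[OF tendsto_power_div_exp_0])
  hence "((\<lambda>s. (1 / c ^ n) * ((c * s) ^ n / exp (c * s))) \<longlongrightarrow> (1 / c ^ n) * 0) at_top"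
    by (intro tendsto_intros)
  thus ?thesis using assms by (simp add: power_mult_distrib exp_minus field_simps)
qed

text \<open>Since \<open>f\<close> may be unbounded, the usual split needs care: near
  \<open>x\<close> continuity gives \<open>\<epsilon> / 2\<close>, and far from \<open>x\<close>
  \<open>gauss_kernel_tail\<close> bounds the rest by a vanishing factor times the constant
  \<open>W\<close>, which is free of \<open>s\<close>.\<close>

lemma gauss_approx_identity:
  fixes f :: "'a::euclidean_space \<Rightarrow> complex"
  assumes f: "f \<in> L2" and cont: "isCont f x"
  shows "((\<lambda>s. LINT y|lborel. f y * complex_of_real (gauss_kernel s (x - y))) \<longlongrightarrow> f x) at_top"
proof (rule tendstoI)
  fix \<epsilon> :: real assume \<epsilon>: "\<epsilon> > 0"
  then obtain d where d: "d > 0" "\<And>y. dist y x < d \<Longrightarrow> dist (f y) (f x) < \<epsilon> / 2"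
    using cont unfolding continuous_at_eps_delta by (metis half_gt_zero)
  define c where "c = pi * d\<^sup>2 / 2"
  have c: "c > 0" using d by (simp add: c_def)
  define G where "G y = gauss_kernel (1 / sqrt 2) (x - y) * sqrt 2 ^ DIM('a)" for y
  have iG: "integrable lborel (\<lambda>y. f y * complex_of_real (gauss_kernel s (x - y)))"
    "integrable lborel (\<lambda>y. f x * complex_of_real (gauss_kernel s (x - y)))"
    "(LINT y|lborel. f x * complex_of_real (gauss_kernel s (x - y))) = f x"
    "integrable lborel (\<lambda>y. gauss_kernel s (x - y))"
    "(LINT y|lborel. gauss_kernel s (x - y)) = 1" if "s > 0" for s
    using integrable_L2_gauss[OF f that] integrable_lborel_translate[OF gauss_kernel_integral(1)[OF that], of x]
      gauss_kernel_integral(2)[OF that, where 'a = 'a]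
    by (auto simp: integrable_mult_right complex_of_real_integrable_eq integral_complex_of_real)
  define W where "W = (LINT y|lborel. norm (f y - f x) * G y)"
  have iW: "integrable lborel (\<lambda>y. norm (f y - f x) * G y)"
  proof -
    have "integrable lborel (\<lambda>y. norm ((f y * complex_of_real (gauss_kernel (1 / sqrt 2) (x - y)) - f x * complex_of_real (gauss_kernel (1 / sqrt 2) (x - y))) * complex_of_real (sqrt 2 ^ DIM('a))))"
      by (intro integrable_norm integrable_mult_left Bochner_Integration.integrable_diff iG) auto
    moreover have "norm ((f y * complex_of_real (gauss_kernel (1 / sqrt 2) (x - y)) - f x * complex_of_real (gauss_kernel (1 / sqrt 2) (x - y))) * complex_of_real (sqrt 2 ^ DIM('a))) = norm (f y - f x) * G y" for y
      by (simp add: norm_mult norm_power G_def gauss_kernel_nonneg flip: left_diff_distrib)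
    ultimately show ?thesis by simp
  qed
  have est: "dist (LINT y|lborel. f y * complex_of_real (gauss_kernel s (x - y))) (f x)
     \<le> \<epsilon> / 2 + s ^ DIM('a) * exp (- c * s) * W" if s: "s \<ge> 1" for s
  proof -
    have s0: "s > 0" using s by simp
    have "dist (LINT y|lborel. f y * complex_of_real (gauss_kernel s (x - y))) (f x) =
       norm (LINT y|lborel. f y * complex_of_real (gauss_kernel s (x - y)) - f x * complex_of_real (gauss_kernel s (x - y)))"
      by (subst Bochner_Integration.integral_diff) (auto simp: iG s0 dist_norm)
    also have "\<dots> \<le> (LINT y|lborel. \<epsilon> / 2 * gauss_kernel s (x - y) + s ^ DIM('a) * exp (- c * s) * (norm (f y - f x) * G y))"
    proof (rule Bochner_Integration.integral_norm_bound_integral)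
      fix y
      have eq: "norm (f y * complex_of_real (gauss_kernel s (x - y)) - f x * complex_of_real (gauss_kernel s (x - y)))
        = norm (f y - f x) * gauss_kernel s (x - y)"
        by (simp add: norm_mult gauss_kernel_nonneg s0 flip: left_diff_distrib)
      have nn: "0 \<le> \<epsilon> / 2 * gauss_kernel s (x - y)" "0 \<le> s ^ DIM('a) * exp (- c * s) * (norm (f y - f x) * G y)"
        using \<epsilon> s0 by (auto simp: gauss_kernel_nonneg G_def)
      show "norm (f y * complex_of_real (gauss_kernel s (x - y)) - f x * complex_of_real (gauss_kernel s (x - y)))
         \<le> \<epsilon> / 2 * gauss_kernel s (x - y) + s ^ DIM('a) * exp (- c * s) * (norm (f y - f x) * G y)"
      proof (cases "dist y x < d")
        case True
        from d(2)[OF this] have "norm (f y - f x) * gauss_kernel s (x - y) \<le> \<epsilon> / 2 * gauss_kernel s (x - y)"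
          by (intro mult_right_mono) (auto simp: dist_norm gauss_kernel_nonneg s0)
        thus ?thesis using nn eq by linarith
      next
        case False
        hence "d \<le> norm (x - y)" by (simp add: dist_norm norm_minus_commute)
        from mult_left_mono[OF gauss_kernel_tail[OF s d(1) this], of "norm (f y - f x)"]
        show ?thesis using nn eq by (simp add: G_def c_def mult_ac)
      qed
    qed (use iG s0 iW in auto)
    also have "\<dots> = \<epsilon> / 2 + s ^ DIM('a) * exp (- c * s) * W"
      using iG s0 iW by (simp add: W_def)
    finally show ?thesis .
  qed
  have "((\<lambda>s. \<epsilon> / 2 + s ^ DIM('a) * exp (- c * s) * W) \<longlongrightarrow> \<epsilon> / 2 + 0 * W) at_top"
    by (intro tendsto_intros power_times_exp_decay c)
  hence "\<forall>\<^sub>F s in at_top. \<epsilon> / 2 + s ^ DIM('a) * exp (- c * s) * W < \<epsilon>"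
    by (rule order_tendstoD) (use \<epsilon> in auto)
  thus "\<forall>\<^sub>F s in at_top. dist (LINT y|lborel. f y * complex_of_real (gauss_kernel s (x - y))) (f x) < \<epsilon>"
    using eventually_ge_at_top[of 1] by eventually_elim (use est in fastforce)
qed

text \<open>The multiplication formula for the truncations of \<open>f\<close>, tested against a modulated Gaussian, in
  the limit of infinite radius.\<close>

lemma fourier_L2_gauss:
  fixes f g :: "'a::euclidean_space \<Rightarrow> complex"
  assumes fg: "has_fourier_L2 f g" and s: "s > 0"
  shows "(LINT \<xi>|lborel. g \<xi> * (cis (2 * pi * (x \<bullet> \<xi>)) * complex_of_real (exp (- pi * (norm \<xi>)\<^sup>2 / s\<^sup>2))))
     = (LINT y|lborel. f y * complex_of_real (gauss_kernel s (x - y)))"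
proof -
  have f: "f \<in> L2" and g: "g \<in> L2" using fg by (auto simp: has_fourier_L2_def)
  have [measurable]: "f \<in> borel_measurable borel" "g \<in> borel_measurable borel"
    using f g by (auto simp: L2_def)
  define \<psi> where "\<psi> \<xi> = cis (2 * pi * (x \<bullet> \<xi>)) * complex_of_real (exp (- pi * (norm \<xi>)\<^sup>2 / s\<^sup>2))" for \<xi>
  define G where "G y = complex_of_real (gauss_kernel s (x - y))" for y
  have \<psi>: "integrable lborel \<psi>"
    unfolding \<psi>_def by (rule gaussian_fourier(1)[OF s])
  have [measurable]: "\<psi> \<in> borel_measurable borel" using \<psi> by auto
  have \<psi>2: "integrable lborel (\<lambda>\<xi>. (norm (\<psi> \<xi>))\<^sup>2)"
    using integrable_gauss_sq[OF s, where 'a = 'a] by (simp add: \<psi>_def norm_mult)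
  \<comment> \<open>Modulation turns into translation: the transform of the Gaussian modulated by
    \<open>x\<close> is the kernel centred at \<open>x\<close>.\<close>
  have F\<psi>: "fourier_L1 \<psi> y = G y" for y
  proof -
    have "cis (- 2 * pi * (\<xi> \<bullet> y)) * \<psi> \<xi> = cis (2 * pi * ((x - y) \<bullet> \<xi>)) * complex_of_real (exp (- pi * (norm \<xi>)\<^sup>2 / s\<^sup>2))" for \<xi>
    proof -
      have "- 2 * pi * (\<xi> \<bullet> y) + 2 * pi * (x \<bullet> \<xi>) = 2 * pi * ((x - y) \<bullet> \<xi>)"
        by (simp add: inner_diff_left inner_commute[of \<xi> y] right_diff_distrib)
      thus ?thesis unfolding \<psi>_def mult.assoc[symmetric] cis_mult by simp
    qed
    thus ?thesis unfolding fourier_L1_def G_def using gaussian_fourier(2)[OF s, of "x - y"] by simp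
  qed
  have [measurable]: "(indicator (cball (0::'a) (real n)) :: 'a \<Rightarrow> complex) \<in> borel_measurable borel" for n
    by (intro borel_measurable_indicator) simp
  define fR where "fR n y = indicator (cball 0 (real n)) y * f y" for n y
  have fR: "integrable lborel (fR n)" for n
  proof -
    have "integrable lborel (\<lambda>y::'a. indicator (cball 0 (real n)) y :: real)"
      by (intro integrable_real_indicator emeasure_bounded_finite bounded_cball) simp
    hence "integrable lborel (\<lambda>y::'a. (norm (indicator (cball 0 (real n)) y :: complex))\<^sup>2)"
      by (rule Bochner_Integration.integrable_bound) (auto simp: indicator_def)
    thus ?thesis unfolding fR_def using f by (intro integrable_L2_mult) (auto simp: L2_def intro!: borel_measurable_indicator)
  qed
  \<comment> \<open>The sequence is followed to its limit in two ways, on the side of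
    \<open>f\<close> by dominated convergence and on the side of \<open>g\<close> by convergence in
    the mean; the claim is that both limits agree.\<close>
  define r where "r n = (LINT \<xi>|lborel. fourier_L1 (fR n) \<xi> * \<psi> \<xi>)" for n
  have r_eq: "r n = (LINT y|lborel. fR n y * G y)" for n
    unfolding r_def using fourier_L1_multiplication[OF fR \<psi>] by (simp add: F\<psi>)
  have fG: "integrable lborel (\<lambda>y. f y * G y)"
    unfolding G_def by (rule integrable_L2_gauss[OF f s])
  have 1: "r \<longlonglongrightarrow> (LINT y|lborel. f y * G y)"
    unfolding r_eq
  proof (rule integral_dominated_convergence)
    show "integrable lborel (\<lambda>y. norm (f y * G y))" using fG by simp
    show "(\<lambda>y. f y * G y) \<in> borel_measurable lborel" using fG by simp
    have "G \<in> borel_measurable borel"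
      unfolding G_def gauss_kernel_def by (intro borel_measurable_continuous_onI continuous_intros)
    thus "(\<lambda>y. fR n y * G y) \<in> borel_measurable lborel" for n
      unfolding fR_def by simp
    show "AE y in lborel. norm (fR n y * G y) \<le> norm (f y * G y)" for n
      by (intro AE_I2) (auto simp: fR_def indicator_def norm_mult)
    show "AE y in lborel. (\<lambda>n. fR n y * G y) \<longlonglongrightarrow> f y * G y"
    proof (intro AE_I2 tendsto_eventually)
      fix y :: 'a
      have "\<forall>\<^sub>F n in sequentially. norm y \<le> real n"
        using filterlim_real_sequentially eventually_ge_at_top by (rule eventually_compose_filterlim[rotated])
      thus "\<forall>\<^sub>F n in sequentially. fR n y * G y = f y * G y"
        by eventually_elim (auto simp: fR_def)
    qed
  qed
  define L where "L = (LINT \<xi>|lborel. g \<xi> * \<psi> \<xi>)"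
  have g\<psi>: "integrable lborel (\<lambda>\<xi>. g \<xi> * \<psi> \<xi>)"
    by (rule integrable_L2_mult) (use g \<psi>2 in \<open>auto simp: L2_def\<close>)
  have [measurable]: "fourier_L1 (fR n) \<in> borel_measurable borel" for n
    using borel_measurable_fourier_L1[of "fR n"] fR[of n] by simp
  have f\<psi>: "integrable lborel (\<lambda>\<xi>. fourier_L1 (fR n) \<xi> * \<psi> \<xi>)" for n
  proof (rule Bochner_Integration.integrable_bound)
    show "integrable lborel (\<lambda>\<xi>. complex_of_real (LINT x|lborel. norm (fR n x)) * \<psi> \<xi>)"
      using \<psi> by simp
    show "AE \<xi> in lborel. norm (fourier_L1 (fR n) \<xi> * \<psi> \<xi>) \<le> norm (complex_of_real (LINT x|lborel. norm (fR n x)) * \<psi> \<xi>)"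
      using norm_fourier_L1_le[OF fR, of n] by (auto simp: norm_mult intro!: mult_right_mono)
  qed simp
  define \<Psi> where "\<Psi> = (LINT \<xi>|lborel. (norm (\<psi> \<xi>))\<^sup>2)"
  define D where "D n = (\<integral>\<^sup>+ \<xi>. ennreal ((norm (g \<xi> - fourier_L1 (fR n) \<xi>))\<^sup>2) \<partial>lborel)" for n
  have \<Psi>: "\<Psi> \<ge> 0" by (simp add: \<Psi>_def)
  have D: "D \<longlonglongrightarrow> 0"
    using filterlim_compose[OF _ filterlim_real_sequentially] fg
    unfolding has_fourier_L2_def D_def fR_def by blast
  have est: "ennreal (norm (L - r n)) \<le> ennreal c * D n + ennreal (\<Psi> / c)" if c: "c > 0" for c n
  proof -
    have "L - r n = (LINT \<xi>|lborel. (g \<xi> - fourier_L1 (fR n) \<xi>) * \<psi> \<xi>)"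
      unfolding L_def r_def left_diff_distrib
      by (rule Bochner_Integration.integral_diff[symmetric, OF g\<psi> f\<psi>])
    moreover have "integrable lborel (\<lambda>\<xi>. (g \<xi> - fourier_L1 (fR n) \<xi>) * \<psi> \<xi>)"
      unfolding left_diff_distrib by (rule Bochner_Integration.integrable_diff[OF g\<psi> f\<psi>])
    ultimately have "ennreal (norm (L - r n)) \<le> (\<integral>\<^sup>+\<xi>. norm ((g \<xi> - fourier_L1 (fR n) \<xi>) * \<psi> \<xi>) \<partial>lborel)"
      using integral_norm_bound_ennreal by simp
    also have "\<dots> \<le> (\<integral>\<^sup>+\<xi>. ennreal c * ennreal ((norm (g \<xi> - fourier_L1 (fR n) \<xi>))\<^sup>2) + ennreal ((norm (\<psi> \<xi>))\<^sup>2 / c) \<partial>lborel)"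
    proof (intro nn_integral_mono)
      fix \<xi>
      define a where "a = norm (g \<xi> - fourier_L1 (fR n) \<xi>)"
      define b where "b = norm (\<psi> \<xi>)"
      have ab: "a \<ge> 0" "b \<ge> 0" by (auto simp: a_def b_def)
      \<comment> \<open>A weighted AM-GM inequality replaces Cauchy-Schwarz.\<close>
      have "0 \<le> (c * a - b)\<^sup>2 / c + a * b" using c ab by simp
      also have "(c * a - b)\<^sup>2 / c + a * b = c * a\<^sup>2 + b\<^sup>2 / c - a * b"
        using c by (simp add: field_simps power2_eq_square)
      finally have "a * b \<le> c * a\<^sup>2 + b\<^sup>2 / c" by simp
      hence "ennreal (a * b) \<le> ennreal (c * a\<^sup>2 + b\<^sup>2 / c)" by (rule ennreal_leI)
      also have "\<dots> = ennreal (c * a\<^sup>2) + ennreal (b\<^sup>2 / c)" using c by (intro ennreal_plus) auto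
      finally show "ennreal (norm ((g \<xi> - fourier_L1 (fR n) \<xi>) * \<psi> \<xi>)) \<le>
        ennreal c * ennreal ((norm (g \<xi> - fourier_L1 (fR n) \<xi>))\<^sup>2) + ennreal ((norm (\<psi> \<xi>))\<^sup>2 / c)"
        using c by (simp add: norm_mult ennreal_mult a_def b_def)
    qed
    also have "\<dots> = ennreal c * D n + (\<integral>\<^sup>+\<xi>. ennreal ((norm (\<psi> \<xi>))\<^sup>2 / c) \<partial>lborel)"
      unfolding D_def by (subst nn_integral_add) (auto simp: nn_integral_cmult)
    also have "(\<integral>\<^sup>+\<xi>. ennreal ((norm (\<psi> \<xi>))\<^sup>2 / c) \<partial>lborel) = ennreal (\<Psi> / c)"
      using \<psi>2 c by (subst nn_integral_eq_integral) (auto simp: \<Psi>_def)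
    finally show ?thesis .
  qed
  have 2: "r \<longlonglongrightarrow> L"
  proof (rule tendstoI)
    fix \<kappa> :: real assume \<kappa>: "\<kappa> > 0"
    \<comment> \<open>First \<open>c\<close> is taken so large that
      \<open>\<Psi> / c < \<kappa> / 2\<close>, and then \<open>n\<close> so large that
      \<open>c * D n\<close> is below \<open>\<kappa> / 2\<close>.\<close>
    define c where "c = 2 * \<Psi> / \<kappa> + 1"
    have c: "c > 0" using \<Psi> \<kappa> by (simp add: c_def add_nonneg_pos)
    have "\<Psi> / c < \<kappa> / 2" using c \<Psi> \<kappa> by (simp add: c_def field_simps)
    have "\<forall>\<^sub>F n in sequentially. D n < ennreal (\<kappa> / (2 * c))"
      by (rule order_tendstoD(2)[OF D]) (use \<kappa> c in auto)
    thus "\<forall>\<^sub>F n in sequentially. dist (r n) L < \<kappa>"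
    proof eventually_elim
      case (elim n)
      have "ennreal (norm (L - r n)) \<le> ennreal c * ennreal (\<kappa> / (2 * c)) + ennreal (\<Psi> / c)"
        by (rule order_trans[OF est[OF c]]) (use elim in \<open>auto intro!: add_mono mult_left_mono\<close>)
      also have "\<dots> = ennreal (\<kappa> / 2 + \<Psi> / c)"
        using c \<kappa> \<Psi> by (simp flip: ennreal_mult ennreal_plus)
      finally have "ennreal (norm (L - r n)) \<le> ennreal (\<kappa> / 2 + \<Psi> / c)" .
      hence "norm (L - r n) \<le> \<kappa> / 2 + \<Psi> / c"
        by (rule ennreal_le_iff[THEN iffD1, rotated]) (use c \<kappa> \<Psi> in simp)
      hence "norm (L - r n) < \<kappa>" using \<open>\<Psi> / c < \<kappa> / 2\<close> by linarith
      thus ?case by (simp add: dist_norm norm_minus_commute)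
    qed
  qed
  show ?thesis using LIMSEQ_unique[OF 2 1] unfolding L_def \<psi>_def G_def .
qed

text \<open>Let the Gaussian parameter tend to infinity in \<open>fourier_L2_gauss\<close>: the side
  of \<open>f\<close> tends to \<open>f x\<close> by continuity at \<open>x\<close>, the side of
  \<open>g\<close> to the inversion integral by dominated convergence with bound
  \<open>norm (g \<xi>)\<close>.\<close>

lemma fourier_L2_inversion:
  fixes f g :: "'a::euclidean_space \<Rightarrow> complex"
  assumes fg: "has_fourier_L2 f g" and g: "integrable lborel g" and cont: "isCont f x"
  shows "f x = (LINT \<xi>|lborel. cis (2 * pi * (x \<bullet> \<xi>)) * g \<xi>)"
proof -
  define E where "E n \<xi> = g \<xi> * (cis (2 * pi * (x \<bullet> \<xi>)) * complex_of_real (exp (- pi * (norm \<xi>)\<^sup>2 / (real (Suc n))\<^sup>2)))" for n \<xi>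
  have lim: "filterlim (\<lambda>n. real (Suc n)) at_top sequentially"
    by (rule filterlim_compose[OF filterlim_real_sequentially filterlim_Suc])
  have f: "f \<in> L2" using fg by (simp add: has_fourier_L2_def)
  have "(\<lambda>n. LINT \<xi>|lborel. E n \<xi>) \<longlonglongrightarrow> f x"
    using filterlim_compose[OF gauss_approx_identity[OF f cont] lim]
    unfolding E_def by (simp only: fourier_L2_gauss[OF fg] of_nat_0_less_iff zero_less_Suc)
  moreover have "(\<lambda>n. LINT \<xi>|lborel. E n \<xi>) \<longlonglongrightarrow> (LINT \<xi>|lborel. g \<xi> * cis (2 * pi * (x \<bullet> \<xi>)))"
  proof (rule integral_dominated_convergence)
    have [measurable]: "(\<lambda>\<xi>. cis (2 * pi * (x \<bullet> \<xi>))) \<in> borel_measurable borel"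
      unfolding cis_conv_exp by (intro borel_measurable_continuous_onI continuous_intros)
    have [measurable]: "g \<in> borel_measurable borel" using g by auto
    show "E n \<in> borel_measurable lborel" for n unfolding E_def by measurable
    show "(\<lambda>\<xi>. g \<xi> * cis (2 * pi * (x \<bullet> \<xi>))) \<in> borel_measurable lborel" by measurable
    show "integrable lborel (\<lambda>\<xi>. norm (g \<xi>))" using g by simp
    show "AE \<xi> in lborel. norm (E n \<xi>) \<le> norm (g \<xi>)" for n
      by (intro AE_I2) (auto simp: E_def norm_mult intro!: mult_left_le)
    show "AE \<xi> in lborel. (\<lambda>n. E n \<xi>) \<longlonglongrightarrow> g \<xi> * cis (2 * pi * (x \<bullet> \<xi>))"
    proof (intro AE_I2)
      fix \<xi> :: 'a
      have "(\<lambda>n. - pi * (norm \<xi>)\<^sup>2 / (real (Suc n))\<^sup>2) \<longlonglongrightarrow> 0"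
        by (intro tendsto_divide_0[OF tendsto_const] filterlim_at_top_imp_at_infinity filterlim_pow_at_top lim) simp
      hence "(\<lambda>n. E n \<xi>) \<longlonglongrightarrow> g \<xi> * (cis (2 * pi * (x \<bullet> \<xi>)) * complex_of_real (exp 0))"
        unfolding E_def by (intro tendsto_intros)
      thus "(\<lambda>n. E n \<xi>) \<longlonglongrightarrow> g \<xi> * cis (2 * pi * (x \<bullet> \<xi>))" by simp
    qed
  qed
  ultimately show ?thesis using LIMSEQ_unique by (simp add: mult.commute)
qed

section \<open>Regularity of Sobolev functions\<close>

lemma nn_integral_decay_real:
  "(\<integral>\<^sup>+x. ennreal ((1 + \<bar>x\<bar>) powr (- (3/2))) \<partial>(lborel :: real measure)) \<le> 4"
proof -
  have h: "(\<integral>\<^sup>+x. ennreal ((1 + x) powr (- (3/2))) * indicator {0..} x \<partial>lborel) = ennreal (0 - (- 2 * (1 + 0) powr (- (1/2))))"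
  proof (rule nn_integral_FTC_atLeast)
    fix x :: real assume "0 \<le> x"
    thus "((\<lambda>x. - 2 * (1 + x) powr (- (1/2))) has_real_derivative (1 + x) powr (- (3/2))) (at x)"
      by (auto intro!: derivative_eq_intros)
  next
    have "((\<lambda>x::real. (1 + x) powr (- (1/2))) \<longlongrightarrow> 0) at_top"
      by (intro tendsto_neg_powr filterlim_tendsto_add_at_top[OF tendsto_const filterlim_ident]) auto
    thus "((\<lambda>x::real. - 2 * (1 + x) powr (- (1/2))) \<longlongrightarrow> 0) at_top"
      using tendsto_mult[OF tendsto_const[of "- 2"]] by fastforce
  qed auto
  have "(\<integral>\<^sup>+x. ennreal ((1 + \<bar>x\<bar>) powr (- (3/2))) \<partial>lborel) \<le>
    (\<integral>\<^sup>+x. ennreal ((1 + x) powr (- (3/2))) * indicator {0..} x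
       + ennreal ((1 + (0 + (-1) * x)) powr (- (3/2))) * indicator {0..} (0 + (-1) * x) \<partial>lborel)"
    by (intro nn_integral_mono) (auto simp: indicator_def)
  also have "\<dots> = (\<integral>\<^sup>+x. ennreal ((1 + x) powr (- (3/2))) * indicator {0..} x \<partial>lborel)
       + (\<integral>\<^sup>+x. ennreal ((1 + (0 + (-1) * x)) powr (- (3/2))) * indicator {0..} (0 + (-1) * x) \<partial>lborel)"
    by (intro nn_integral_add) auto
  also have "(\<integral>\<^sup>+x. ennreal ((1 + (0 + (-1) * x)) powr (- (3/2))) * indicator {0..} (0 + (-1) * x) \<partial>lborel)
      = (\<integral>\<^sup>+x. ennreal ((1 + x) powr (- (3/2))) * indicator {0..} x \<partial>lborel)"
    by (subst (2) nn_integral_real_affine[where c = "-1" and t = 0]) auto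
  finally show ?thesis unfolding h by (simp flip: ennreal_plus)
qed

text \<open>The third power is distributed over the four coordinates, \<open>3 / 4\<close> to each.
  As \<open>1 + (norm \<xi>)\<^sup>2\<close> dominates half of
  \<open>(1 + \<bar>\<xi> \<bullet> b\<bar>)\<^sup>2\<close>, the integrand is at most a product of
  four one-dimensional functions with exponent \<open>- 3 / 2\<close>; the factor 2 in
  \<open>\<phi>\<close> covers the loss \<open>2 powr (3 / 4)\<close>.\<close>

lemma nn_integral_decay_R4:
  "(\<integral>\<^sup>+\<xi>. ennreal (1 / (1 + (norm \<xi>)\<^sup>2) ^ 3) \<partial>(lborel :: (real^4) measure)) < \<infinity>"
proof -
  define \<phi> :: "real \<Rightarrow> real" where "\<phi> x = 2 * (1 + \<bar>x\<bar>) powr (- (3/2))" for x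
  have b: "(1 + (norm \<xi>)\<^sup>2) powr (- (3/4)) \<le> \<phi> (\<xi> \<bullet> b)" if "b \<in> Basis" for \<xi> b :: "real^4"
  proof -
    define v where "v = 1 + \<bar>\<xi> \<bullet> b\<bar>"
    have v: "v \<ge> 1" by (simp add: v_def)
    have "\<bar>\<xi> \<bullet> b\<bar>\<^sup>2 \<le> (norm \<xi>)\<^sup>2" using Basis_le_norm[OF that, of \<xi>] by (intro power_mono) auto
    moreover have "2 * \<bar>\<xi> \<bullet> b\<bar> \<le> 1 + \<bar>\<xi> \<bullet> b\<bar>\<^sup>2" using sum_squares_bound[of 1 "\<bar>\<xi> \<bullet> b\<bar>"] by simp
    moreover have "v\<^sup>2 = 1 + 2 * \<bar>\<xi> \<bullet> b\<bar> + \<bar>\<xi> \<bullet> b\<bar>\<^sup>2" by (simp add: v_def power2_sum)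
    ultimately have "v\<^sup>2 / 2 \<le> 1 + (norm \<xi>)\<^sup>2" by linarith
    hence "(1 + (norm \<xi>)\<^sup>2) powr (- (3/4)) \<le> (v\<^sup>2 / 2) powr (- (3/4))"
      using v by (intro powr_mono2') auto
    also have "\<dots> = (v powr 2) powr (- (3/4)) * 2 powr (3/4)"
      using v by (simp add: powr_divide powr_minus divide_simps)
    also have "(v powr 2) powr (- (3/4)) = v powr (- (3/2))" by (simp add: powr_powr)
    also have "v powr (- (3/2)) * 2 powr (3/4) \<le> v powr (- (3/2)) * 2 powr 1"
      by (intro mult_left_mono powr_mono) auto
    finally show ?thesis by (simp add: \<phi>_def v_def)
  qed
  have "(\<integral>\<^sup>+\<xi>. ennreal (1 / (1 + (norm \<xi>)\<^sup>2) ^ 3) \<partial>(lborel :: (real^4) measure))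
     \<le> (\<integral>\<^sup>+\<xi>. (\<Prod>b\<in>Basis. ennreal (\<phi> (\<xi> \<bullet> b))) \<partial>(lborel :: (real^4) measure))"
  proof (intro nn_integral_mono)
    fix \<xi> :: "real^4"
    define q where "q = 1 + (norm \<xi>)\<^sup>2"
    have q: "q > 0" by (simp add: q_def add_pos_nonneg)
    have "(q powr (- (3/4))) powr 4 = q powr (- 3)" by (simp add: powr_powr)
    moreover have "q powr (- 3) = 1 / q ^ 3" using q by (simp add: powr_minus divide_simps)
    ultimately have "1 / q ^ 3 = (q powr (- (3/4))) powr 4" by simp
    also have "\<dots> = (q powr (- (3/4))) ^ 4" using q by simp
    also have "\<dots> = (\<Prod>b\<in>(Basis :: (real^4) set). q powr (- (3/4)))" by simp
    also have "\<dots> \<le> (\<Prod>b\<in>Basis. \<phi> (\<xi> \<bullet> b))"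
      by (intro prod_mono) (use b in \<open>auto simp: q_def\<close>)
    finally show "ennreal (1 / (1 + (norm \<xi>)\<^sup>2) ^ 3) \<le> (\<Prod>b\<in>Basis. ennreal (\<phi> (\<xi> \<bullet> b)))"
      by (subst prod_ennreal) (auto simp: q_def \<phi>_def intro!: ennreal_leI)
  qed
  also have "\<dots> = (\<Prod>b\<in>(Basis :: (real^4) set). (\<integral>\<^sup>+x. ennreal (\<phi> x) \<partial>lborel))"
    by (rule nn_integral_lborel_prod) (auto simp: \<phi>_def)
  also have "\<dots> = (\<integral>\<^sup>+x. ennreal (\<phi> x) \<partial>lborel) ^ 4" by simp
  also have "\<dots> < \<infinity>"
  proof -
    have "(\<integral>\<^sup>+x. ennreal (\<phi> x) \<partial>lborel) = 2 * (\<integral>\<^sup>+x. ennreal ((1 + \<bar>x\<bar>) powr (- (3/2))) \<partial>(lborel :: real measure))"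
      unfolding \<phi>_def by (subst nn_integral_cmult[symmetric]) (auto simp: ennreal_mult')
    also have "\<dots> \<le> 2 * 4" by (intro mult_left_mono nn_integral_decay_real) auto
    also have "\<dots> < \<infinity>" by (simp add: ennreal_mult_less_top)
    finally show ?thesis by (simp add: power_less_top_ennreal)
  qed
  finally show ?thesis .
qed

text \<open>With \<open>q = 1 + (norm \<xi>)\<^sup>2\<close>, write
  \<open>sqrt q * norm (g \<xi>)\<close> as \<open>q\<^sup>2 * norm (g \<xi>)\<close> times
  \<open>1 / (q * sqrt q)\<close> and bound the product by the sum of squares. The first square is
  below the Sobolev integrand because \<open>s > 4\<close>, the second is \<open>1 / q ^ 3\<close>;
  \<open>sqrt q\<close> dominates both 1 and \<open>norm \<xi>\<close>.\<close>

lemma Hs_transform_integrable: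
  fixes g :: "real^4 \<Rightarrow> complex"
  assumes [measurable]: "g \<in> borel_measurable lborel" and s: "s > 4"
    and fin: "(\<integral>\<^sup>+ \<xi>. ennreal ((1 + 4 * pi\<^sup>2 * (norm \<xi>)\<^sup>2) powr s * (norm (g \<xi>))\<^sup>2) \<partial>lborel) < \<infinity>"
  shows "integrable lborel g" "integrable lborel (\<lambda>\<xi>. norm \<xi> * norm (g \<xi>))"
proof -
  define w where "w \<xi> = (1 + 4 * pi\<^sup>2 * (norm \<xi>)\<^sup>2) powr s * (norm (g \<xi>))\<^sup>2" for \<xi>
  define m where "m (\<xi>::real^4) = 1 / (1 + (norm \<xi>)\<^sup>2) ^ 3" for \<xi>
  have [measurable]: "norm \<in> borel_measurable (borel :: (real^4) measure)" by simp
  have [measurable]: "w \<in> borel_measurable borel" "m \<in> borel_measurable borel"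
    using assms(1) unfolding w_def m_def by measurable
  have w: "integrable lborel w"
    by (rule integrableI_nonneg) (use fin in \<open>auto simp: w_def\<close>)
  have m: "integrable lborel m"
    by (rule integrableI_nonneg) (use nn_integral_decay_R4 in \<open>auto simp: m_def\<close>)
  have key: "sqrt (1 + (norm \<xi>)\<^sup>2) * norm (g \<xi>) \<le> w \<xi> + m \<xi>" for \<xi>
  proof -
    define q where "q = 1 + (norm \<xi>)\<^sup>2"
    have q: "q \<ge> 1" by (simp add: q_def)
    have "1 \<le> pi\<^sup>2" using pi_gt3 by (intro one_le_power) auto
    hence "1 \<le> 4 * pi\<^sup>2" by simp
    hence "1 * (norm \<xi>)\<^sup>2 \<le> 4 * pi\<^sup>2 * (norm \<xi>)\<^sup>2"
      by (intro mult_right_mono) auto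
    hence q2: "q \<le> 1 + 4 * pi\<^sup>2 * (norm \<xi>)\<^sup>2" by (simp add: q_def)
    have "q ^ 4 = q powr 4" using q by simp
    also have "\<dots> \<le> q powr s" using q s by (intro powr_mono) auto
    also have "\<dots> \<le> (1 + 4 * pi\<^sup>2 * (norm \<xi>)\<^sup>2) powr s" using q q2 s by (intro powr_mono2) auto
    finally have w': "q ^ 4 * (norm (g \<xi>))\<^sup>2 \<le> w \<xi>" unfolding w_def by (intro mult_right_mono) auto
    define a where "a = q\<^sup>2 * norm (g \<xi>)"
    define b where "b = 1 / (q * sqrt q)"
    have ab: "a \<ge> 0" "b \<ge> 0" using q by (auto simp: a_def b_def)
    have "sqrt q * norm (g \<xi>) = a * b"
      using q by (simp add: a_def b_def field_simps power2_eq_square)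
    also have "\<dots> \<le> a\<^sup>2 + b\<^sup>2"
      using sum_squares_bound[of a b] mult_nonneg_nonneg[OF ab] by linarith
    also have "a\<^sup>2 = q ^ 4 * (norm (g \<xi>))\<^sup>2" by (simp add: a_def power_mult_distrib flip: power_mult)
    also have "b\<^sup>2 = m \<xi>" using q by (simp add: b_def m_def q_def power_mult_distrib power_divide power2_eq_square power3_eq_cube)
    finally show ?thesis using w' by (simp add: q_def)
  qed
  have sq: "1 \<le> sqrt (1 + (norm \<xi>)\<^sup>2)" "norm \<xi> \<le> sqrt (1 + (norm \<xi>)\<^sup>2)" for \<xi> :: "real^4"
    by (auto intro: real_le_rsqrt)
  show "integrable lborel g"
  proof (rule Bochner_Integration.integrable_bound[OF Bochner_Integration.integrable_add[OF w m]])
    show "AE \<xi> in lborel. norm (g \<xi>) \<le> norm (w \<xi> + m \<xi>)"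
    proof (intro AE_I2)
      fix \<xi> show "norm (g \<xi>) \<le> norm (w \<xi> + m \<xi>)"
        using key[of \<xi>] mult_right_mono[OF sq(1)[of \<xi>], of "norm (g \<xi>)"] by simp
    qed
  qed simp
  show "integrable lborel (\<lambda>\<xi>. norm \<xi> * norm (g \<xi>))"
  proof (rule Bochner_Integration.integrable_bound[OF Bochner_Integration.integrable_add[OF w m]])
    show "AE \<xi> in lborel. norm (norm \<xi> * norm (g \<xi>)) \<le> norm (w \<xi> + m \<xi>)"
    proof (intro AE_I2)
      fix \<xi> show "norm (norm \<xi> * norm (g \<xi>)) \<le> norm (w \<xi> + m \<xi>)"
        using key[of \<xi>] mult_right_mono[OF sq(2)[of \<xi>], of "norm (g \<xi>)"] by simp
    qed
  qed simp
qed

section \<open>Differentiation of the inverse transform\<close>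

lemma cis_difference_quotient:
  assumes k: "k \<longlonglongrightarrow> (0::real)" "\<And>n. k n \<noteq> 0"
  shows "(\<lambda>n. (cis (a * k n) - 1) / complex_of_real (k n)) \<longlonglongrightarrow> \<i> * complex_of_real a"
proof -
  have "((\<lambda>z. exp (\<i> * complex_of_real a * z)) has_field_derivative \<i> * complex_of_real a) (at 0)"
    by (auto intro!: derivative_eq_intros)
  hence "((\<lambda>z. (exp (\<i> * complex_of_real a * (0 + z)) - exp (\<i> * complex_of_real a * 0)) / z) \<longlongrightarrow> \<i> * complex_of_real a) (at 0)"
    by (rule DERIV_D)
  moreover have "filterlim (\<lambda>n. complex_of_real (k n)) (at 0) sequentially"
    unfolding filterlim_at using k tendsto_of_real[OF k(1), where 'a = complex] by auto
  ultimately have "(\<lambda>n. (exp (\<i> * complex_of_real a * (0 + complex_of_real (k n))) - exp (\<i> * complex_of_real a * 0)) / complex_of_real (k n)) \<longlonglongrightarrow> \<i> * complex_of_real a"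
    by (rule filterlim_compose)
  thus ?thesis by (simp add: cis_conv_exp mult.assoc)
qed

definition inv_fourier :: "('a::euclidean_space \<Rightarrow> complex) \<Rightarrow> 'a \<Rightarrow> complex" where
  "inv_fourier g x = (LINT \<xi>|lborel. cis (2 * pi * (x \<bullet> \<xi>)) * g \<xi>)"

lemma borel_measurable_cis_inner [measurable]:
  "(\<lambda>\<xi>::'a::euclidean_space. cis (c * (x \<bullet> \<xi>))) \<in> borel_measurable borel"
  unfolding cis_conv_exp by (intro borel_measurable_continuous_onI continuous_intros)

lemma norm_inv_fourier_le:
  "norm (inv_fourier g x) \<le> (LINT \<xi>|lborel. norm (g \<xi>))"
  unfolding inv_fourier_def by (rule order_trans[OF integral_norm_bound]) (simp add: norm_mult)

lemma continuous_inv_fourier: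
  fixes g :: "'a::euclidean_space \<Rightarrow> complex"
  assumes g: "integrable lborel g"
  shows "continuous_on A (inv_fourier g)"
proof -
  have [measurable]: "g \<in> borel_measurable borel" using g by auto
  have "isCont (inv_fourier g) x" for x
    unfolding continuous_at_sequentially comp_def inv_fourier_def
  proof (intro allI impI)
    fix X assume X: "X \<longlonglongrightarrow> x"
    show "(\<lambda>n. LINT \<xi>|lborel. cis (2 * pi * (X n \<bullet> \<xi>)) * g \<xi>) \<longlonglongrightarrow> (LINT \<xi>|lborel. cis (2 * pi * (x \<bullet> \<xi>)) * g \<xi>)"
    proof (rule integral_dominated_convergence)
      show "integrable lborel (\<lambda>\<xi>. norm (g \<xi>))" using g by simp
      show "AE \<xi> in lborel. (\<lambda>n. cis (2 * pi * (X n \<bullet> \<xi>)) * g \<xi>) \<longlonglongrightarrow> cis (2 * pi * (x \<bullet> \<xi>)) * g \<xi>"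
        unfolding cis_conv_exp by (intro AE_I2 tendsto_intros X)
    qed (auto simp: norm_mult)
  qed
  thus ?thesis by (simp add: continuous_at_imp_continuous_on)
qed

text \<open>Differentiation under the integral along an arbitrary null sequence. The bound
  \<open>norm (cis \<theta> - 1) \<le> \<bar>\<theta>\<bar>\<close> dominates the difference
  quotients by a multiple of \<open>norm \<xi> * norm (g \<xi>)\<close>.\<close>

lemma inv_fourier_deriv:
  fixes g :: "'a::euclidean_space \<Rightarrow> complex"
  assumes g: "integrable lborel g" and g1: "integrable lborel (\<lambda>\<xi>. norm \<xi> * norm (g \<xi>))"
  defines "h e \<equiv> inv_fourier (\<lambda>\<xi>. \<i> * complex_of_real (2 * pi * (e \<bullet> \<xi>)) * g \<xi>)"
  shows "((\<lambda>t. Re (inv_fourier g (x + t *\<^sub>R e))) has_real_derivative Re (h e (x + t *\<^sub>R e))) (at t)"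
    "continuous_on A (h e)"
proof -
  have [measurable]: "g \<in> borel_measurable borel" using g by auto
  have ig: "integrable lborel (\<lambda>\<xi>. \<i> * complex_of_real (2 * pi * (e \<bullet> \<xi>)) * g \<xi>)"
  proof (rule Bochner_Integration.integrable_bound)
    show "integrable lborel (\<lambda>\<xi>. 2 * pi * norm e * (norm \<xi> * norm (g \<xi>)))" using g1 by simp
    show "AE \<xi> in lborel. norm (\<i> * complex_of_real (2 * pi * (e \<bullet> \<xi>)) * g \<xi>) \<le> norm (2 * pi * norm e * (norm \<xi> * norm (g \<xi>)))"
    proof (intro AE_I2)
      fix \<xi>
      have "\<bar>e \<bullet> \<xi>\<bar> * norm (g \<xi>) \<le> norm e * norm \<xi> * norm (g \<xi>)"
        by (intro mult_right_mono Cauchy_Schwarz_ineq2) auto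
      thus "norm (\<i> * complex_of_real (2 * pi * (e \<bullet> \<xi>)) * g \<xi>) \<le> norm (2 * pi * norm e * (norm \<xi> * norm (g \<xi>)))"
        by (simp add: norm_mult abs_mult mult_ac)
    qed
  qed simp
  thus "continuous_on A (h e)" unfolding h_def by (rule continuous_inv_fourier)
  define y where "y = x + t *\<^sub>R e"
  have ic: "integrable lborel (\<lambda>\<xi>. cis (2 * pi * (z \<bullet> \<xi>)) * g \<xi>)" for z
    by (rule Bochner_Integration.integrable_bound[OF g]) (auto simp: norm_mult)
  have lim: "(\<lambda>n. (inv_fourier g (y + k n *\<^sub>R e) - inv_fourier g y) / complex_of_real (k n)) \<longlonglongrightarrow> h e y"
    if k: "k \<longlonglongrightarrow> 0" "\<And>n. k n \<noteq> 0" for k :: "nat \<Rightarrow> real"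
  proof -
    define Q where "Q n \<xi> = cis (2 * pi * (y \<bullet> \<xi>)) * (g \<xi> * ((cis (2 * pi * (e \<bullet> \<xi>) * k n) - 1) / complex_of_real (k n)))" for n \<xi>
    have "(inv_fourier g (y + k n *\<^sub>R e) - inv_fourier g y) / complex_of_real (k n) = (LINT \<xi>|lborel. Q n \<xi>)" for n
    proof -
      have "(inv_fourier g (y + k n *\<^sub>R e) - inv_fourier g y) / complex_of_real (k n) =
         (LINT \<xi>|lborel. (cis (2 * pi * ((y + k n *\<^sub>R e) \<bullet> \<xi>)) * g \<xi> - cis (2 * pi * (y \<bullet> \<xi>)) * g \<xi>) / complex_of_real (k n))"
        unfolding inv_fourier_def by (simp add: ic)
      also have "\<dots> = (LINT \<xi>|lborel. Q n \<xi>)"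
      proof (intro Bochner_Integration.integral_cong refl)
        fix \<xi>
        have "2 * pi * ((y + k n *\<^sub>R e) \<bullet> \<xi>) = 2 * pi * (y \<bullet> \<xi>) + 2 * pi * (e \<bullet> \<xi>) * k n"
          by (simp add: inner_add_left algebra_simps)
        hence "cis (2 * pi * ((y + k n *\<^sub>R e) \<bullet> \<xi>)) = cis (2 * pi * (y \<bullet> \<xi>)) * cis (2 * pi * (e \<bullet> \<xi>) * k n)"
          by (simp add: cis_mult)
        thus "(cis (2 * pi * ((y + k n *\<^sub>R e) \<bullet> \<xi>)) * g \<xi> - cis (2 * pi * (y \<bullet> \<xi>)) * g \<xi>) / complex_of_real (k n) = Q n \<xi>"
          by (simp add: Q_def algebra_simps diff_divide_distrib)
      qed
      finally show ?thesis .
    qed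
    moreover have "(\<lambda>n. LINT \<xi>|lborel. Q n \<xi>) \<longlonglongrightarrow>
       (LINT \<xi>|lborel. cis (2 * pi * (y \<bullet> \<xi>)) * (\<i> * complex_of_real (2 * pi * (e \<bullet> \<xi>)) * g \<xi>))"
    proof (rule integral_dominated_convergence)
      show "integrable lborel (\<lambda>\<xi>. 2 * pi * norm e * (norm \<xi> * norm (g \<xi>)))" using g1 by simp
      have "(\<lambda>\<xi>. cis (2 * pi * (e \<bullet> \<xi>) * k n)) \<in> borel_measurable borel" for n
        unfolding cis_conv_exp by (intro borel_measurable_continuous_onI continuous_intros)
      thus "Q n \<in> borel_measurable lborel" for n unfolding Q_def by measurable
      show "AE \<xi> in lborel. norm (Q n \<xi>) \<le> 2 * pi * norm e * (norm \<xi> * norm (g \<xi>))" for n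
      proof (intro AE_I2)
        fix \<xi>
        have "norm (cis (2 * pi * (e \<bullet> \<xi>) * k n) - 1) \<le> \<bar>2 * pi * (e \<bullet> \<xi>) * k n\<bar>"
          using iexp_approx1[of "2 * pi * (e \<bullet> \<xi>) * k n" 0] by (simp add: cis_conv_exp)
        hence "norm ((cis (2 * pi * (e \<bullet> \<xi>) * k n) - 1) / complex_of_real (k n)) \<le> 2 * pi * \<bar>e \<bullet> \<xi>\<bar>"
          using k(2)[of n] by (simp add: norm_divide divide_simps abs_mult)
        also have "\<dots> \<le> 2 * pi * (norm e * norm \<xi>)"
          by (intro mult_left_mono Cauchy_Schwarz_ineq2) auto
        finally have "norm (g \<xi>) * norm ((cis (2 * pi * (e \<bullet> \<xi>) * k n) - 1) / complex_of_real (k n)) \<le> norm (g \<xi>) * (2 * pi * (norm e * norm \<xi>))"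
          by (intro mult_left_mono) auto
        moreover have "norm (Q n \<xi>) = norm (g \<xi>) * norm ((cis (2 * pi * (e \<bullet> \<xi>) * k n) - 1) / complex_of_real (k n))"
          unfolding Q_def norm_mult norm_cis by (rule mult_1)
        moreover have "norm (g \<xi>) * (2 * pi * (norm e * norm \<xi>)) = 2 * pi * norm e * (norm \<xi> * norm (g \<xi>))" by simp
        ultimately show "norm (Q n \<xi>) \<le> 2 * pi * norm e * (norm \<xi> * norm (g \<xi>))" by simp
      qed
      show "AE \<xi> in lborel. (\<lambda>n. Q n \<xi>) \<longlonglongrightarrow> cis (2 * pi * (y \<bullet> \<xi>)) * (\<i> * complex_of_real (2 * pi * (e \<bullet> \<xi>)) * g \<xi>)"
      proof (intro AE_I2)
        fix \<xi>
        have "(\<lambda>n. Q n \<xi>) \<longlonglongrightarrow> cis (2 * pi * (y \<bullet> \<xi>)) * (g \<xi> * (\<i> * complex_of_real (2 * pi * (e \<bullet> \<xi>))))"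
          unfolding Q_def by (intro tendsto_intros cis_difference_quotient k)
        thus "(\<lambda>n. Q n \<xi>) \<longlonglongrightarrow> cis (2 * pi * (y \<bullet> \<xi>)) * (\<i> * complex_of_real (2 * pi * (e \<bullet> \<xi>)) * g \<xi>)"
          by (simp only: mult.commute)
      qed
    qed simp
    ultimately show ?thesis unfolding h_def inv_fourier_def[of "\<lambda>\<xi>. \<i> * _ \<xi> * g \<xi>"] by simp
  qed
  show "((\<lambda>t. Re (inv_fourier g (x + t *\<^sub>R e))) has_real_derivative Re (h e (x + t *\<^sub>R e))) (at t)"
    unfolding DERIV_def tendsto_at_iff_sequentially comp_def
  proof (intro allI impI)
    fix k :: "nat \<Rightarrow> real" assume k: "\<forall>i. k i \<in> UNIV - {0}" "k \<longlonglongrightarrow> 0"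
    have "(\<lambda>n. Re ((inv_fourier g (y + k n *\<^sub>R e) - inv_fourier g y) / complex_of_real (k n))) \<longlonglongrightarrow> Re (h e y)"
      by (intro tendsto_Re lim) (use k in auto)
    thus "(\<lambda>n. (Re (inv_fourier g (x + (t + k n) *\<^sub>R e)) - Re (inv_fourier g (x + t *\<^sub>R e))) / k n) \<longlonglongrightarrow> Re (h e (x + t *\<^sub>R e))"
      by (simp add: y_def scaleR_left_distrib add.assoc Re_divide_of_real)
  qed
qed

text \<open>Continuity makes the inversion formula hold at every point, so \<open>f\<close> inherits
  boundedness and continuous directional derivatives \<open>D e\<close> from the inverse
  transform.\<close>

lemma Hs_regularity:
  fixes f :: "real^4 \<Rightarrow> real"
  assumes Hs: "(\<lambda>x. complex_of_real (f x)) \<in> Hs s" and s: "s > 4" and cont: "continuous_on UNIV f"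
  obtains D B where
    "\<And>x e t. ((\<lambda>t. f (x + t *\<^sub>R e)) has_real_derivative D e (x + t *\<^sub>R e)) (at t)"
    "\<And>e. continuous_on UNIV (D e)" "\<And>x. \<bar>f x\<bar> \<le> B"
proof -
  obtain g where fg: "has_fourier_L2 (\<lambda>x. complex_of_real (f x)) g"
    and fin: "(\<integral>\<^sup>+ \<xi>. ennreal ((1 + 4 * pi\<^sup>2 * (norm \<xi>)\<^sup>2) powr s * (norm (g \<xi>))\<^sup>2) \<partial>lborel) < \<infinity>"
    using Hs by (auto simp: Hs_def)
  have "g \<in> borel_measurable lborel" using fg by (auto simp: has_fourier_L2_def L2_def)
  note g = Hs_transform_integrable[OF this s fin]
  have "isCont (\<lambda>x. complex_of_real (f x)) x" for x
    using cont by (simp add: continuous_on_eq_continuous_at)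
  from fourier_L2_inversion[OF fg g(1) this]
  have f: "complex_of_real (f x) = inv_fourier g x" for x by (simp add: inv_fourier_def)
  hence f': "f x = Re (inv_fourier g x)" for x by (metis Re_complex_of_real)
  define D where "D e x = Re (inv_fourier (\<lambda>\<xi>. \<i> * complex_of_real (2 * pi * (e \<bullet> \<xi>)) * g \<xi>) x)" for e x
  show ?thesis
  proof (rule that[of D])
    show "((\<lambda>t. f (x + t *\<^sub>R e)) has_real_derivative D e (x + t *\<^sub>R e)) (at t)" for x e t
      unfolding f' D_def by (rule inv_fourier_deriv[OF g])
    show "continuous_on UNIV (D e)" for e
      unfolding D_def by (intro continuous_intros inv_fourier_deriv[OF g])
    show "\<bar>f x\<bar> \<le> (LINT \<xi>|lborel. norm (g \<xi>))" for x
      using norm_inv_fourier_le[of g x] f[of x] by (metis norm_of_real)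
  qed
qed

section \<open>Reduction of the vector field to the half-plane\<close>

text \<open>The half-plane placed in \<open>\<real>^4\<close> as \<open>x2 = x3 = 0\<close>. While
  \<open>ur\<close> and \<open>uz\<close> are meaningful for \<open>r > 0\<close> only,
  \<open>u\<close> along this plane is available for all real \<open>r\<close>, as
  \<open>axis_estimate\<close> requires.\<close>

definition meridian :: "real \<Rightarrow> real \<Rightarrow> real^4" where
  "meridian r z = r *\<^sub>R axis 1 1 + z *\<^sub>R axis 4 1"

lemma meridian_nth [simp]:
  "meridian r z $ 1 = r" "meridian r z $ 2 = 0" "meridian r z $ 3 = 0" "meridian r z $ 4 = z"
  by (simp_all add: meridian_def axis_def)

lemma vector_4_nth [simp]:
  "(vector [a, b, c, d] :: real^4) $ 1 = a" "(vector [a, b, c, d] :: real^4) $ 2 = b"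
  "(vector [a, b, c, d] :: real^4) $ 3 = c" "(vector [a, b, c, d] :: real^4) $ 4 = d"
  unfolding vector_def by simp_all

lemma axisymmetric_components:
  assumes "axisymmetric_no_swirl u ur uz" "rad x > 0"
  shows "u x $ 1 = ur (rad x) (x $ 4) * (x $ 1 / rad x)" "u x $ 2 = ur (rad x) (x $ 4) * (x $ 2 / rad x)"
    "u x $ 3 = ur (rad x) (x $ 4) * (x $ 3 / rad x)" "u x $ 4 = uz (rad x) (x $ 4)"
  using assms by (simp_all add: axisymmetric_no_swirl_def e_r_def e_z_def)

lemma axisymmetric_meridian:
  assumes "axisymmetric_no_swirl u ur uz" "r > 0"
  shows "u (meridian r z) $ 1 = ur r z" "u (meridian r z) $ 4 = uz r z"
proof -
  have "rad (meridian r z) = r" using assms by (simp add: rad_def)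
  thus "u (meridian r z) $ 1 = ur r z" "u (meridian r z) $ 4 = uz r z"
    using axisymmetric_components[OF assms(1), of "meridian r z"] assms(2) by simp_all
qed

text \<open>Source of the term \<open>2 * ur / r\<close> in the divergence. Moving by
  \<open>t\<close> in direction 2 or 3 changes the radius to
  \<open>\<rho> t = sqrt (r\<^sup>2 + t\<^sup>2)\<close>, which is stationary at 0; only the
  rotation of \<open>e_r\<close>, the factor \<open>t / \<rho> t\<close>, contributes to the
  derivative.\<close>

lemma deriv_angular:
  assumes ax: "axisymmetric_no_swirl u ur uz" and r: "r > 0" and i: "i = 2 \<or> i = 3"
    and d: "((\<lambda>\<rho>. u (meridian \<rho> z) $ 1) has_real_derivative d) (at r)"
  shows "deriv (\<lambda>t. u (meridian r z + t *\<^sub>R axis i 1) $ i) 0 = ur r z / r"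
proof (rule DERIV_imp_deriv)
  define \<rho> where "\<rho> t = sqrt (r\<^sup>2 + t\<^sup>2)" for t
  have \<rho>: "\<rho> t > 0" for t unfolding \<rho>_def using r by (simp add: add_pos_nonneg)
  have \<rho>0: "\<rho> 0 = r" using r by (simp add: \<rho>_def)
  have "u (meridian r z + t *\<^sub>R axis i 1) $ i = u (meridian (\<rho> t) z) $ 1 * (t / \<rho> t)" for t
  proof -
    define x where "x = meridian r z + t *\<^sub>R (axis i 1 :: real^4)"
    have x: "rad x = \<rho> t" "x $ 4 = z" "x $ i = t"
      using i by (auto simp: x_def rad_def \<rho>_def axis_def)
    have "u x $ i = ur (rad x) (x $ 4) * (x $ i / rad x)"
      using axisymmetric_components[OF ax, of x] x(1) \<rho>[of t] i by auto
    thus ?thesis using axisymmetric_meridian(1)[OF ax \<rho>] by (simp add: x x_def[symmetric])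
  qed
  moreover have "((\<lambda>t. u (meridian (\<rho> t) z) $ 1 * (t / \<rho> t)) has_real_derivative
      (d * 0) * (0 / \<rho> 0) + (1 * \<rho> 0 - 0 * 0) / (\<rho> 0 * \<rho> 0) * u (meridian (\<rho> 0) z) $ 1) (at 0)"
  proof (intro DERIV_mult DERIV_divide DERIV_ident)
    show *: "(\<rho> has_real_derivative 0) (at 0)"
      unfolding \<rho>_def using r by (auto intro!: derivative_eq_intros)
    show "((\<lambda>t. u (meridian (\<rho> t) z) $ 1) has_real_derivative d * 0) (at 0)"
      by (rule DERIV_chain2[OF _ *]) (simp add: \<rho>0 d)
  qed (use \<rho>[of 0] in simp)
  ultimately show "((\<lambda>t. u (meridian r z + t *\<^sub>R axis i 1) $ i) has_real_derivative ur r z / r) (at 0)"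
    using r by (simp add: \<rho>0 axisymmetric_meridian(1)[OF ax r])
qed

lemma nn_integral_lborel_translate:
  fixes c :: "'a::euclidean_space"
  assumes "f \<in> borel_measurable borel"
  shows "(\<integral>\<^sup>+x. f x \<partial>lborel) = (\<integral>\<^sup>+x. f (c + x) \<partial>lborel)"
  by (subst lborel_distr_plus[of c, symmetric], subst nn_integral_distr) (use assms in auto)

lemma axisymmetric_bound:
  assumes s: "s > 4" and u: "u \<in> Hs_field s" and cont: "continuous_on UNIV u"
    and div: "\<And>x. divergence u x = 0" and ax: "axisymmetric_no_swirl u ur uz"
    and L: "(\<lambda>(r, z). scalar_vorticity ur uz r z / r\<^sup>2) \<in> lorentz21 half_plane_measure"
    and p: "p > 0"
  shows "ennreal \<bar>ur p q / p\<bar> \<le> ennreal (441 / 8 * sqrt 2048) *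
    lorentz21_norm half_plane_measure (\<lambda>(r, z). scalar_vorticity ur uz r z / r\<^sup>2)"
proof -
  define \<eta> where "\<eta> = (\<lambda>(r, z). scalar_vorticity ur uz r z / r\<^sup>2)"
  have Hs: "(\<lambda>x. complex_of_real (u x $ i)) \<in> Hs s" for i using u by (simp add: Hs_field_def)
  have ci: "continuous_on UNIV (\<lambda>x. u x $ i)" for i by (intro continuous_intros cont)
  obtain D1 B1 where 1: "\<And>x e t. ((\<lambda>t. u (x + t *\<^sub>R e) $ 1) has_real_derivative D1 e (x + t *\<^sub>R e)) (at t)"
    "\<And>e. continuous_on UNIV (D1 e)" "\<And>x. \<bar>u x $ 1\<bar> \<le> B1"
    using Hs_regularity[OF Hs s ci, of 1] by metis
  obtain D4 B4 where 4: "\<And>x e t. ((\<lambda>t. u (x + t *\<^sub>R e) $ 4) has_real_derivative D4 e (x + t *\<^sub>R e)) (at t)"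
    "\<And>e. continuous_on UNIV (D4 e)" "\<And>x. \<bar>u x $ 4\<bar> \<le> B4"
    using Hs_regularity[OF Hs s ci, of 4] by metis
  define e1 e4 :: "real^4" where "e1 = axis 1 1" and "e4 = axis 4 1"
  have mer: "meridian 0 z + r *\<^sub>R e1 = meridian r z" "meridian r 0 + z *\<^sub>R e4 = meridian r z" for r z
    by (simp_all add: meridian_def e1_def e4_def)
  have dr1: "((\<lambda>r. u (meridian r z) $ 1) has_real_derivative D1 e1 (meridian r z)) (at r)" for r z
    using 1(1)[of "meridian 0 z" e1 r] by (simp add: mer)
  have dr4: "((\<lambda>r. u (meridian r z) $ 4) has_real_derivative D4 e1 (meridian r z)) (at r)" for r z
    using 4(1)[of "meridian 0 z" e1 r] by (simp add: mer)
  have dz1: "((\<lambda>z. u (meridian r z) $ 1) has_real_derivative D1 e4 (meridian r z)) (at z)" for r z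
    using 1(1)[of "meridian r 0" e4 z] by (simp add: mer)
  have dz4: "((\<lambda>z. u (meridian r z) $ 4) has_real_derivative D4 e4 (meridian r z)) (at z)" for r z
    using 4(1)[of "meridian r 0" e4 z] by (simp add: mer)
  have shift: "((\<lambda>w. h (q + w)) has_real_derivative d) (at w)"
    if "(h has_real_derivative d) (at (q + w))" for h d w
    using DERIV_shift[of h d w q] that by (simp add: add.commute)
  have cm: "continuous_on A (\<lambda>x. meridian (fst x) (q + snd x))" for A
    unfolding meridian_def by (intro continuous_intros)
  have comp: "continuous_on UNIV (\<lambda>x. h (meridian (fst x) (q + snd x)))"
    if "continuous_on UNIV h" for h :: "real^4 \<Rightarrow> real"
    by (rule continuous_on_compose2[OF that cm]) auto
  have divr: "r * D1 e1 (meridian r z) + 2 * u (meridian r z) $ 1 + r * D4 e4 (meridian r z) = 0"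
    if r: "r > 0" for r z
  proof -
    have "deriv (\<lambda>t. u (meridian r z + t *\<^sub>R e1) $ 1) 0 = D1 e1 (meridian r z)"
      "deriv (\<lambda>t. u (meridian r z + t *\<^sub>R e4) $ 4) 0 = D4 e4 (meridian r z)"
      using DERIV_imp_deriv[OF 1(1)[of "meridian r z" e1 0]] DERIV_imp_deriv[OF 4(1)[of "meridian r z" e4 0]]
      by simp_all
    hence "D1 e1 (meridian r z) + ur r z / r + ur r z / r + D4 e4 (meridian r z) = 0"
      using div[of "meridian r z"] deriv_angular[OF ax r _ dr1[of z r]]
      unfolding divergence_def UNIV_4 e1_def e4_def by simp
    hence "r * (D1 e1 (meridian r z) + ur r z / r + ur r z / r + D4 e4 (meridian r z)) = 0" by simp
    thus ?thesis using r axisymmetric_meridian(1)[OF ax r, of z] by (simp add: algebra_simps)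
  qed
  have vort: "scalar_vorticity ur uz r z = D4 e1 (meridian r z) - D1 e4 (meridian r z)" if r: "r > 0" for r z
  proof -
    \<comment> \<open>\<open>uz\<close> agrees with the component of \<open>u\<close> for positive
      radius only, but this is an open set around \<open>r\<close>.\<close>
    have "((\<lambda>\<rho>. uz \<rho> z) has_real_derivative D4 e1 (meridian r z)) (at r)"
      by (rule has_field_derivative_transform_within_open[OF dr4, of "{0<..}"])
         (use r axisymmetric_meridian(2)[OF ax] in auto)
    moreover have "((\<lambda>\<zeta>. ur r \<zeta>) has_real_derivative D1 e4 (meridian r z)) (at z)"
      using dz1[of r z] axisymmetric_meridian(1)[OF ax r] by simp
    ultimately show ?thesis unfolding scalar_vorticity_def by (simp add: DERIV_imp_deriv)
  qed
  \<comment> \<open>A continuous function on the whole plane that agrees with the vorticity for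
    \<open>r > 0\<close>, by \<open>vort\<close>.\<close>
  define om where "om x = D4 e1 (meridian (fst x) (snd x)) - D1 e4 (meridian (fst x) (snd x))" for x
  have [measurable]: "om \<in> borel_measurable borel"
  proof -
    have cm': "continuous_on UNIV (\<lambda>x. meridian (fst x) (snd x))"
      unfolding meridian_def by (intro continuous_intros)
    show ?thesis unfolding om_def
      by (intro borel_measurable_continuous_onI continuous_intros
          continuous_on_compose2[OF 4(2) cm'] continuous_on_compose2[OF 1(2) cm']) auto
  qed
  have \<eta>[measurable]: "\<eta> \<in> borel_measurable half_plane_measure"
    and fin: "lorentz21_norm half_plane_measure \<eta> < \<infinity>"
    using L by (auto simp: lorentz21_def \<eta>_def)
  have weight_meas[measurable]: "ring_weight p q \<in> borel_measurable half_plane_measure"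
    unfolding half_plane_measure_def by (simp add: measurable_restrict_space1)
  have H[measurable]: "{0<..} \<times> UNIV \<in> sets (borel :: (real \<times> real) measure)"
    by (intro borel_open open_Times) auto
  define I where "I = enn2real (ennreal (sqrt 2048) * lorentz21_norm half_plane_measure \<eta>)"
  have I: "ennreal I = ennreal (sqrt 2048) * lorentz21_norm half_plane_measure \<eta>"
    unfolding I_def using fin by (subst ennreal_enn2real) (auto simp: ennreal_mult_less_top)
  \<comment> \<open>The vorticity is \<open>r\<^sup>2\<close> times \<open>\<eta>\<close>, and this
    factor is the density of \<open>half_plane_measure\<close>.\<close>
  have "(\<integral>\<^sup>+x\<in>{0<..} \<times> UNIV. ennreal (\<bar>om x\<bar> * ring_weight p q x) \<partial>lborel) =
     (\<integral>\<^sup>+x\<in>{0<..} \<times> UNIV. ennreal ((fst x)\<^sup>2) * ennreal (\<bar>\<eta> x\<bar> * ring_weight p q x) \<partial>lborel)"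
  proof (intro nn_integral_cong)
    fix x :: "real \<times> real"
    show "ennreal (\<bar>om x\<bar> * ring_weight p q x) * indicator ({0<..} \<times> UNIV) x =
      ennreal ((fst x)\<^sup>2) * ennreal (\<bar>\<eta> x\<bar> * ring_weight p q x) * indicator ({0<..} \<times> UNIV) x"
    proof (cases "fst x > 0")
      case True
      hence "\<bar>om x\<bar> * ring_weight p q x = (fst x)\<^sup>2 * (\<bar>\<eta> x\<bar> * ring_weight p q x)"
        using vort[of "fst x" "snd x"] by (simp add: \<eta>_def om_def case_prod_unfold)
      hence "ennreal (\<bar>om x\<bar> * ring_weight p q x) = ennreal ((fst x)\<^sup>2) * ennreal (\<bar>\<eta> x\<bar> * ring_weight p q x)"
        by (simp only: ennreal_mult' zero_le_power2)
      thus ?thesis by (simp only:)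
    qed (auto simp: indicator_def)
  qed
  also have "\<dots> = (\<integral>\<^sup>+x. ennreal (\<bar>\<eta> x\<bar> * ring_weight p q x) \<partial>half_plane_measure)"
    by (rule nn_integral_half_plane[symmetric]) measurable
  also have "\<dots> \<le> ennreal I"
    unfolding I
    by (rule lorentz21_duality[OF sigma_finite_half_plane \<eta> weight_meas ring_weight_nonneg _ ring_weight_weak_L2[OF p]]) auto
  finally have "(\<integral>\<^sup>+x\<in>{0<..} \<times> UNIV. ennreal (\<bar>om x\<bar> * ring_weight p q x) \<partial>lborel) \<le> ennreal I" .
  \<comment> \<open>Translation by \<open>q\<close> along the axis preserves the half-plane and
    moves the centre of the weight to height 0, where \<open>axis_estimate\<close> is
    stated.\<close>
  also have "(\<integral>\<^sup>+x\<in>{0<..} \<times> UNIV. ennreal (\<bar>om x\<bar> * ring_weight p q x) \<partial>lborel) =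
    (\<integral>\<^sup>+x\<in>{0<..} \<times> UNIV. ennreal (\<bar>om ((0, q) + x)\<bar> * ring_weight p 0 x) \<partial>lborel)"
    by (subst nn_integral_lborel_translate[of _ "(0, q)"], measurable)
       (intro nn_integral_cong, auto simp: ring_weight_def indicator_def)
  finally have bound: "(\<integral>\<^sup>+x\<in>{0<..} \<times> UNIV. ennreal (\<bar>D4 e1 (meridian (fst x) (q + snd x)) -
      D1 e4 (meridian (fst x) (q + snd x))\<bar> * ring_weight p 0 x) \<partial>lborel) \<le> ennreal I"
    by (simp add: om_def)
  have "8 / 441 * \<bar>u (meridian p (q + 0)) $ 1\<bar> \<le> p * I"
  proof (rule axis_estimate[OF p, where a = "\<lambda>r w. u (meridian r (q + w)) $ 1" and b = "\<lambda>r w. u (meridian r (q + w)) $ 4"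
        and ar = "\<lambda>r w. D1 e1 (meridian r (q + w))" and az = "\<lambda>r w. D1 e4 (meridian r (q + w))"
        and br = "\<lambda>r w. D4 e1 (meridian r (q + w))" and bz = "\<lambda>r w. D4 e4 (meridian r (q + w))"
        and M = "max B1 B4"])
    show "I \<ge> 0" by (simp add: I_def)
    show "\<bar>u (meridian r (q + w)) $ 1\<bar> \<le> max B1 B4" "\<bar>u (meridian r (q + w)) $ 4\<bar> \<le> max B1 B4" for r w
      using 1(3) 4(3) by (simp_all add: le_max_iff_disj)
  qed (intro dr1 dr4 shift dz1 dz4 comp ci 1(2) 4(2) divr bound; assumption?)+
  hence "\<bar>ur p q\<bar> \<le> 441 / 8 * (p * I)" using axisymmetric_meridian(1)[OF ax p] by simp
  hence "\<bar>ur p q / p\<bar> \<le> 441 / 8 * I" using p by (simp add: field_simps)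
  hence "ennreal \<bar>ur p q / p\<bar> \<le> ennreal (441 / 8) * ennreal I"
    by (subst ennreal_mult'[symmetric]) (auto intro: ennreal_leI)
  also have "\<dots> = ennreal (441 / 8 * sqrt 2048) * lorentz21_norm half_plane_measure \<eta>"
    unfolding I by (subst ennreal_mult) (auto simp: mult.assoc)
  finally show ?thesis by (simp add: \<eta>_def)
qed

theorem theorem2p5:
  shows "\<exists>C::real. C > 0 \<and>
    (\<forall>(s::real) (u :: real^4 \<Rightarrow> real^4) (ur :: real \<Rightarrow> real \<Rightarrow> real) (uz :: real \<Rightarrow> real \<Rightarrow> real).
       s > 4 \<longrightarrow>
       u \<in> Hs_field s \<longrightarrow> continuous_on UNIV u \<longrightarrow>
       (\<forall>x. divergence u x = 0) \<longrightarrow>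
       axisymmetric_no_swirl u ur uz \<longrightarrow>
       (\<lambda>(r, z). scalar_vorticity ur uz r z / r\<^sup>2) \<in> lorentz21 half_plane_measure \<longrightarrow>
       Linf_norm lborel (\<lambda>x::real^4. ur (rad x) (x$4) / rad x)
         \<le> ennreal C * lorentz21_norm half_plane_measure
             (\<lambda>(r, z). scalar_vorticity ur uz r z / r\<^sup>2))"
proof (intro exI[of _ "441 / 8 * sqrt 2048"] conjI allI impI)
  fix s u ur uz
  assume A: "s > 4" "u \<in> Hs_field s" "continuous_on UNIV u" "\<forall>x. divergence u x = 0"
    "axisymmetric_no_swirl u ur uz" "(\<lambda>(r, z). scalar_vorticity ur uz r z / r\<^sup>2) \<in> lorentz21 half_plane_measure"
  have rad: "rad x \<ge> 0" for x by (simp add: rad_def)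
  \<comment> \<open>Nothing is known about the measurability of \<open>ur\<close>, so the quotient
    is expressed through the continuous field \<open>u\<close>. On the axis both sides are 0, by
    division by 0.\<close>
  have eq: "ur (rad x) (x$4) / rad x = (u x $ 1 * x $ 1 + u x $ 2 * x $ 2 + u x $ 3 * x $ 3) / (rad x)\<^sup>2" for x
  proof (cases "rad x = 0")
    case False
    hence r: "rad x > 0" using rad[of x] by linarith
    have "u x $ 1 * x $ 1 + u x $ 2 * x $ 2 + u x $ 3 * x $ 3 =
        ur (rad x) (x $ 4) / rad x * ((x $ 1)\<^sup>2 + (x $ 2)\<^sup>2 + (x $ 3)\<^sup>2)"
      unfolding axisymmetric_components[OF A(5) r] by (simp add: power2_eq_square algebra_simps add_divide_distrib)
    also have "(x $ 1)\<^sup>2 + (x $ 2)\<^sup>2 + (x $ 3)\<^sup>2 = (rad x)\<^sup>2" by (simp add: rad_def)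
    finally show ?thesis using r by simp
  qed simp
  have [measurable]: "(\<lambda>x. ur (rad x) (x$4) / rad x) \<in> borel_measurable borel"
    unfolding eq unfolding rad_def
    by (intro borel_measurable_divide borel_measurable_continuous_onI continuous_intros A(3))
  have "(\<lambda>x. ennreal \<bar>ur (rad x) (x$4) / rad x\<bar>) \<in> borel_measurable lborel" by measurable
  moreover have "ennreal \<bar>ur (rad x) (x$4) / rad x\<bar> \<le> ennreal (441 / 8 * sqrt 2048) *
    lorentz21_norm half_plane_measure (\<lambda>(r, z). scalar_vorticity ur uz r z / r\<^sup>2)" for x
    \<comment> \<open>On the axis the quotient is 0 by division by 0, so the bound holds at every
      point.\<close>
    using axisymmetric_bound[OF A(1-3) _ A(5,6), of "rad x" "x $ 4"] A(4) rad[of x]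
    by (cases "rad x = 0") auto
  ultimately show "Linf_norm lborel (\<lambda>x::real^4. ur (rad x) (x$4) / rad x)
         \<le> ennreal (441 / 8 * sqrt 2048) * lorentz21_norm half_plane_measure
             (\<lambda>(r, z). scalar_vorticity ur uz r z / r\<^sup>2)"
    unfolding Linf_norm_def by (intro esssup_I AE_I2)
qed simp

end
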